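(* Let $\alpha>0$ and let $\Omega\subset\mathbb R^2$ be a regular set. Then, as $\lambda\to\infty$, $$F_{\lambda,\alpha}(\Omega)=\left(1-\frac{1}{2\pi\alpha^2}\right)P(\Omega)+\frac{1}{8\pi\alpha^4\lambda^2}\int_{\partial\Omega}\kappa^2\,\mathrm d\mathcal H^1+o(\lambda^{-2}).$$
   Context: A set is called regular if it is a bounded open set with boundary of class $C^\infty$. $P(\Omega)$ is the perimeter of $\Omega$ and $\kappa$ the curvature of $\partial\Omega$. For $\lambda,\alpha>0$, $$F_{\lambda,\alpha}(\Omega):=P(\Omega)-\frac{\lambda^2}{4\pi}\int_\Omega\int_{\mathbb R^2\setminus\Omega}\frac{e^{-\lambda\alpha|x-y|}}{|x-y|}\,\mathrm d^2y\,\mathrm d^2x .$$ Here $\alpha$ and $\Omega$ are fixed in the limit $\lambda\to\infty$. *)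

theory Defs
  imports "HOL-Analysis.Analysis" "HOL-Library.Landau_Symbols"
begin

section \<open>Regular sets\<close>

definition smooth_real :: "(real \<Rightarrow> real) \<Rightarrow> bool" where
  "smooth_real g \<longleftrightarrow> (\<forall>k x. (deriv ^^ k) g differentiable (at x))"

text \<open>
  The boundary is of class \<open>C\<^sup>\<infinity>\<close> if, near each of its points and in suitable orthonormal
  coordinates, the set is the region strictly above the graph of a \<open>C\<^sup>\<infinity>\<close> function. In particular
  the set lies on one side of its boundary. Asking for \<open>g\<close> on the whole line is no restriction:
  a local \<open>g\<close> can be cut off after shrinking \<open>r\<close>.
\<close>

definition smooth_boundary :: "(real^2) set \<Rightarrow> bool" where
  "smooth_boundary \<Omega> \<longleftrightarrow>
     (\<forall>p\<in>frontier \<Omega>. \<exists>r>0. \<exists>e n g. norm e = 1 \<and> norm n = 1 \<and> e \<bullet> n = 0 \<and> smooth_real g \<and>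
        \<Omega> \<inter> ball p r = {x \<in> ball p r. x \<bullet> n > g (x \<bullet> e)})"

definition regular_set :: "(real^2) set \<Rightarrow> bool" where
  "regular_set \<Omega> \<longleftrightarrow> bounded \<Omega> \<and> open \<Omega> \<and> smooth_boundary \<Omega>"


section \<open>Perimeter\<close>

definition divergence :: "(real^2 \<Rightarrow> real^2) \<Rightarrow> real^2 \<Rightarrow> real" where
  "divergence \<phi> x = (\<Sum>i\<in>UNIV. frechet_derivative \<phi> (at x) (axis i 1) $ i)"

definition C1_compact_support :: "(real^2 \<Rightarrow> real^2) \<Rightarrow> bool" where
  "C1_compact_support \<phi> \<longleftrightarrow>
     (\<forall>x. \<phi> differentiable (at x)) \<and>
     (\<forall>v. continuous_on UNIV (\<lambda>x. frechet_derivative \<phi> (at x) v)) \<and>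
     compact (closure {x. \<phi> x \<noteq> 0})"

text \<open>
  De Giorgi's perimeter. The truncation of negative reals by \<^const>\<open>ennreal\<close> is harmless, since
  \<open>\<phi> = 0\<close> is admissible.
\<close>

definition perimeter :: "(real^2) set \<Rightarrow> ennreal" where
  "perimeter E =
     (SUP \<phi>\<in>{\<phi>. C1_compact_support \<phi> \<and> (\<forall>x. norm (\<phi> x) \<le> 1)}.
        ennreal (LINT x:E|lebesgue. divergence \<phi> x))"


section \<open>One-dimensional Hausdorff measure\<close>

text \<open>
  The \<^const>\<open>bounded\<close> clause is needed because \<^const>\<open>diameter\<close> is unspecified on unbounded sets.
\<close>

definition hausdorff1_pre :: "real \<Rightarrow> 'a::metric_space set \<Rightarrow> ennreal" where
  "hausdorff1_pre d A =
     (INF U\<in>{U::nat \<Rightarrow> 'a set. A \<subseteq> (\<Union>i. U i) \<and> (\<forall>i. bounded (U i) \<and> diameter (U i) \<le> d)}.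
        \<Sum>i. ennreal (diameter (U i)))"

definition hausdorff1_outer :: "'a::metric_space set \<Rightarrow> ennreal" where
  "hausdorff1_outer A = (SUP d\<in>{0<..}. hausdorff1_pre d A)"

definition hausdorff1 :: "'a::metric_space measure" where
  "hausdorff1 = measure_of UNIV (sets borel) hausdorff1_outer"


text \<open>
  \<^const>\<open>hausdorff1_outer\<close> is a metric outer measure, hence countably additive on the Borel sets.
  So \<^const>\<open>measure_of\<close> does not fall back to the zero measure.
\<close>

lemma hausdorff1_pre_mono: "A \<subseteq> B \<Longrightarrow> hausdorff1_pre d A \<le> hausdorff1_pre d B"
  unfolding hausdorff1_pre_def by (rule INF_superset_mono) auto

lemma hausdorff1_pre_antimono: "d \<le> d' \<Longrightarrow> hausdorff1_pre d' A \<le> hausdorff1_pre d A"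
  unfolding hausdorff1_pre_def by (rule INF_superset_mono) (auto intro: order_trans)

lemma hausdorff1_pre_le:
  "A \<subseteq> (\<Union>i. U i) \<Longrightarrow> (\<And>i. bounded (U i)) \<Longrightarrow> (\<And>i. diameter (U i) \<le> d) \<Longrightarrow>
     hausdorff1_pre d A \<le> (\<Sum>i. ennreal (diameter (U i)))"
  unfolding hausdorff1_pre_def by (rule INF_lower) auto

lemma hausdorff1_pre_close:
  assumes "hausdorff1_pre d A < e"
  obtains U where "A \<subseteq> (\<Union>i::nat. U i)" "\<And>i. bounded (U i)" "\<And>i. diameter (U i) \<le> d"
    "(\<Sum>i. ennreal (diameter (U i))) < e"
  using assms unfolding hausdorff1_pre_def INF_less_iff by auto

lemma hausdorff1_pre_countably_subadditive:
  "hausdorff1_pre d (\<Union>i::nat. A i) \<le> (\<Sum>i. hausdorff1_pre d (A i))"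
proof (rule ennreal_le_epsilon)
  fix e :: real assume "0 < e" "(\<Sum>n. hausdorff1_pre d (A n)) < top"
  then have *: "\<And>n. hausdorff1_pre d (A n) < hausdorff1_pre d (A n) + e * (1/2)^Suc n"
    by (auto simp add: less_top dest!: ennreal_suminf_lessD)
  have "\<exists>U. A n \<subseteq> (\<Union>i::nat. U i) \<and> (\<forall>i. bounded (U i) \<and> diameter (U i) \<le> d) \<and>
          (\<Sum>i. ennreal (diameter (U i))) \<le> hausdorff1_pre d (A n) + e * (1/2)^Suc n" for n
    using hausdorff1_pre_close[OF *[of n]] by (metis less_imp_le)
  then obtain B where B: "\<And>n. A n \<subseteq> (\<Union>i::nat. B n i)"
      "\<And>n i. bounded (B n i)" "\<And>n i. diameter (B n i) \<le> d"
      "\<And>n. (\<Sum>i. ennreal (diameter (B n i))) \<le> hausdorff1_pre d (A n) + e * (1/2)^Suc n"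
    by metis
  define C where "C = case_prod B o prod_decode"
  have AC: "(\<Union>i. A i) \<subseteq> (\<Union>i. C i)"
    using B(1) by (auto simp add: C_def subset_eq) (metis prod.case prod_encode_inverse)
  have "hausdorff1_pre d (\<Union>i. A i) \<le> (\<Sum>i. ennreal (diameter (C i)))"
    using B(2,3) by (intro hausdorff1_pre_le[OF AC]) (auto simp: C_def split_def)
  also have "\<dots> = (\<Sum>i. (\<lambda>p. ennreal (diameter (case_prod B p))) (prod_decode i))"
    by (simp add: C_def)
  also have "\<dots> = (\<Sum>n. \<Sum>i. ennreal (diameter (B n i)))"
    by (rule suminf_ennreal_2dimen) simp
  also have "\<dots> \<le> (\<Sum>n. hausdorff1_pre d (A n) + e * (1/2) ^ Suc n)"
    by (intro suminf_le allI B(4)) auto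
  also have "\<dots> = (\<Sum>n. hausdorff1_pre d (A n)) + (\<Sum>n. ennreal e * ennreal ((1/2) ^ Suc n))"
    using \<open>0 < e\<close> by (subst suminf_add[symmetric])
                     (auto simp del: ennreal_suminf_cmult simp add: ennreal_mult[symmetric])
  also have "\<dots> = (\<Sum>n. hausdorff1_pre d (A n)) + e"
    unfolding ennreal_suminf_cmult
    by (subst suminf_ennreal_eq[OF zero_le_power power_half_series]) auto
  finally show "hausdorff1_pre d (\<Union>i. A i) \<le> (\<Sum>n. hausdorff1_pre d (A n)) + e" .
qed

lemma hausdorff1_outer_mono: "A \<subseteq> B \<Longrightarrow> hausdorff1_outer A \<le> hausdorff1_outer B"
  unfolding hausdorff1_outer_def by (intro SUP_mono) (auto intro: hausdorff1_pre_mono)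

lemma hausdorff1_outer_empty: "hausdorff1_outer {} = 0"
proof -
  have "hausdorff1_pre d {} \<le> 0" if "0 < d" for d :: real
    using hausdorff1_pre_le[of "{}" "\<lambda>_. {}" d] that by simp
  then show ?thesis
    unfolding hausdorff1_outer_def by (metis SUP_least greaterThan_iff le_zero_eq)
qed

lemma hausdorff1_outer_countably_subadditive:
  "hausdorff1_outer (\<Union>i::nat. A i) \<le> (\<Sum>i. hausdorff1_outer (A i))"
proof (unfold hausdorff1_outer_def[of "\<Union>i. A i"], rule SUP_least)
  fix d :: real assume "d \<in> {0<..}"
  then have "hausdorff1_pre d (A i) \<le> hausdorff1_outer (A i)" for i
    unfolding hausdorff1_outer_def by (intro SUP_upper)
  then show "hausdorff1_pre d (\<Union>i. A i) \<le> (\<Sum>i. hausdorff1_outer (A i))"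
    by (intro order_trans[OF hausdorff1_pre_countably_subadditive] suminf_le) auto
qed

lemma outer_measure_space_hausdorff1:
  "outer_measure_space (Pow UNIV) (hausdorff1_outer :: 'a::metric_space set \<Rightarrow> ennreal)"
  unfolding outer_measure_space_def positive_def increasing_def countably_subadditive_def
  by (auto simp: hausdorff1_outer_empty hausdorff1_outer_countably_subadditive
      intro: hausdorff1_outer_mono)

lemma hausdorff1_outer_subadditive:
  "hausdorff1_outer (A \<union> B) \<le> hausdorff1_outer A + hausdorff1_outer B"
proof -
  have "hausdorff1_outer (\<Union>i::nat. if i = 0 then A else if i = 1 then B else {}) \<le>
        (\<Sum>i. hausdorff1_outer (if i = 0 then A else if i = 1 then B else {}))"
    by (rule hausdorff1_outer_countably_subadditive)
  also have "\<dots> = (\<Sum>i\<in>{0,1::nat}. hausdorff1_outer (if i = 0 then A else if i = 1 then B else {}))"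
    by (rule suminf_finite) (auto simp: hausdorff1_outer_empty)
  also have "(\<Union>i::nat. if i = 0 then A else if i = 1 then B else {}) = A \<union> B"
    by (auto split: if_splits)
  finally show ?thesis by simp
qed

lemma hausdorff1_outer_metric:
  assumes "e > 0" and sep: "\<And>a b. a \<in> A \<Longrightarrow> b \<in> B \<Longrightarrow> e \<le> dist a b"
  shows "hausdorff1_outer A + hausdorff1_outer B \<le> hausdorff1_outer (A \<union> B)"
proof -
  have pre: "hausdorff1_pre d A + hausdorff1_pre d B \<le> hausdorff1_pre d (A \<union> B)"
    if d: "0 < d" "d < e" for d
    unfolding hausdorff1_pre_def[of d "A \<union> B"]
  proof (safe intro!: INF_greatest)
    fix U :: "nat \<Rightarrow> 'a set"
    assume U: "A \<union> B \<subseteq> (\<Union>i. U i)" "\<forall>i. bounded (U i) \<and> diameter (U i) \<le> d"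
    define V where "V S i = (if U i \<inter> S = {} then {} else U i)" for S i
    have *: "hausdorff1_pre d S \<le> (\<Sum>i. ennreal (diameter (V S i)))" if "S \<subseteq> A \<union> B" for S
      using U that d by (intro hausdorff1_pre_le) (auto simp: V_def subset_eq, blast)
    have "V A i = {} \<or> V B i = {}" for i
    proof (rule ccontr)
      assume "\<not> ?thesis"
      then obtain a b where ab: "a \<in> A" "b \<in> B" "a \<in> U i" "b \<in> U i"
        by (auto simp: V_def split: if_splits)
      then have "dist a b \<le> d"
        using U(2) diameter_bounded_bound by (meson order_trans)
      then show False using sep[OF ab(1,2)] d by simp
    qed
    then have le: "ennreal (diameter (V A i)) + ennreal (diameter (V B i)) \<le> ennreal (diameter (U i))" for i
      by (metis V_def add.right_neutral add.left_neutral diameter_empty ennreal_0 order_refl zero_le)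
    have "hausdorff1_pre d A + hausdorff1_pre d B \<le>
        (\<Sum>i. ennreal (diameter (V A i))) + (\<Sum>i. ennreal (diameter (V B i)))"
      by (intro add_mono *) auto
    also have "\<dots> = (\<Sum>i. ennreal (diameter (V A i)) + ennreal (diameter (V B i)))"
      by (rule suminf_add) auto
    also have "\<dots> \<le> (\<Sum>i. ennreal (diameter (U i)))"
      by (intro suminf_le allI le) auto
    finally show "hausdorff1_pre d A + hausdorff1_pre d B \<le> (\<Sum>i. ennreal (diameter (U i)))" .
  qed
  have "hausdorff1_outer A + hausdorff1_outer B =
      (SUP d\<in>{0<..}. hausdorff1_pre d A + hausdorff1_pre d B)"
    unfolding hausdorff1_outer_def
  proof (rule SUP_add_directed_ennreal[symmetric])
    fix i j :: real assume "i \<in> {0<..}" "j \<in> {0<..}"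
    then show "\<exists>k\<in>{0<..}. hausdorff1_pre i A + hausdorff1_pre j B \<le> hausdorff1_pre k A + hausdorff1_pre k B"
      by (intro bexI[of _ "min i j"] add_mono hausdorff1_pre_antimono) auto
  qed
  also have "\<dots> \<le> hausdorff1_outer (A \<union> B)"
  proof (rule SUP_least)
    fix d :: real assume "d \<in> {0<..}"
    then have d: "0 < min d (e/2)" "min d (e/2) < e" using \<open>e > 0\<close> by auto
    have "hausdorff1_pre d A + hausdorff1_pre d B \<le>
        hausdorff1_pre (min d (e/2)) A + hausdorff1_pre (min d (e/2)) B"
      by (intro add_mono hausdorff1_pre_antimono) auto
    also have "\<dots> \<le> hausdorff1_pre (min d (e/2)) (A \<union> B)" by (rule pre[OF d])
    also have "\<dots> \<le> hausdorff1_outer (A \<union> B)"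
      unfolding hausdorff1_outer_def using d by (intro SUP_upper) auto
    finally show "hausdorff1_pre d A + hausdorff1_pre d B \<le> hausdorff1_outer (A \<union> B)" .
  qed
  finally show ?thesis .
qed

lemma hausdorff1_outer_separated_sum:
  assumes sep: "\<And>i j. i < j \<Longrightarrow> \<exists>e>0. \<forall>k\<ge>j. \<forall>a\<in>S i. \<forall>b\<in>S k. e \<le> dist a b"
    and X: "\<And>i. S i \<subseteq> X"
  shows "(\<Sum>i::nat. hausdorff1_outer (S i)) \<le> hausdorff1_outer X"
proof -
  have "(\<Sum>i<n. hausdorff1_outer (S (m + i))) \<le> hausdorff1_outer (\<Union>i\<in>{m..}. S i)" for n m
  proof (induction n arbitrary: m)
    case (Suc n)
    obtain e where e: "e > 0" "\<forall>k\<ge>Suc m. \<forall>a\<in>S m. \<forall>b\<in>S k. e \<le> dist a b"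
      using sep[of m "Suc m"] by auto
    have "(\<Sum>i<Suc n. hausdorff1_outer (S (m + i))) =
        hausdorff1_outer (S m) + (\<Sum>i<n. hausdorff1_outer (S (Suc m + i)))"
      by (simp add: sum.lessThan_Suc_shift del: sum.lessThan_Suc)
    also have "\<dots> \<le> hausdorff1_outer (S m) + hausdorff1_outer (\<Union>i\<in>{Suc m..}. S i)"
      by (intro add_left_mono Suc)
    also have "\<dots> \<le> hausdorff1_outer (S m \<union> (\<Union>i\<in>{Suc m..}. S i))"
      using e by (intro hausdorff1_outer_metric[of e]) auto
    also have "\<dots> \<le> hausdorff1_outer (\<Union>i\<in>{m..}. S i)"
      by (rule hausdorff1_outer_mono) (auto intro: Suc_leD)
    finally show ?case .
  qed simp
  from this[where m = 0] have "(\<Sum>i<n. hausdorff1_outer (S i)) \<le> hausdorff1_outer (\<Union>i\<in>{0..}. S i)" for n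
    by simp
  moreover have "hausdorff1_outer (\<Union>i\<in>{0..}. S i) \<le> hausdorff1_outer X"
    using X by (intro hausdorff1_outer_mono UN_least)
  ultimately have "(\<Sum>i<n. hausdorff1_outer (S i)) \<le> hausdorff1_outer X" for n
    using order_trans by blast
  then show ?thesis by (intro suminf_le_const) auto
qed

lemma hausdorff1_outer_closed:
  assumes C: "closed C"
  shows "hausdorff1_outer (X \<inter> C) + hausdorff1_outer (X - C) \<le> hausdorff1_outer X"
proof (cases "C = {} \<or> hausdorff1_outer X = top")
  case True
  then show ?thesis by (auto simp: hausdorff1_outer_empty)
next
  case False
  then have ne: "C \<noteq> {}" and fin: "hausdorff1_outer X < top" by (auto simp: less_top)
  define Y where "Y n = {x \<in> X. inverse (real (Suc n)) \<le> infdist x C}" for n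
  define S where "S k = {x \<in> X. inverse (real (Suc (Suc k))) \<le> infdist x C \<and>
      infdist x C < inverse (real (Suc k))}" for k
  have dist: "infdist x C - infdist y C \<le> dist x y" for x y
    using infdist_triangle[of x C y] by simp
  have sepS: "\<exists>e>0. \<forall>k\<ge>j. \<forall>a\<in>S (2 * i + c). \<forall>b\<in>S (2 * k + c). e \<le> dist a b" if "i < j" for i j c
  proof (intro exI[of _ "inverse (real (2*i + c + 2)) - inverse (real (2*i + c + 3))"] conjI allI impI ballI)
    show "0 < inverse (real (2*i + c + 2)) - inverse (real (2*i + c + 3))"
      using less_imp_inverse_less[of "real (2*i + c + 2)" "real (2*i + c + 3)"] by simp
    fix k a b assume "j \<le> k" and a: "a \<in> S (2 * i + c)" and b: "b \<in> S (2 * k + c)"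
    then have "inverse (real (Suc (2*k + c))) \<le> inverse (real (2*i + c + 3))"
      using that by (intro le_imp_inverse_le) auto
    moreover have "infdist b C < inverse (real (Suc (2*k + c)))" using b by (simp add: S_def)
    moreover have "inverse (real (2*i + c + 2)) \<le> infdist a C" using a by (simp add: S_def)
    ultimately show "inverse (real (2*i + c + 2)) - inverse (real (2*i + c + 3)) \<le> dist a b"
      using dist[of a b] by linarith
  qed
  have half: "(\<Sum>i. hausdorff1_outer (S (2 * i + c))) \<le> hausdorff1_outer X" for c
    using sepS by (intro hausdorff1_outer_separated_sum) (auto simp: S_def)
  have tail: "hausdorff1_outer (X - C) \<le>
     hausdorff1_outer (Y (2 * n)) + ((\<Sum>i. hausdorff1_outer (S (2 * (i + n)))) +
       (\<Sum>i. hausdorff1_outer (S (2 * (i + n) + 1))))" for n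
  proof -
    have "X - C \<subseteq> Y (2*n) \<union> ((\<Union>i. S (2 * (i + n))) \<union> (\<Union>i. S (2 * (i + n) + 1)))"
    proof
      fix x assume x: "x \<in> X - C"
      then have pos: "0 < infdist x C"
        using C ne by (metis DiffD2 in_closed_iff_infdist_zero infdist_nonneg less_eq_real_def)
      show "x \<in> Y (2*n) \<union> ((\<Union>i. S (2 * (i + n))) \<union> (\<Union>i. S (2 * (i + n) + 1)))"
      proof (cases "x \<in> Y (2*n)")
        case False
        define m where "m = (LEAST m. inverse (real (Suc m)) \<le> infdist x C)"
        have ex: "\<exists>m. inverse (real (Suc m)) \<le> infdist x C"
          using reals_Archimedean[OF pos] by (auto intro: less_imp_le)
        have m: "inverse (real (Suc m)) \<le> infdist x C"
          unfolding m_def by (rule LeastI_ex[OF ex])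
        have "2 * n < m"
        proof (rule ccontr)
          assume "\<not> 2 * n < m"
          then have "inverse (real (Suc (2*n))) \<le> inverse (real (Suc m))"
            by (intro le_imp_inverse_le) auto
          then have "inverse (real (Suc (2*n))) \<le> infdist x C" using m by linarith
          then show False using False x by (simp add: Y_def)
        qed
        then obtain k where k: "m = Suc k" "2 * n \<le> k" by (cases m) auto
        have "infdist x C < inverse (real (Suc k))"
          using not_less_Least[of k "\<lambda>m. inverse (real (Suc m)) \<le> infdist x C"] k(1)
          unfolding m_def by simp
        then have xS: "x \<in> S k" using x m k by (simp add: S_def)
        have "\<exists>i. k = 2 * (i + n) \<or> k = 2 * (i + n) + 1"
          using k(2) by presburger
        then show ?thesis using xS by auto
      qed simp
    qed
    then have "hausdorff1_outer (X - C) \<le>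
        hausdorff1_outer (Y (2*n) \<union> ((\<Union>i. S (2 * (i + n))) \<union> (\<Union>i. S (2 * (i + n) + 1))))"
      by (rule hausdorff1_outer_mono)
    also have "\<dots> \<le> hausdorff1_outer (Y (2*n)) +
        (hausdorff1_outer (\<Union>i. S (2 * (i + n))) + hausdorff1_outer (\<Union>i. S (2 * (i + n) + 1)))"
      by (intro order_trans[OF hausdorff1_outer_subadditive] add_mono order_refl hausdorff1_outer_subadditive)
    also have "\<dots> \<le> hausdorff1_outer (Y (2 * n)) + ((\<Sum>i. hausdorff1_outer (S (2 * (i + n)))) +
       (\<Sum>i. hausdorff1_outer (S (2 * (i + n) + 1))))"
      by (intro add_mono order_refl hausdorff1_outer_countably_subadditive)
    finally show ?thesis .
  qed
  have tl: "(\<lambda>n. \<Sum>i. hausdorff1_outer (S (2 * (i + n) + c))) \<longlonglongrightarrow> 0" for c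
  proof -
    have lt: "(\<Sum>i. hausdorff1_outer (S (2 * i + c))) < top" using half[of c] fin by (rule le_less_trans)
    define f where "f i = enn2real (hausdorff1_outer (S (2 * i + c)))" for i
    have f: "ennreal (f i) = hausdorff1_outer (S (2 * i + c))" for i
      unfolding f_def using ennreal_suminf_lessD[OF lt, of i] by simp
    have f0: "0 \<le> f i" for i by (simp add: f_def)
    have sf: "summable f"
      using lt unfolding f[symmetric] by (intro summable_suminf_not_top f0) auto
    have "(\<lambda>n. \<Sum>i. f (i + n)) \<longlonglongrightarrow> 0"
      using suminf_exist_split2[OF sf] .
    then have "(\<lambda>n. ennreal (\<Sum>i. f (i + n))) \<longlonglongrightarrow> ennreal 0"
      by (rule tendsto_ennrealI)
    moreover have "ennreal (\<Sum>i. f (i + n)) = (\<Sum>i. hausdorff1_outer (S (2 * (i + n) + c)))" for n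
      unfolding f[symmetric] using sf by (intro suminf_ennreal2[symmetric] f0) (simp add: summable_iff_shift)
    ultimately show ?thesis by simp
  qed
  have bound: "hausdorff1_outer (X \<inter> C) + hausdorff1_outer (X - C) \<le> hausdorff1_outer X +
      ((\<Sum>i. hausdorff1_outer (S (2 * (i + n) + 0))) + (\<Sum>i. hausdorff1_outer (S (2 * (i + n) + 1))))" for n
  proof -
    have "hausdorff1_outer (X \<inter> C) + hausdorff1_outer (Y (2*n)) \<le> hausdorff1_outer (X \<inter> C \<union> Y (2*n))"
    proof (rule hausdorff1_outer_metric[of "inverse (real (Suc (2*n)))"])
      fix a b assume "a \<in> X \<inter> C" "b \<in> Y (2*n)"
      then show "inverse (real (Suc (2*n))) \<le> dist a b"
        using infdist_le[of a C b] by (simp add: Y_def dist_commute)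
    qed simp
    also have "\<dots> \<le> hausdorff1_outer X" by (rule hausdorff1_outer_mono) (auto simp: Y_def)
    finally have 1: "hausdorff1_outer (X \<inter> C) + hausdorff1_outer (Y (2*n)) \<le> hausdorff1_outer X" .
    let ?T = "(\<Sum>i. hausdorff1_outer (S (2 * (i + n)))) + (\<Sum>i. hausdorff1_outer (S (2 * (i + n) + 1)))"
    have "hausdorff1_outer (X \<inter> C) + hausdorff1_outer (X - C) \<le>
        hausdorff1_outer (X \<inter> C) + (hausdorff1_outer (Y (2*n)) + ?T)"
      by (intro add_left_mono tail)
    also have "\<dots> = (hausdorff1_outer (X \<inter> C) + hausdorff1_outer (Y (2*n))) + ?T"
      by (simp only: add.assoc)
    also have "\<dots> \<le> hausdorff1_outer X + ?T"
      by (intro add_right_mono 1)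
    finally show ?thesis by (simp only: add_0_right)
  qed
  have "(\<lambda>n. hausdorff1_outer X + ((\<Sum>i. hausdorff1_outer (S (2 * (i + n) + 0))) +
      (\<Sum>i. hausdorff1_outer (S (2 * (i + n) + 1))))) \<longlonglongrightarrow> hausdorff1_outer X + (0 + 0)"
    by (intro tendsto_add tl tendsto_const)
  then show ?thesis
    using bound by (intro LIMSEQ_le_const) auto
qed

lemma sets_hausdorff1 [simp]: "sets hausdorff1 = sets borel"
  unfolding hausdorff1_def by (metis sets.sets_measure_of_eq space_borel)

lemma emeasure_hausdorff1:
  fixes A :: "'a::metric_space set"
  assumes "A \<in> sets borel"
  shows "emeasure hausdorff1 A = hausdorff1_outer A"
proof -
  let ?L = "lambda_system UNIV (Pow UNIV) (hausdorff1_outer :: 'a set \<Rightarrow> ennreal)"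
  have ms: "measure_space UNIV ?L hausdorff1_outer"
    using sigma_algebra.caratheodory_lemma[OF sigma_algebra_Pow outer_measure_space_hausdorff1] .
  then have sa: "sigma_algebra UNIV ?L" by (simp add: measure_space_def)
  have "C \<in> ?L" if "closed C" for C
  proof -
    have "hausdorff1_outer (x \<inter> C) + hausdorff1_outer (x - C) = hausdorff1_outer x" for x
      using hausdorff1_outer_closed[OF that, of x] hausdorff1_outer_subadditive[of "x \<inter> C" "x - C"]
      by (intro antisym) (auto simp: Int_Diff_Un)
    then show ?thesis by (simp add: algebra.lambda_system_eq[OF algebra_Pow] del: Pow_UNIV)
  qed
  then have sub: "sets borel \<subseteq> ?L"
    unfolding borel_eq_closed using sigma_algebra.sigma_sets_subset[OF sa, of "Collect closed"]
    by auto
  have "countably_additive (sets borel) (hausdorff1_outer :: 'a set \<Rightarrow> ennreal)"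
    using ms sub unfolding measure_space_def countably_additive_def by blast
  moreover have "positive (sets borel) (hausdorff1_outer :: 'a set \<Rightarrow> ennreal)"
    by (simp add: positive_def hausdorff1_outer_empty)
  ultimately show ?thesis
    using assms by (intro emeasure_measure_of[OF hausdorff1_def]) auto
qed


section \<open>Curvature of the boundary\<close>

text \<open>
  For a unit-speed parametrization \<open>c\<close> of \<open>\<partial>\<Omega>\<close> near \<open>p = c(0)\<close>, the curvature \<open>k\<close> is given by
  \<open>c''(0) = k n\<close> with \<open>n\<close> the inner unit normal, so that convex sets have \<open>k \<ge> 0\<close>. The value does
  not depend on the choice of \<open>c\<close>.
\<close>

definition has_curvature :: "(real^2) set \<Rightarrow> real^2 \<Rightarrow> real \<Rightarrow> bool" where
  "has_curvature \<Omega> p k \<longleftrightarrow>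
     (\<exists>\<epsilon>>0. \<exists>c c' c'' n.
        c 0 = p \<and>
        (\<forall>t\<in>{-\<epsilon><..<\<epsilon>}. c t \<in> frontier \<Omega> \<and> norm (c' t) = 1 \<and>
           (c has_vector_derivative c' t) (at t) \<and> (c' has_vector_derivative c'' t) (at t)) \<and>
        norm n = 1 \<and> n \<bullet> c' 0 = 0 \<and> (\<forall>\<^sub>F s in at_right 0. p + s *\<^sub>R n \<in> \<Omega>) \<and>
        c'' 0 = k *\<^sub>R n)"

definition curvature :: "(real^2) set \<Rightarrow> real^2 \<Rightarrow> real" where
  "curvature \<Omega> p = (THE k. has_curvature \<Omega> p k)"


section \<open>The energy\<close>

definition energy :: "real \<Rightarrow> real \<Rightarrow> (real^2) set \<Rightarrow> real" where
  "energy l \<alpha> \<Omega> =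
     enn2real (perimeter \<Omega>) -
     l\<^sup>2 / (4 * pi) *
       (LINT x:\<Omega>|lebesgue. (LINT y:- \<Omega>|lebesgue. exp (- (l * \<alpha> * norm (x - y))) / norm (x - y)))"

end

(*
With mu = lambda * alpha, the kernel exp (- mu |z|) / |z| is the divergence of
F z = - exp (- mu |z|) / (mu |z|^2) z. For y outside the closure of Omega the divergence theorem
turns the integral of the kernel over Omega into a boundary integral of F; integrating over y and
exchanging the integrals leaves, at each boundary point q with inner normal nu, the integral of
- (z . nu) exp (- mu |z|) / (mu |z|^2) over the z with q + z outside Omega. If Omega is replaced by
the half plane z . nu > 0, this is 2 / mu^2, which produces the perimeter term. The difference is the
integral of |z . nu| exp (- mu |z|) / (mu |z|^2) over the set where Omega and the half plane disagree.
Under the parabolic scaling z = (u / mu) tau + (v / mu^2) nu this set converges to the region between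
the tangent and the osculating parabola v = kappa u^2 / 2, so that mu^4 times the difference tends
to kappa^2 / 2, and dominated convergence applies twice: in (u, v) and along the boundary.
*)

theory Submission
  imports Defs
begin


section \<open>Orthonormal frames of the plane\<close>

text \<open>Much of the work lies in the definitions: the perimeter is a supremum over test fields,
  the boundary integral uses a measure built from coverings, and \<open>curvature\<close> is a
  \<open>THE\<close>. All three are computed on graphs: arc length density
  \<open>sqrt (1 + g'^2)\<close>, perimeter equal to the Hausdorff measure of the frontier,
  curvature \<open>g'' / (1 + g'^2)^(3/2)\<close>. The scaling is forced by quadratic contact. Where
  \<Omega> and the tangent half plane disagree, |z . nu| <= C |z|^2, and the kernel confines |z| to
  order 1/mu. The region thus has width 1/mu and height 1/mu^2, while |z . nu| / |z|^2 is of order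
  1; this gives mu^(-3) and, with the factor 1/mu of F, mu^(-4). The same inequality, with one C for
  all boundary points and all z, supplies both majorants. Constants: lambda^2 / (4 pi) times 2 /
  mu^2 is 1 / (2 pi alpha^2), and lambda^2 / (4 pi) times kappa^2 / (2 mu^4) is kappa^2 / (8 pi
  alpha^4 lambda^2). The perimeter term is exact for every lambda > 0, so the whole error comes from
  the disagreement.\<close>

definition orthonormal_pair :: "real^2 \<Rightarrow> real^2 \<Rightarrow> bool" where
  "orthonormal_pair e n \<longleftrightarrow> norm e = 1 \<and> norm n = 1 \<and> e \<bullet> n = 0"

definition frame_map :: "real^2 \<Rightarrow> real^2 \<Rightarrow> real \<times> real \<Rightarrow> real^2" where
  "frame_map e n = (\<lambda>(s, t). s *\<^sub>R e + t *\<^sub>R n)"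

lemma orthonormal_pair_inner:
  assumes "orthonormal_pair e n"
  shows "e \<bullet> e = 1" "n \<bullet> n = 1" "e \<bullet> n = 0" "n \<bullet> e = 0"
  using assms by (auto simp: orthonormal_pair_def norm_eq_1 inner_commute)

lemma orthonormal_pair_abs_inner_le:
  assumes "orthonormal_pair e n"
  shows "\<bar>x \<bullet> e\<bar> \<le> norm x" "\<bar>x \<bullet> n\<bar> \<le> norm x"
  using Cauchy_Schwarz_ineq2[of x e] Cauchy_Schwarz_ineq2[of x n] assms
  by (auto simp: orthonormal_pair_def)

lemma orthonormal_pair_expand:
  assumes "orthonormal_pair e n"
  shows "x = (x \<bullet> e) *\<^sub>R e + (x \<bullet> n) *\<^sub>R n"
proof -
  have h: "e$1 * e$1 + e$2 * e$2 = 1" "n$1 * n$1 + n$2 * n$2 = 1" "e$1 * n$1 + e$2 * n$2 = 0"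
    using orthonormal_pair_inner[OF assms] by (auto simp: inner_vec_def sum_2)
  \<comment> \<open>\<open>d\<close> is the determinant of the pair, so it is 1 or -1, and
    \<open>n\<close> is \<open>d\<close> times the quarter turn of \<open>e\<close>.\<close>
  define d where "d = e$1 * n$2 - e$2 * n$1"
  have d: "d * d = 1" using h unfolding d_def by algebra
  have n1: "n$1 = - (d * e$2)" using h unfolding d_def by algebra
  have n2: "n$2 = d * e$1" using h unfolding d_def by algebra
  have "x$1 = (x$1 * e$1 + x$2 * e$2) * e$1 + (x$1 * n$1 + x$2 * n$2) * n$1"
    "x$2 = (x$1 * e$1 + x$2 * e$2) * e$2 + (x$1 * n$1 + x$2 * n$2) * n$2"
    unfolding n1 n2 using h(1) d by algebra+
  then show ?thesis
    by (simp add: vec_eq_iff forall_2 inner_vec_def sum_2)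
qed

lemma orthonormal_pair_inner_expand:
  assumes "orthonormal_pair e n"
  shows "x \<bullet> y = (x \<bullet> e) * (y \<bullet> e) + (x \<bullet> n) * (y \<bullet> n)"
proof -
  have "x \<bullet> y = x \<bullet> ((y \<bullet> e) *\<^sub>R e + (y \<bullet> n) *\<^sub>R n)"
    using orthonormal_pair_expand[OF assms] by metis
  then show ?thesis by (simp add: inner_add_right mult.commute)
qed

lemma orthonormal_pair_norm:
  assumes "orthonormal_pair e n"
  shows "norm x = sqrt ((x \<bullet> e)\<^sup>2 + (x \<bullet> n)\<^sup>2)"
  unfolding norm_eq_sqrt_inner power2_eq_square
  by (subst orthonormal_pair_inner_expand[OF assms]) (rule refl)

lemma frame_map_inner [simp]:
  assumes "orthonormal_pair e n"
  shows "frame_map e n p \<bullet> e = fst p" "frame_map e n p \<bullet> n = snd p"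
  using orthonormal_pair_inner[OF assms] by (auto simp: frame_map_def split_beta inner_simps)

lemma norm_frame_map:
  assumes "orthonormal_pair e n"
  shows "norm (frame_map e n (s, t)) = sqrt (s\<^sup>2 + t\<^sup>2)"
  unfolding orthonormal_pair_norm[OF assms] using assms by simp

lemma frame_map_eqI: "orthonormal_pair e n \<Longrightarrow> frame_map e n (x \<bullet> e, x \<bullet> n) = x"
  unfolding frame_map_def by (simp add: orthonormal_pair_expand[symmetric])

lemma continuous_on_frame_map [continuous_intros]:
  "continuous_on S f \<Longrightarrow> continuous_on S (\<lambda>x. frame_map e n (f x))"
  unfolding frame_map_def split_beta by (intro continuous_intros)

lemma measurable_frame_map [measurable]: "frame_map e n \<in> borel_measurable borel"
  by (intro borel_measurable_continuous_onI continuous_intros)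

text \<open>Pairs and vectors of length two are different types. A Borel measure that gives every
  box the product of its side lengths is \<open>lborel\<close>, so it is enough to compare
  boxes.\<close>

lemma lborel_vec2: "distr (lborel :: (real \<times> real) measure) borel (\<lambda>p. \<chi> i. if i = 1 then fst p else snd p) = (lborel :: (real^2) measure)"
proof (rule lborel_eqI[symmetric])
  let ?V = "\<lambda>p::real\<times>real. (\<chi> i. if i = 1 then fst p else snd p) :: real^2"
  have "continuous_on UNIV ?V"
    proof (intro continuous_on_vec_lambda)
    fix i :: 2 show "continuous_on UNIV (\<lambda>p::real\<times>real. if i = 1 then fst p else snd p)"
      by (cases "i = 1") (auto intro: continuous_intros)
  qed
  then have [measurable]: "?V \<in> borel_measurable borel" by (rule borel_measurable_continuous_onI)
  have ax: "Basis = {axis 1 1, axis 2 1 :: real^2}"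
    by (auto simp: Basis_vec_def UNIV_2)
  have ne: "axis 1 1 \<noteq> (axis 2 1 :: real^2)" by (simp add: axis_eq_axis)
  fix l u :: "real^2" assume le: "\<And>b. b \<in> Basis \<Longrightarrow> l \<bullet> b \<le> u \<bullet> b"
  have le': "l $ 1 \<le> u $ 1" "l $ 2 \<le> u $ 2"
    using le[of "axis 1 1"] le[of "axis 2 1"] by (auto simp: ax inner_axis)
  have "?V -` box l u = {l$1<..<u$1} \<times> {l$2<..<u$2}"
    by (auto simp: mem_box_cart forall_2)
  then have "emeasure (distr lborel borel ?V) (box l u) = emeasure lborel ({l$1<..<u$1} \<times> {l$2<..<u$2})"
    by (simp add: emeasure_distr)
  also have "\<dots> = ennreal (u$1 - l$1) * ennreal (u$2 - l$2)"
    unfolding lborel_prod[symmetric] using le' by (simp add: lborel.emeasure_pair_measure_Times)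
  also have "\<dots> = (\<Prod>b\<in>Basis. (u - l) \<bullet> b)"
    unfolding ax using ne le' by (simp add: inner_axis ennreal_mult'' )
  finally show "emeasure (distr lborel borel ?V) (box l u) = (\<Prod>b\<in>Basis. (u - l) \<bullet> b)" .
qed simp

text \<open>The preimage of a box is its image under the inverse map, which is again orthogonal and
  hence preserves Lebesgue measure; boxes determine \<open>lborel\<close>.\<close>

lemma lborel_orthogonal_image:
  fixes f :: "real^'n::{finite,wellorder} \<Rightarrow> real^'n::_"
  assumes f: "orthogonal_transformation f"
  shows "distr lborel borel f = lborel"
proof (rule lborel_eqI[symmetric])
  have lin: "linear f" using f orthogonal_transformation_linear by blast
  then have [measurable]: "f \<in> borel_measurable borel"
    by (intro borel_measurable_continuous_onI linear_continuous_on) (simp add: linear_conv_bounded_linear)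
  fix l u :: "real^'n::_" assume le: "\<And>b. b \<in> Basis \<Longrightarrow> l \<bullet> b \<le> u \<bullet> b"
  have bij: "bij f" using f by (simp add: orthogonal_transformation_bij)
  have inv: "orthogonal_transformation (inv f)" using f by (rule orthogonal_transformation_inv)
  have eq: "f -` box l u = inv f ` box l u" using bij by (simp add: bij_vimage_eq_inv_image)
  have m: "inv f ` box l u \<in> lmeasurable" "measure lebesgue (inv f ` box l u) = measure lebesgue (box l u)"
    by (rule measurable_orthogonal_image[OF inv], simp) (rule measure_orthogonal_image[OF inv], simp)
  have b: "f -` box l u \<in> sets borel" using measurable_sets[of f borel borel "box l u"] by simp
  have "emeasure (distr lborel borel f) (box l u) = emeasure lborel (f -` box l u)"
    by (simp add: emeasure_distr)
  also have "\<dots> = emeasure lebesgue (f -` box l u)" using b by simp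
  also have "\<dots> = ennreal (measure lebesgue (box l u))"
    using m emeasure_eq_measure2[of "inv f ` box l u" lebesgue] unfolding eq by (simp add: fmeasurableD2)
  also have "\<dots> = (\<Prod>b\<in>Basis. (u - l) \<bullet> b)"
    using le by (simp)
  finally show "emeasure (distr lborel borel f) (box l u) = (\<Prod>b\<in>Basis. (u - l) \<bullet> b)" .
qed simp

text \<open>The frame map is the passage from pairs to vectors followed by an orthogonal map. It
  allows every plane integral to be computed in coordinates adapted to a tangent.\<close>

lemma lborel_frame_map:
  assumes "orthonormal_pair e n"
  shows "distr lborel borel (frame_map e n) = lborel"
proof -
  let ?V = "\<lambda>p::real\<times>real. (\<chi> i. if i = 1 then fst p else snd p) :: real^2"
  let ?f = "\<lambda>x::real^2. frame_map e n (x$1, x$2)"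
  have "continuous_on UNIV ?V"
    proof (intro continuous_on_vec_lambda)
    fix i :: 2 show "continuous_on UNIV (\<lambda>p::real\<times>real. if i = 1 then fst p else snd p)"
      by (cases "i = 1") (auto intro: continuous_intros)
  qed
  then have [measurable]: "?V \<in> borel_measurable borel" by (rule borel_measurable_continuous_onI)
  have lin: "linear ?f"
    by (intro linearI) (auto simp: frame_map_def algebra_simps)
  have ot: "orthogonal_transformation ?f"
  proof -
    have "norm (frame_map e n (v$1, v$2)) = norm v" for v :: "real^2"
      unfolding norm_frame_map[OF assms] by (simp add: norm_vec_def L2_set_def sum_2)
    then show ?thesis
      using lin by (simp add: orthogonal_transformation)
  qed
  have [measurable]: "?f \<in> borel_measurable borel" 
    by (intro borel_measurable_continuous_onI continuous_intros)
  have "lborel = distr (distr lborel borel ?V) borel ?f"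
    by (simp add: lborel_vec2 lborel_orthogonal_image[OF ot])
  also have "\<dots> = distr lborel borel (?f \<circ> ?V)" by (rule distr_distr) auto
  also have "?f \<circ> ?V = frame_map e n" by (auto simp: fun_eq_iff)
  finally show ?thesis by simp
qed

lemma nn_integral_frame:
  assumes on: "orthonormal_pair e n" and [measurable]: "f \<in> borel_measurable borel"
  shows "(\<integral>\<^sup>+x. f x \<partial>lborel) = (\<integral>\<^sup>+s. \<integral>\<^sup>+t. f (frame_map e n (s, t)) \<partial>lborel \<partial>lborel)"
proof -
  have "(\<integral>\<^sup>+x. f x \<partial>lborel) = (\<integral>\<^sup>+p. f (frame_map e n p) \<partial>(lborel \<Otimes>\<^sub>M lborel))"
    by (subst lborel_frame_map[OF on, symmetric]) (simp add: nn_integral_distr lborel_prod)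
  also have "\<dots> = (\<integral>\<^sup>+s. \<integral>\<^sup>+t. f (frame_map e n (s, t)) \<partial>lborel \<partial>lborel)"
    by (subst lborel.nn_integral_fst[symmetric]) (auto simp: lborel_prod)
  finally show ?thesis .
qed

lemma integral_frame:
  fixes f :: "real^2 \<Rightarrow> real"
  assumes on: "orthonormal_pair e n" and [measurable]: "f \<in> borel_measurable borel"
  shows "(\<integral>x. f x \<partial>lborel) = (\<integral>p. f (frame_map e n p) \<partial>(lborel \<Otimes>\<^sub>M lborel))"
proof -
  have "(\<integral>x. f x \<partial>lborel) = (\<integral>x. f x \<partial>distr (lborel \<Otimes>\<^sub>M lborel) borel (frame_map e n))"
    unfolding lborel_prod lborel_frame_map[OF on] ..
  also have "\<dots> = (\<integral>p. f (frame_map e n p) \<partial>(lborel \<Otimes>\<^sub>M lborel))"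
    unfolding lborel_prod by (rule integral_distr) auto
  finally show ?thesis .
qed

section \<open>The one-dimensional Hausdorff measure of a graph\<close>

text \<open>Cutting the interval into \<open>N\<close> equal pieces gives a cover by images of
  diameter at most \<open>L * h\<close>, which is below any given scale for large \<open>N\<close>,
  while the sum of these bounds is always \<open>L * (b - a)\<close>.\<close>

lemma hausdorff1_outer_lipschitz_image_le:
  fixes \<gamma> :: "real \<Rightarrow> 'a::real_normed_vector"
  assumes "a \<le> b" "0 \<le> L" and lip: "\<And>x y. x \<in> {a..b} \<Longrightarrow> y \<in> {a..b} \<Longrightarrow> dist (\<gamma> x) (\<gamma> y) \<le> L * \<bar>x - y\<bar>"
  shows "hausdorff1_outer (\<gamma> ` {a<..b}) \<le> ennreal (L * (b - a))"
  unfolding hausdorff1_outer_def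
proof (rule SUP_least)
  fix d :: real assume "d \<in> {0<..}"
  then have d: "0 < d" by simp
  obtain N :: nat where N: "L * (b - a) / d < real N" using reals_Archimedean2 by blast
  have "0 \<le> L * (b - a) / d" using assms d by simp
  with N have N0: "0 < N" by linarith
  define h where "h = (b - a) / N"
  have h0: "0 \<le> h" using assms by (simp add: h_def)
  have Nh: "real N * h = b - a" using N0 by (simp add: h_def)
  have Lh: "L * h \<le> d" using N d N0 by (simp add: h_def field_simps)
  define I where "I i = {a + real i * h .. a + real (Suc i) * h}" for i
  have Isub: "I i \<subseteq> {a..b}" if "i < N" for i
  proof -
    have "real (Suc i) * h \<le> real N * h" using that h0 by (intro mult_right_mono) auto
    moreover have "0 \<le> real i * h" using h0 by simp
    ultimately show ?thesis unfolding I_def Nh by auto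
  qed
  have Idist: "dist (\<gamma> x) (\<gamma> y) \<le> L * h" if "i < N" "x \<in> I i" "y \<in> I i" for i x y
  proof -
    have "\<bar>x - y\<bar> \<le> h" using that by (auto simp: I_def algebra_simps abs_le_iff)
    moreover have "x \<in> {a..b}" "y \<in> {a..b}" using Isub[OF that(1)] that(2,3) by blast+
    ultimately show ?thesis
      using lip[of x y] \<open>0 \<le> L\<close> by (meson mult_left_mono order_trans)
  qed
  define U where "U i = (if i < N then \<gamma> ` I i else {})" for i
  have diam: "diameter (U i) \<le> L * h" for i
    unfolding U_def using Idist \<open>0 \<le> L\<close> h0 by (auto intro!: diameter_le simp: dist_norm)
  have bdd: "bounded (U i)" for i
  proof (cases "i < N")
    case True
    then show ?thesis
      unfolding bounded_two_points U_def using Idist by (auto intro!: exI[of _ "L * h"])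
  qed (simp add: U_def)
  have cov: "\<gamma> ` {a<..b} \<subseteq> (\<Union>i. U i)"
  proof (safe)
    fix x assume x: "x \<in> {a<..b}"
    then have hp: "0 < h" using N0 by (simp add: h_def)
    \<comment> \<open>The piece with \<open>a + i * h < x \<le> a + (i + 1) * h\<close>. Since
      \<open>a < x\<close>, the ceiling is at least 1 and the subtraction does not truncate.\<close>
    define i where "i = nat (\<lceil>(x - a) / h\<rceil> - 1)"
    have pos: "0 < (x - a) / h" using x hp by simp
    have ri: "real i = of_int \<lceil>(x - a) / h\<rceil> - 1"
      using pos by (simp add: i_def)
    have 1: "real i < (x - a) / h" "(x - a) / h \<le> real i + 1" using ri ceiling_correct[of "(x - a) / h"] by linarith+
    have "(x - a) / h \<le> real N" using x hp Nh by (simp add: divide_le_eq)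
    with 1 have iN: "i < N" by linarith
    have "x \<in> I i" using 1 hp by (auto simp: I_def field_simps)
    then show "\<gamma> x \<in> (\<Union>i. U i)" using iN by (auto simp: U_def)
  qed
  have "hausdorff1_pre d (\<gamma> ` {a<..b}) \<le> (\<Sum>i. ennreal (diameter (U i)))"
    using diam Lh by (intro hausdorff1_pre_le[OF cov bdd]) (meson order_trans)
  also have "\<dots> = (\<Sum>i<N. ennreal (diameter (U i)))"
    by (rule suminf_finite) (auto simp: U_def)
  also have "\<dots> \<le> (\<Sum>i<N. ennreal (L * h))"
    using diam by (intro sum_mono ennreal_leI)
  also have "\<dots> = ennreal (real N * (L * h))"
    using h0 \<open>0 \<le> L\<close> by (simp add: ennreal_mult ennreal_of_nat_eq_real_of_nat)
  also have "real N * (L * h) = L * (b - a)" using Nh by (metis mult.left_commute)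
  finally show "hausdorff1_pre d (\<gamma> ` {a<..b}) \<le> ennreal (L * (b - a))" .
qed

text \<open>A cover of the image pulls back to a cover of the interval by parameter sets of length
  at most \<open>diameter (U i) / l\<close>, and Lebesgue measure is countably subadditive.\<close>

lemma hausdorff1_outer_expanding_image_ge:
  fixes \<gamma> :: "real \<Rightarrow> 'a::real_normed_vector"
  assumes "a \<le> b" "0 < l" and lip: "\<And>x y. x \<in> {a..b} \<Longrightarrow> y \<in> {a..b} \<Longrightarrow> l * \<bar>x - y\<bar> \<le> dist (\<gamma> x) (\<gamma> y)"
  shows "ennreal (l * (b - a)) \<le> hausdorff1_outer (\<gamma> ` {a<..b})"
proof -
  \<comment> \<open>The outer measure is a supremum over scales, so one scale gives a lower
    bound.\<close>
  have "ennreal (l * (b - a)) \<le> hausdorff1_pre 1 (\<gamma> ` {a<..b})"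
    unfolding hausdorff1_pre_def
  proof (safe intro!: INF_greatest)
    fix U :: "nat \<Rightarrow> 'a set"
    assume cov: "\<gamma> ` {a<..b} \<subseteq> (\<Union>i. U i)" and U: "\<forall>i. bounded (U i) \<and> diameter (U i) \<le> 1"
    define V where "V i = {x \<in> {a<..b}. \<gamma> x \<in> U i}" for i
    \<comment> \<open>The covering sets are arbitrary, so \<open>V i\<close> may fail to be
      measurable; its closed interval hull is measurable and no longer than the diameter
      bound.\<close>
    define J where "J i = (if V i = {} then {} else {Inf (V i)..Sup (V i)})" for i
    have bV: "bdd_above (V i)" "bdd_below (V i)" for i
      by (auto simp: V_def intro!: bdd_aboveI[of _ b] bdd_belowI[of _ a])
    have VJ: "V i \<subseteq> J i" for i
      using bV[of i] by (auto simp: J_def intro: cInf_lower cSup_upper)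
    have mJ: "emeasure lborel (J i) \<le> ennreal (diameter (U i) / l)" for i
    proof (cases "V i = {}")
      case False
      have d: "y - x \<le> diameter (U i) / l" if "x \<in> V i" "y \<in> V i" for x y
      proof -
        have "l * \<bar>y - x\<bar> \<le> dist (\<gamma> y) (\<gamma> x)" using that by (intro lip) (auto simp: V_def)
        also have "\<dots> \<le> diameter (U i)" using that U by (intro diameter_bounded_bound) (auto simp: V_def)
        finally have "\<bar>y - x\<bar> \<le> diameter (U i) / l" using \<open>0 < l\<close> by (simp add: field_simps)
        then show ?thesis by simp
      qed
      have "Sup (V i) \<le> Inf (V i) + diameter (U i) / l"
      proof (rule cSup_least[OF False])
        fix y assume y: "y \<in> V i"
        have "y - diameter (U i) / l \<le> Inf (V i)"
          using d[OF _ y] by (intro cInf_greatest[OF False]) (simp add: algebra_simps)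
        then show "y \<le> Inf (V i) + diameter (U i) / l" by simp
      qed
      moreover have "Inf (V i) \<le> Sup (V i)" using False bV by (intro cInf_le_cSup) auto
      ultimately show ?thesis using False by (simp add: J_def ennreal_leI)
    qed (simp add: J_def)
    have sub: "{a<..b} \<subseteq> (\<Union>i. J i)"
    proof
      fix x assume "x \<in> {a<..b}"
      with cov obtain i where "x \<in> V i" unfolding V_def by blast
      with VJ show "x \<in> (\<Union>i. J i)" by blast
    qed
    have "ennreal (b - a) = emeasure lborel {a<..b}" using \<open>a \<le> b\<close> by simp
    also have "\<dots> \<le> emeasure lborel (\<Union>i. J i)"
      using sub by (intro emeasure_mono) (auto simp: J_def intro!: sets.countable_UN)
    also have "\<dots> \<le> (\<Sum>i. emeasure lborel (J i))"
      by (intro emeasure_subadditive_countably) (auto simp: J_def)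
    also have "\<dots> \<le> (\<Sum>i. ennreal (diameter (U i) / l))"
      using mJ by (intro suminf_le) auto
    finally have "ennreal l * ennreal (b - a) \<le> ennreal l * (\<Sum>i. ennreal (diameter (U i) / l))"
      by (intro mult_left_mono) auto
    also have "\<dots> = (\<Sum>i. ennreal l * ennreal (diameter (U i) / l))" by simp
    also have "(\<lambda>i. ennreal l * ennreal (diameter (U i) / l)) = (\<lambda>i. ennreal (diameter (U i)))"
      using \<open>0 < l\<close> U by (auto simp: ennreal_mult[symmetric] diameter_ge_0)
    finally show "ennreal (l * (b - a)) \<le> (\<Sum>i. ennreal (diameter (U i)))"
      using \<open>0 < l\<close> \<open>a \<le> b\<close> by (simp add: ennreal_mult)
  qed
  also have "\<dots> \<le> hausdorff1_outer (\<gamma> ` {a<..b})"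
    unfolding hausdorff1_outer_def by (rule SUP_upper) simp
  finally show ?thesis .
qed

text \<open>Turns measure estimates on short intervals into a derivative: by continuity, near
  \<open>x\<close> the increments of \<open>F\<close> are squeezed between slopes close to
  \<open>w x\<close>.\<close>

lemma DERIV_of_increment_bounds:
  fixes F w :: "real \<Rightarrow> real"
  assumes cont: "isCont w x" and "c < x"
    and bnd: "\<And>u v lo hi. \<lbrakk>c \<le> u; u \<le> v; \<And>s. s \<in> {u..v} \<Longrightarrow> lo \<le> w s \<and> w s \<le> hi; 0 < lo\<rbrakk> \<Longrightarrow>
      lo * (v - u) \<le> F v - F u \<and> F v - F u \<le> hi * (v - u)"
    and pos: "w x > 0"
  shows "DERIV F x :> w x"
  unfolding DERIV_def
proof (rule LIM_I)
  fix r :: real assume "0 < r"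
  \<comment> \<open>Half of \<open>w x\<close> keeps the lower slope \<open>w x - r'\<close>
    positive, as \<open>bnd\<close> demands; half of \<open>r\<close> leaves room for the strict
    inequality.\<close>
  define r' where "r' = min (r/2) (w x / 2)"
  have r': "0 < r'" "r' < r" "r' < w x" using \<open>0 < r\<close> pos by (auto simp: r'_def)
  obtain d where d: "d > 0" "\<And>s. \<bar>s - x\<bar> < d \<Longrightarrow> \<bar>w s - w x\<bar> < r'"
    using cont r'(1) unfolding isCont_def LIM_eq
    by (metis abs_zero diff_self real_norm_def)
  show "\<exists>s>0. \<forall>h. h \<noteq> 0 \<and> norm (h - 0) < s \<longrightarrow> norm ((F (x + h) - F x) / h - w x) < r"
  proof (intro exI[of _ "min d (x - c)"] conjI allI impI)
    show "0 < min d (x - c)" using d \<open>c < x\<close> by simp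
    fix h :: real assume h: "h \<noteq> 0 \<and> norm (h - 0) < min d (x - c)"
    have key: "(w x - r') * (v - u) \<le> F v - F u \<and> F v - F u \<le> (w x + r') * (v - u)"
      if "c \<le> u" "u \<le> v" "x - d < u" "v < x + d" for u v
    proof (rule bnd)
      fix s assume "s \<in> {u..v}"
      then have "\<bar>s - x\<bar> < d" using that by auto
      from d(2)[OF this] show "w x - r' \<le> w s \<and> w s \<le> w x + r'" by auto
    qed (use that r' in auto)
    have "\<bar>(F (x + h) - F x) / h - w x\<bar> \<le> r'"
    proof (cases "h > 0")
      case True
      have "(w x - r') * h \<le> F (x + h) - F x \<and> F (x + h) - F x \<le> (w x + r') * h"
        using key[of x "x + h"] h True \<open>c < x\<close> by auto
      then show ?thesis using True by (simp add: abs_le_iff field_simps)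
    next
      case False
      then have hn: "h < 0" using h by auto
      have "(w x - r') * (-h) \<le> F x - F (x + h) \<and> F x - F (x + h) \<le> (w x + r') * (-h)"
        using key[of "x + h" x] h hn d(1) by auto
      then have "\<bar>F (x + h) - F x - w x * h\<bar> \<le> r' * (- h)" by (simp add: abs_le_iff algebra_simps)
      moreover have "(F (x + h) - F x) / h - w x = (F (x + h) - F x - w x * h) / h"
        using hn by (simp add: field_simps)
      ultimately show ?thesis using hn by (simp add: abs_divide field_simps)
    qed
    then show "norm ((F (x + h) - F x) / h - w x) < r" using r' by simp
  qed
qed

definition graph_map :: "real^2 \<Rightarrow> real^2 \<Rightarrow> (real \<Rightarrow> real) \<Rightarrow> real \<Rightarrow> real^2" where
  "graph_map e n g s = frame_map e n (s, g s)"

lemma graph_map_inner [simp]: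
  assumes "orthonormal_pair e n"
  shows "graph_map e n g s \<bullet> e = s" "graph_map e n g s \<bullet> n = g s"
  using assms by (auto simp: graph_map_def)

lemma graph_map_eqI: "orthonormal_pair e n \<Longrightarrow> x \<bullet> n = g (x \<bullet> e) \<Longrightarrow> graph_map e n g (x \<bullet> e) = x"
  unfolding graph_map_def by (metis frame_map_eqI)

lemma space_hausdorff1 [simp]: "space hausdorff1 = UNIV"
  using sets_eq_imp_space_eq[OF sets_hausdorff1] by simp

lemma measurable_hausdorff1 [simp]: "measurable hausdorff1 N = measurable borel N"
  by (rule measurable_cong_sets) auto

text \<open>By the mean value theorem a chord is exactly \<open>w \<xi>\<close> times its parameter
  length, which feeds the two image estimates. They give the distribution function of the left side
  the derivative \<open>w\<close>; the fundamental theorem then evaluates it on half-open intervals,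
  which determine the measure.\<close>

lemma measure_graph:
  fixes g g' :: "real \<Rightarrow> real"
  assumes on: "orthonormal_pair e n"
    and g: "\<And>s. (g has_real_derivative g' s) (at s)" and g': "continuous_on UNIV g'"
  shows "distr (density hausdorff1 (indicator {x. x \<bullet> n = g (x \<bullet> e)})) borel (\<lambda>x. x \<bullet> e) =
    density lborel (\<lambda>s. ennreal (sqrt (1 + (g' s)\<^sup>2)))" (is "?M = ?N")
proof -
  define w where "w s = sqrt (1 + (g' s)\<^sup>2)" for s
  have wc: "continuous_on UNIV w" unfolding w_def by (intro continuous_intros g')
  then have [measurable]: "w \<in> borel_measurable borel" by (rule borel_measurable_continuous_onI)
  have wpos: "0 < w s" for s unfolding w_def by (smt (verit) real_sqrt_gt_zero zero_le_power2)
  have gc: "continuous_on UNIV g" using g by (meson DERIV_isCont continuous_at_imp_continuous_on)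
  have [measurable]: "g \<in> borel_measurable borel" using gc by (rule borel_measurable_continuous_onI)
  let ?G = "{x. x \<bullet> n = g (x \<bullet> e)}"
  let ?\<gamma> = "graph_map e n g"
  have em: "emeasure ?M {u<..v} = hausdorff1_outer (?\<gamma> ` {u<..v})" for u v
  proof -
    have *: "?\<gamma> ` {u<..v} = ?G \<inter> {x. x \<bullet> e \<in> {u<..v}}"
    proof (intro equalityI subsetI)
      fix x assume "x \<in> ?G \<inter> {x. x \<bullet> e \<in> {u<..v}}"
      then show "x \<in> ?\<gamma> ` {u<..v}" by (intro image_eqI[of _ _ "x \<bullet> e"]) (auto simp: graph_map_eqI[OF on])
    qed (use on in auto)
    have [measurable]: "?G \<in> sets borel" "{x. x \<bullet> e \<in> {u<..v}} \<in> sets borel" by measurable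
    have m: "(\<lambda>x. x \<bullet> e) \<in> measurable (density hausdorff1 (indicator ?G)) borel"
      by (subst measurable_cong_sets[OF _ refl, of _ borel]) auto
    have "emeasure ?M {u<..v} = emeasure (density hausdorff1 (indicator ?G)) {x. x \<bullet> e \<in> {u<..v}}"
      by (subst emeasure_distr[OF m]) (auto intro!: arg_cong2[where f=emeasure])
    also have "\<dots> = (\<integral>\<^sup>+x. indicator (?G \<inter> {x. x \<bullet> e \<in> {u<..v}}) x \<partial>hausdorff1)"
      unfolding indicator_inter_arith by (rule emeasure_density) simp_all
    also have "\<dots> = emeasure hausdorff1 (?G \<inter> {x. x \<bullet> e \<in> {u<..v}})"
      by (rule nn_integral_indicator) (simp only: sets_hausdorff1, measurable)
    also have "\<dots> = hausdorff1_outer (?\<gamma> ` {u<..v})"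
      unfolding * by (rule emeasure_hausdorff1) measurable
    finally show ?thesis .
  qed
  have dist: "\<exists>\<xi>\<in>{u..v}. dist (?\<gamma> x) (?\<gamma> y) = w \<xi> * \<bar>x - y\<bar>" if "x \<in> {u..v}" "y \<in> {u..v}" for u v x y
  proof -
    have "\<exists>\<xi>\<in>{u..v}. g x - g y = g' \<xi> * (x - y)"
    proof (cases "x = y")
      case True then show ?thesis using that by auto
    next
      case False
      have "\<exists>\<xi>. min x y < \<xi> \<and> \<xi> < max x y \<and> g (max x y) - g (min x y) = (max x y - min x y) * g' \<xi>"
        using False by (intro MVT2 g) auto
      then obtain \<xi> where "min x y < \<xi>" "\<xi> < max x y" "g (max x y) - g (min x y) = (max x y - min x y) * g' \<xi>"
        by blast
      then show ?thesis using that by (intro bexI[of _ \<xi>]) (auto simp: max_def min_def algebra_simps split: if_splits)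
    qed
    then obtain \<xi> where \<xi>: "\<xi> \<in> {u..v}" "g x - g y = g' \<xi> * (x - y)" by blast
    have "dist (?\<gamma> x) (?\<gamma> y) = norm (frame_map e n (x - y, g x - g y))"
      by (simp add: dist_norm graph_map_def frame_map_def algebra_simps)
    also have "\<dots> = sqrt ((1 + (g' \<xi>)\<^sup>2) * (x - y)\<^sup>2)"
      unfolding norm_frame_map[OF on] \<xi>(2) by (simp add: distrib_right power_mult_distrib)
    also have "\<dots> = w \<xi> * \<bar>x - y\<bar>" by (simp add: real_sqrt_mult w_def)
    finally show ?thesis using \<xi>(1) by blast
  qed
  have up: "emeasure ?M {u<..v} \<le> ennreal (hi * (v - u))"
    if "u \<le> v" "\<And>s. s \<in> {u..v} \<Longrightarrow> w s \<le> hi" for u v hi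
    unfolding em
  proof (rule hausdorff1_outer_lipschitz_image_le)
    show "0 \<le> hi" using that(2)[of u] wpos[of u] that(1) by auto
    fix x y assume "x \<in> {u..v}" "y \<in> {u..v}"
    from dist[OF this] show "dist (?\<gamma> x) (?\<gamma> y) \<le> hi * \<bar>x - y\<bar>"
      using that(2) by (auto intro!: mult_right_mono)
  qed (use that in auto)
  have low: "ennreal (lo * (v - u)) \<le> emeasure ?M {u<..v}"
    if "u \<le> v" "\<And>s. s \<in> {u..v} \<Longrightarrow> lo \<le> w s" "0 < lo" for u v lo
    unfolding em
  proof (rule hausdorff1_outer_expanding_image_ge)
    fix x y assume "x \<in> {u..v}" "y \<in> {u..v}"
    from dist[OF this] show "lo * \<bar>x - y\<bar> \<le> dist (?\<gamma> x) (?\<gamma> y)"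
      using that(2) by (auto intro!: mult_right_mono)
  qed (use that in auto)
  have fin: "emeasure ?M {u<..v} < top" if "u \<le> v" for u v
  proof -
    have "compact (w ` {u..v})" by (intro compact_continuous_image continuous_on_subset[OF wc]) auto
    then obtain B where "\<And>s. s \<in> {u..v} \<Longrightarrow> w s \<le> B"
      by (metis bounded_imp_bdd_above bdd_above_def compact_imp_bounded image_eqI)
    from up[OF that this] show ?thesis by (auto intro: le_less_trans)
  qed
  have eq: "emeasure ?M {a<..b} = emeasure ?N {a<..b}" if ab: "a \<le> b" for a b
  proof -
    \<comment> \<open>Starting the distribution function below \<open>a\<close> makes it
      differentiable from both sides at \<open>a\<close> as well.\<close>
    define c where "c = a - 1"
    define F where "F x = measure ?M {c<..x}" for x
    have eM: "emeasure ?M {u<..v} = ennreal (measure ?M {u<..v})" if "u \<le> v" for u v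
      using fin[OF that] by (intro emeasure_eq_ennreal_measure) auto
    have diff: "F v - F u = measure ?M {u<..v}" if "c \<le> u" "u \<le> v" for u v
    proof -
      have "{c<..v} = {c<..u} \<union> {u<..v}" using that by auto
      moreover have "measure ?M ({c<..u} \<union> {u<..v}) = measure ?M {c<..u} + measure ?M {u<..v}"
        using fin[of c u] fin[of u v] that by (intro measure_Union) auto
      ultimately show ?thesis by (simp add: F_def)
    qed
    (* The graph map is Lipschitz and expanding on short intervals, with both constants close to w. *)
    have der: "DERIV F x :> w x" if "x \<in> {a..b}" for x
    proof (rule DERIV_of_increment_bounds[where c=c])
      show "isCont w x" using wc by (simp add: continuous_on_eq_continuous_at)
      show "c < x" using that by (simp add: c_def)
      fix u v lo hi assume uv: "c \<le> u" "u \<le> v" and b: "\<And>s. s \<in> {u..v} \<Longrightarrow> lo \<le> w s \<and> w s \<le> hi" and "0 < lo"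
      have hi: "0 \<le> hi" using b[of u] uv \<open>0 < lo\<close> by auto
      have "ennreal (lo * (v - u)) \<le> ennreal (F v - F u)"
        using low[of u v lo] uv b \<open>0 < lo\<close> by (simp add: eM diff)
      moreover have "ennreal (F v - F u) \<le> ennreal (hi * (v - u))"
        using up[of u v hi] uv b by (simp add: eM diff)
      moreover have "0 \<le> F v - F u" using uv by (simp add: diff)
      ultimately show "lo * (v - u) \<le> F v - F u \<and> F v - F u \<le> hi * (v - u)"
        using uv hi by (simp add: ennreal_le_iff)
    qed (rule wpos)
    have "emeasure ?N {a<..b} = (\<integral>\<^sup>+s. ennreal (w s) * indicator {a<..b} s \<partial>lborel)"
      by (simp add: emeasure_density w_def[symmetric])
    also have "\<dots> = (\<integral>\<^sup>+s. ennreal (w s) * indicator {a..b} s \<partial>lborel)"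
      by (intro nn_integral_cong_AE) (use AE_lborel_singleton[of a] in eventually_elim, auto split: split_indicator)
    also have "\<dots> = ennreal (F b - F a)"
      using der wpos less_imp_le[OF wpos] ab by (intro nn_integral_FTC_Icc) auto
    also have "\<dots> = emeasure ?M {a<..b}" using ab by (subst diff) (auto simp: c_def eM)
    finally show ?thesis by simp
  qed
  show ?thesis
  proof (rule measure_eqI_generator_eq[where E="range (\<lambda>(a, b). {a<..b::real})" and \<Omega>=UNIV
        and A="\<lambda>i. {- real i<..real i}"])
    show "Int_stable (range (\<lambda>(a, b). {a<..b::real}))"
      by (auto simp: Int_stable_def)
    have "sets (borel::real measure) = sigma_sets UNIV (range (\<lambda>(a, b). {a<..b::real}))"
      by (subst borel_sigma_sets_Ioc) simp
    then show "sets ?M = sigma_sets UNIV (range (\<lambda>(a, b). {a<..b::real}))"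
      "sets ?N = sigma_sets UNIV (range (\<lambda>(a, b). {a<..b::real}))" by auto
    fix X :: "real set" assume "X \<in> range (\<lambda>(a, b). {a<..b})"
    then obtain a b where X: "X = {a<..b}" by auto
    show "emeasure ?M X = emeasure ?N X"
      using eq[of a b] by (cases "a \<le> b") (auto simp: X)
  next
    show "(\<Union>i. {- real i<..real i}) = UNIV"
    proof (safe)
      fix x :: real
      obtain i :: nat where "\<bar>x\<bar> < real i" using reals_Archimedean2 by blast
      then show "x \<in> (\<Union>i. {- real i<..real i})" by (intro UN_I[of i]) auto
    qed simp
    fix i show "emeasure ?M {- real i<..real i} \<noteq> \<infinity>" using fin[of "- real i" "real i"] by auto
  qed auto
qed

lemma nn_integral_graph:
  fixes g g' :: "real \<Rightarrow> real"
  assumes on: "orthonormal_pair e n"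
    and g: "\<And>s. (g has_real_derivative g' s) (at s)" and g': "continuous_on UNIV g'"
    and f [measurable]: "f \<in> borel_measurable borel"
  shows "(\<integral>\<^sup>+x. f x * indicator {x. x \<bullet> n = g (x \<bullet> e)} x \<partial>hausdorff1) =
    (\<integral>\<^sup>+s. f (graph_map e n g s) * ennreal (sqrt (1 + (g' s)\<^sup>2)) \<partial>lborel)"
proof -
  have gc: "continuous_on UNIV g" using g by (meson DERIV_isCont continuous_at_imp_continuous_on)
  have [measurable]: "g \<in> borel_measurable borel" using gc by (rule borel_measurable_continuous_onI)
  have [measurable]: "g' \<in> borel_measurable borel" using g' by (rule borel_measurable_continuous_onI)
  let ?G = "{x. x \<bullet> n = g (x \<bullet> e)}"
  let ?\<gamma> = "graph_map e n g"
  have [measurable]: "?\<gamma> \<in> borel_measurable borel" unfolding graph_map_def frame_map_def by simp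
  have i [measurable]: "indicator ?G \<in> borel_measurable borel" by measurable
  have "(\<integral>\<^sup>+s. f (?\<gamma> s) * ennreal (sqrt (1 + (g' s)\<^sup>2)) \<partial>lborel) =
      (\<integral>\<^sup>+s. f (?\<gamma> s) \<partial>density lborel (\<lambda>s. ennreal (sqrt (1 + (g' s)\<^sup>2))))"
    by (subst nn_integral_density) (auto simp: mult.commute)
  also have "\<dots> = (\<integral>\<^sup>+x. f (?\<gamma> (x \<bullet> e)) \<partial>density hausdorff1 (indicator ?G))"
    unfolding measure_graph[OF on g g', symmetric]
    by (subst nn_integral_distr) (auto simp: measurable_cong_sets[OF sets_density refl])
  also have "\<dots> = (\<integral>\<^sup>+x. indicator ?G x * f (?\<gamma> (x \<bullet> e)) \<partial>hausdorff1)"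
    by (subst nn_integral_density) (auto)
  also have "\<dots> = (\<integral>\<^sup>+x. f x * indicator ?G x \<partial>hausdorff1)"
    by (intro nn_integral_cong) (auto split: split_indicator simp: graph_map_eqI[OF on])
  finally show ?thesis by simp
qed

section \<open>Continuously differentiable fields and the divergence theorem above a graph\<close>

text \<open>The same derivative conditions as in \<open>C1_compact_support\<close>, so that fields
  built here are admissible for the perimeter. In finite dimension, continuity for each fixed
  \<open>v\<close> amounts to continuity of the derivative as an operator.\<close>

definition C1 :: "('a::real_normed_vector \<Rightarrow> 'b::real_normed_vector) \<Rightarrow> bool" where
  "C1 f \<longleftrightarrow> (\<forall>x. f differentiable (at x)) \<and>
     (\<forall>v. continuous_on UNIV (\<lambda>x. frechet_derivative f (at x) v))"

lemma C1I:
  assumes "\<And>x. (f has_derivative D x) (at x)" "\<And>v. continuous_on UNIV (\<lambda>x. D x v)"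
  shows "C1 f"
proof -
  have "frechet_derivative f (at x) = D x" for x
    using assms(1)[of x] by (rule frechet_derivative_at[symmetric])
  then show ?thesis using assms by (auto simp: C1_def differentiable_def)
qed

lemma C1_has_derivative:
  "C1 f \<Longrightarrow> (f has_derivative frechet_derivative f (at x)) (at x)"
  by (simp add: C1_def frechet_derivative_works)

lemma C1_continuous_derivative:
  "C1 f \<Longrightarrow> continuous_on UNIV (\<lambda>x. frechet_derivative f (at x) v)"
  by (simp add: C1_def)

lemma C1_continuous: "C1 f \<Longrightarrow> continuous_on UNIV f"
  by (meson C1_has_derivative continuous_at_imp_continuous_on has_derivative_continuous)

lemma C1_const [simp]: "C1 (\<lambda>x. c)"
  by (rule C1I[where D="\<lambda>_ _. 0"]) auto

lemma C1_linear: "bounded_linear f \<Longrightarrow> C1 f"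
  by (rule C1I[where D="\<lambda>_. f"]) (auto simp: bounded_linear_imp_has_derivative)

lemma C1_add: "C1 f \<Longrightarrow> C1 g \<Longrightarrow> C1 (\<lambda>x. f x + g x)"
  by (rule C1I, rule has_derivative_add; (rule C1_has_derivative)?)
    (auto intro!: continuous_intros C1_continuous_derivative)

lemma C1_sum: "finite I \<Longrightarrow> (\<And>i. i \<in> I \<Longrightarrow> C1 (f i)) \<Longrightarrow> C1 (\<lambda>x. \<Sum>i\<in>I. f i x)"
  by (induction I rule: finite_induct) (auto intro: C1_add)

lemma C1_diff: "C1 f \<Longrightarrow> C1 g \<Longrightarrow> C1 (\<lambda>x. f x - g x)"
  by (rule C1I, rule has_derivative_diff; (rule C1_has_derivative)?)
    (auto intro!: continuous_intros C1_continuous_derivative)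

lemma C1_scaleR: "C1 f \<Longrightarrow> C1 g \<Longrightarrow> C1 (\<lambda>x. f x *\<^sub>R g x)"
  by (rule C1I, rule has_derivative_scaleR; (rule C1_has_derivative)?)
    (auto intro!: continuous_intros C1_continuous_derivative intro: C1_continuous)

lemma C1_mult: "C1 f \<Longrightarrow> C1 g \<Longrightarrow> C1 (\<lambda>x. f x * g x :: real)"
  using C1_scaleR[of f g] by simp

lemma C1_inner: "C1 f \<Longrightarrow> C1 g \<Longrightarrow> C1 (\<lambda>x. f x \<bullet> g x)"
  by (rule C1I, rule has_derivative_inner; (rule C1_has_derivative)?)
    (auto intro!: continuous_intros C1_continuous_derivative intro: C1_continuous)

text \<open>The conditions on \<open>h\<close> concern the range of \<open>f\<close> alone. This
  admits functions singular at 0, such as \<open>inverse\<close> and \<open>radial_coeff\<close>,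
  composed with a positive \<open>f\<close>.\<close>

lemma C1_compose_real:
  fixes h h' :: "real \<Rightarrow> real"
  assumes f: "C1 f" and h: "\<And>x. DERIV h (f x) :> h' (f x)" and h': "continuous_on (range f) h'"
  shows "C1 (\<lambda>x. h (f x))"
proof (rule C1I)
  fix x
  show "((\<lambda>x. h (f x)) has_derivative (\<lambda>v. frechet_derivative f (at x) v * h' (f x))) (at x)"
    using has_derivative_compose[OF C1_has_derivative[OF f] h[unfolded has_field_derivative_def]]
    by (simp add: mult.commute)
next
  fix v
  show "continuous_on UNIV (\<lambda>x. frechet_derivative f (at x) v * h' (f x))"
    by (intro continuous_intros C1_continuous_derivative[OF f] continuous_on_compose2[OF h' C1_continuous[OF f]]) auto
qed

lemma C1_compact_support_iff: "C1_compact_support \<phi> \<longleftrightarrow> C1 \<phi> \<and> compact (closure {x. \<phi> x \<noteq> 0})"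
  by (auto simp: C1_compact_support_def C1_def)

text \<open>The square of the positive part is the building block of every cutoff below: it vanishes
  on a half line and is of class C1.\<close>

lemma DERIV_max0_sq: "((\<lambda>x::real. (max 0 x)\<^sup>2) has_real_derivative 2 * max 0 x) (at x)"
proof -
  consider "x < 0" | "x = 0" | "x > 0" by linarith
  then show ?thesis
  proof cases
    case 1
    then have "\<forall>\<^sub>F y in nhds x. (max 0 y)\<^sup>2 = (0::real)"
      by (auto intro!: eventually_mono[OF eventually_nhds_in_open[of "{..<0}" x]])
    then have "((\<lambda>x::real. (max 0 x)\<^sup>2) has_real_derivative 0) (at x)"
      by (subst DERIV_cong_ev[OF refl _ refl, where g="\<lambda>_. 0"]) auto
    then show ?thesis using 1 by simp
  next
    case 2
    have "((\<lambda>h::real. (max 0 h)\<^sup>2 / h) \<longlongrightarrow> 0) (at 0)"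
    proof (rule Lim_null_comparison)
      show "\<forall>\<^sub>F h in at 0. norm ((max 0 h)\<^sup>2 / h) \<le> \<bar>h\<bar>" for h :: real
        by (intro always_eventually) (auto simp: max_def power2_eq_square)
      show "((\<lambda>h::real. \<bar>h\<bar>) \<longlongrightarrow> 0) (at 0)" by (rule tendsto_eq_intros | simp)+
    qed
    then show ?thesis by (simp add: 2 DERIV_def)
  next
    case 3
    then have "\<forall>\<^sub>F y in nhds x. (max 0 y)\<^sup>2 = y\<^sup>2"
      by (auto intro!: eventually_mono[OF eventually_nhds_in_open[of "{0<..}" x]])
    moreover have "((\<lambda>x::real. x\<^sup>2) has_real_derivative 2 * x) (at x)"
      by (auto intro!: derivative_eq_intros)
    ultimately have "((\<lambda>x::real. (max 0 x)\<^sup>2) has_real_derivative 2 * x) (at x)"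
      by (subst DERIV_cong_ev[OF refl _ refl, where g="\<lambda>x. x\<^sup>2"]) auto
    then show ?thesis using 3 by simp
  qed
qed

text \<open>The divergence is the trace of the derivative and can be computed in any orthonormal
  basis.\<close>

lemma divergence_frame:
  assumes on: "orthonormal_pair e n" and d: "\<phi> differentiable (at x)"
  shows "divergence \<phi> x = frechet_derivative \<phi> (at x) e \<bullet> e + frechet_derivative \<phi> (at x) n \<bullet> n"
proof -
  let ?D = "frechet_derivative \<phi> (at x)"
  have lin: "linear ?D" using d by (simp add: linear_frechet_derivative)
  have ax: "axis i 1 = (e $ i) *\<^sub>R e + (n $ i) *\<^sub>R n" for i
    using orthonormal_pair_expand[OF on, of "axis i 1"] by (simp add: inner_axis' )
  have "divergence \<phi> x = (\<Sum>i\<in>UNIV. ?D (axis i 1) $ i)" by (simp add: divergence_def)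
  also have "\<dots> = (\<Sum>i\<in>UNIV. e $ i * ?D e $ i + n $ i * ?D n $ i)"
    by (simp add: ax linear_add[OF lin] linear_scale[OF lin])
  also have "\<dots> = ?D e \<bullet> e + ?D n \<bullet> n"
    by (simp add: inner_vec_def sum.distrib mult.commute)
  finally show ?thesis .
qed

lemma integral_deriv_compact_support:
  fixes F f :: "real \<Rightarrow> real"
  assumes F: "\<And>x. (F has_real_derivative f x) (at x)" and c: "continuous_on UNIV f"
    and z: "\<And>x. R \<le> \<bar>x\<bar> \<Longrightarrow> F x = 0"
  shows "(\<integral>x. f x \<partial>lborel) = 0" "(\<integral>x. indicator {0<..} x * f x \<partial>lborel) = - F 0"
proof -
  \<comment> \<open>Strictly above \<open>R\<close>, so that \<open>F\<close> vanishes in a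
    neighbourhood of every \<open>x\<close> with \<open>S \<le> \<bar>x\<bar>\<close> and its
    derivative vanishes there too; positive, so that 0 lies inside.\<close>
  define S where "S = max R 0 + 1"
  have S: "S > 0" "R < S" by (auto simp: S_def)
  have f0: "f x = 0" if "S \<le> \<bar>x\<bar>" for x
  proof -
    have "\<forall>\<^sub>F y in nhds x. y \<in> {y. R < \<bar>y\<bar>}"
      using that S by (intro eventually_nhds_in_open open_Collect_less continuous_intros) auto
    then have "\<forall>\<^sub>F y in nhds x. F y = 0" by eventually_elim (use z in auto)
    then have "(F has_real_derivative f x) (at x) = ((\<lambda>_. 0) has_real_derivative f x) (at x)"
      by (intro DERIV_cong_ev) auto
    with F[of x] have "((\<lambda>_. 0) has_real_derivative f x) (at x)" by simp
    then show ?thesis using DERIV_const DERIV_unique by blast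
  qed
  have ic: "isCont f x" for x using c by (simp add: continuous_on_eq_continuous_at)
  have "(\<integral>x. f x \<partial>lborel) = (\<integral>x. f x * indicator {-S..S} x \<partial>lborel)"
    by (intro Bochner_Integration.integral_cong) (auto split: split_indicator intro: f0)
  also have "\<dots> = F S - F (-S)"
    using S by (intro integral_FTC_Icc_real F ic) auto
  also have "\<dots> = 0" using z[of S] z[of "-S"] S by simp
  finally show "(\<integral>x. f x \<partial>lborel) = 0" .
  have "(\<integral>x. indicator {0<..} x * f x \<partial>lborel) = (\<integral>x. f x * indicator {0..S} x \<partial>lborel)"
  proof (rule integral_cong_AE)
    have [measurable]: "f \<in> borel_measurable borel" using c by (rule borel_measurable_continuous_onI)
    show "(\<lambda>x. indicator {0<..} x * f x) \<in> borel_measurable lborel"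
      "(\<lambda>x. f x * indicator {0..S} x) \<in> borel_measurable lborel" by measurable
    show "AE x in lborel. indicator {0<..} x * f x = f x * indicator {0..S} x"
      using AE_lborel_singleton[of 0] by eventually_elim (auto split: split_indicator intro: f0)
  qed
  also have "\<dots> = F S - F 0"
    using S by (intro integral_FTC_Icc_real F ic) auto
  finally show "(\<integral>x. indicator {0<..} x * f x \<partial>lborel) = - F 0" using z[of S] S by simp
qed

lemma integrable_continuous_bounded_support:
  fixes f :: "'a::euclidean_space \<Rightarrow> real"
  assumes c: "continuous_on UNIV f" and K: "compact K" "\<And>x. x \<notin> K \<Longrightarrow> f x = 0" and S: "S \<in> sets borel"
  shows "integrable lborel (\<lambda>x. indicator S x * f x)"
proof -
  have "integrable lborel (\<lambda>x. indicator K x *\<^sub>R f x)"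
    using continuous_on_subset[OF c] by (intro borel_integrable_compact K) auto
  moreover have "(\<lambda>x. indicator K x *\<^sub>R f x) = f" using K by (auto split: split_indicator)
  ultimately have "integrable lborel f" by simp
  from integrable_mult_indicator[OF _ this, of S] S show ?thesis by simp
qed

text \<open>The shear \<open>\<Phi>\<close>, which raises the half plane by \<open>g\<close>,
  straightens the region. In its coordinates the divergence is a derivative in \<open>s\<close>,
  which integrates to 0, plus a derivative in \<open>u\<close>, which leaves the boundary term at
  \<open>u = 0\<close>.\<close>

lemma divergence_graph:
  fixes \<phi> :: "real^2 \<Rightarrow> real^2" and g g' :: "real \<Rightarrow> real"
  assumes on: "orthonormal_pair e n"
    and g: "\<And>s. (g has_real_derivative g' s) (at s)" and g': "continuous_on UNIV g'"
    and \<phi>: "C1 \<phi>" and supp: "\<And>x. R \<le> norm x \<Longrightarrow> \<phi> x = 0"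
  shows "(\<integral>x. indicator {x. x \<bullet> n > g (x \<bullet> e)} x * divergence \<phi> x \<partial>lborel) =
    - (\<integral>s. \<phi> (frame_map e n (s, g s)) \<bullet> (n - g' s *\<^sub>R e) \<partial>lborel)"
proof -
  define D where "D x = frechet_derivative \<phi> (at x)" for x
  have D: "(\<phi> has_derivative D x) (at x)" for x
    unfolding D_def using \<phi> by (rule C1_has_derivative)
  have lin: "linear (D x)" for x using D has_derivative_linear by blast
  have Dc: "continuous_on UNIV (\<lambda>x. D x v)" for v
    unfolding D_def using \<phi> by (rule C1_continuous_derivative)
  have gc: "continuous_on UNIV g" using g by (meson DERIV_isCont continuous_at_imp_continuous_on)
  define \<Phi> where "\<Phi> = (\<lambda>p. frame_map e n (fst p, g (fst p) + snd p))"
  have \<Phi>c: "continuous_on UNIV \<Phi>"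
    unfolding \<Phi>_def by (intro continuous_intros continuous_on_compose2[OF gc]) auto
  have D\<Phi>c: "continuous_on UNIV (\<lambda>p. D (\<Phi> p) v)" for v
    by (rule continuous_on_compose2[OF Dc \<Phi>c]) simp
  have g'c: "continuous_on UNIV (\<lambda>p::real\<times>real. g' (fst p))"
    by (rule continuous_on_compose2[OF g']) (auto intro: continuous_intros)
  have D0: "D x = (\<lambda>_. 0)" if "R < norm x" for x
  proof -
    have "\<forall>\<^sub>F y in nhds x. y \<in> {y. R < norm y}"
      using that by (intro eventually_nhds_in_open open_Collect_less continuous_intros) auto
    then have ev: "\<forall>\<^sub>F y in nhds x. \<phi> y = 0" by eventually_elim (use supp in auto)
    have "((\<lambda>_. 0) has_derivative D x) (at x)"
      by (rule has_derivative_transform_eventually[OF D])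
        (use ev eventually_nhds_x_imp_x in \<open>auto simp: eventually_at_filter elim: eventually_mono\<close>)
    then show ?thesis using has_derivative_const has_derivative_unique by blast
  qed
  \<comment> \<open>A bound for the graph over the support window; it confines the support of the
    sheared field to the compact rectangle \<open>K\<close>.\<close>
  define G where "G = Sup ((\<lambda>s. \<bar>g s\<bar>) ` {-R..R})"
  have G: "\<bar>g s\<bar> \<le> G" if "\<bar>s\<bar> \<le> R" for s
    unfolding G_def
  proof (rule cSup_upper)
    have "compact ((\<lambda>s. \<bar>g s\<bar>) ` {-R..R})"
      by (intro compact_continuous_image continuous_intros continuous_on_subset[OF gc]) auto
    then show "bdd_above ((\<lambda>s. \<bar>g s\<bar>) ` {-R..R})"
      by (intro bounded_imp_bdd_above compact_imp_bounded)
  qed (use that in \<open>auto intro!: imageI\<close>)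
  define K where "K = {-R..R} \<times> {-(R+G)..R+G}"
  have far: "R < norm (\<Phi> p)" if "p \<notin> K" for p
  proof (rule ccontr)
    assume "\<not> R < norm (\<Phi> p)"
    then have le: "norm (\<Phi> p) \<le> R" by simp
    have "\<bar>\<Phi> p \<bullet> e\<bar> \<le> norm (\<Phi> p)" "\<bar>\<Phi> p \<bullet> n\<bar> \<le> norm (\<Phi> p)"
      using orthonormal_pair_abs_inner_le[OF on, of "\<Phi> p"] by auto
    then have "\<bar>fst p\<bar> \<le> R" "\<bar>g (fst p) + snd p\<bar> \<le> R" using le on by (auto simp: \<Phi>_def)
    with G[of "fst p"] have "p \<in> K" by (cases p) (auto simp: K_def)
    with that show False by simp
  qed
  have Kc: "compact K" unfolding K_def by (intro compact_Times) auto
  have bp [simp]: "borel \<Otimes>\<^sub>M borel = (borel :: (real\<times>real) measure)" by (simp add: borel_prod)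
  have intg: "integrable (lborel \<Otimes>\<^sub>M lborel) (\<lambda>p. indicator S p * f p)"
    if "continuous_on UNIV f" "\<And>p. R < norm (\<Phi> p) \<Longrightarrow> f p = 0" "S \<in> sets borel" for f :: "real\<times>real \<Rightarrow> real" and S
    unfolding lborel_prod using that far by (intro integrable_continuous_bounded_support[OF _ Kc]) auto
  \<comment> \<open>\<open>A\<close> is the \<open>s\<close> derivative of the component along
    \<open>e\<close> of the sheared field, \<open>B\<close> the \<open>u\<close> derivative of its
    component along \<open>n - g' *\<^sub>R e\<close>. The two terms with \<open>g'\<close> cancel
    in \<open>A + B\<close>, which leaves the trace.\<close>
  define A where "A p = D (\<Phi> p) (e + g' (fst p) *\<^sub>R n) \<bullet> e" for p
  define B where "B p = D (\<Phi> p) n \<bullet> (n - g' (fst p) *\<^sub>R e)" for p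
  have Ac: "continuous_on UNIV A"
    unfolding A_def linear_add[OF lin] linear_scale[OF lin] by (intro continuous_intros D\<Phi>c g'c)
  have Bc: "continuous_on UNIV B"
    unfolding B_def by (intro continuous_intros D\<Phi>c g'c)
  have A0: "A p = 0" and B0: "B p = 0" if "R < norm (\<Phi> p)" for p
    using D0[OF that] by (auto simp: A_def B_def)
  have div: "divergence \<phi> (\<Phi> p) = A p + B p" for p
    using divergence_frame[OF on, of \<phi> "\<Phi> p"] \<phi>
    by (simp add: C1_def A_def B_def D_def[symmetric] linear_add[OF lin] linear_scale[OF lin] inner_simps)
  let ?P = "UNIV \<times> {0<..} :: (real \<times> real) set"
  have P: "?P \<in> sets borel" by (intro borel_open open_Times) auto
  have iA: "integrable (lborel \<Otimes>\<^sub>M lborel) (\<lambda>p. indicator ?P p * A p)" by (intro intg Ac A0 P)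
  have iB: "integrable (lborel \<Otimes>\<^sub>M lborel) (\<lambda>p. indicator ?P p * B p)" by (intro intg Bc B0 P)
  have divc: "continuous_on UNIV (divergence \<phi>)"
  proof -
    have "divergence \<phi> = (\<lambda>x. D x e \<bullet> e + D x n \<bullet> n)"
      using divergence_frame[OF on] \<phi> by (auto simp: C1_def D_def)
    then show ?thesis using Dc by (auto intro!: continuous_intros)
  qed
  have [measurable]: "g \<in> borel_measurable borel" using gc by (rule borel_measurable_continuous_onI)
  have [measurable]: "divergence \<phi> \<in> borel_measurable borel" using divc by (rule borel_measurable_continuous_onI)
  let ?h = "\<lambda>p. indicator {p. snd p > g (fst p)} p * divergence \<phi> (frame_map e n p)"
  have ih: "integrable (lborel \<Otimes>\<^sub>M lborel) ?h"
    unfolding lborel_prod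
  proof (rule integrable_continuous_bounded_support)
    show "compact ({-R..R} \<times> {-R..R})" by (intro compact_Times) auto
    show "continuous_on UNIV (\<lambda>p. divergence \<phi> (frame_map e n p))"
      by (rule continuous_on_compose2[OF divc]) (auto intro: continuous_intros)
    show "{p. snd p > g (fst p)} \<in> sets borel"
      by (intro borel_open open_Collect_less continuous_intros continuous_on_compose2[OF gc]) auto
    fix p :: "real \<times> real" assume "p \<notin> {-R..R} \<times> {-R..R}"
    then have "R < \<bar>fst p\<bar> \<or> R < \<bar>snd p\<bar>" by (cases p) auto
    moreover have "\<bar>fst p\<bar> \<le> norm (frame_map e n p)" "\<bar>snd p\<bar> \<le> norm (frame_map e n p)"
      using orthonormal_pair_abs_inner_le[OF on, of "frame_map e n p"] by (auto simp: frame_map_inner[OF on])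
    ultimately have "R < norm (frame_map e n p)" by linarith
    from D0[OF this] show "divergence \<phi> (frame_map e n p) = 0"
      using divergence_frame[OF on, of \<phi> "frame_map e n p"] \<phi> by (simp add: C1_def D_def)
  qed
  have "(\<integral>x. indicator {x. x \<bullet> n > g (x \<bullet> e)} x * divergence \<phi> x \<partial>lborel) = (\<integral>p. ?h p \<partial>(lborel \<Otimes>\<^sub>M lborel))"
    by (subst integral_frame[OF on]) (auto intro!: Bochner_Integration.integral_cong simp: on split: split_indicator)
  also have "\<dots> = (\<integral>s. \<integral>t. ?h (s, t) \<partial>lborel \<partial>lborel)"
    by (rule lborel_pair.integral_fst'[OF ih, symmetric])
  also have "\<dots> = (\<integral>s. \<integral>u. indicator ?P (s, u) * (A (s, u) + B (s, u)) \<partial>lborel \<partial>lborel)"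
  proof (rule Bochner_Integration.integral_cong[OF refl])
    fix s :: real
    \<comment> \<open>The shear is a translation in each fibre, so its Jacobian is 1.\<close>
    have "(\<integral>t. ?h (s, t) \<partial>lborel) = (\<integral>u. ?h (s, g s + 1 * u) \<partial>lborel)"
      by (subst lborel_integral_real_affine[of 1 _ "g s"]) auto
    then show "(\<integral>t. ?h (s, t) \<partial>lborel) = (\<integral>u. indicator ?P (s, u) * (A (s, u) + B (s, u)) \<partial>lborel)"
      unfolding div[symmetric] by (simp add: \<Phi>_def indicator_def)
  qed
  also have "\<dots> = (\<integral>p. indicator ?P p * (A p + B p) \<partial>(lborel \<Otimes>\<^sub>M lborel))"
    using lborel_pair.integral_fst'[OF Bochner_Integration.integrable_add[OF iA iB]]
    by (simp add: distrib_left)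
  also have "\<dots> = (\<integral>p. indicator ?P p * A p \<partial>(lborel \<Otimes>\<^sub>M lborel)) + (\<integral>p. indicator ?P p * B p \<partial>(lborel \<Otimes>\<^sub>M lborel))"
    using Bochner_Integration.integral_add[OF iA iB] by (simp add: distrib_left)
  also have "(\<integral>p. indicator ?P p * A p \<partial>(lborel \<Otimes>\<^sub>M lborel)) = (\<integral>u. \<integral>s. indicator ?P (s, u) * A (s, u) \<partial>lborel \<partial>lborel)"
    using lborel_pair.integral_snd[of "\<lambda>s u. indicator ?P (s, u) * A (s, u)"] iA by (simp add: split_beta')
  also have "\<dots> = integral\<^sup>L lborel (\<lambda>u::real. 0::real)"
  proof (rule Bochner_Integration.integral_cong[OF refl])
    fix u :: real
    have "(\<integral>s. A (s, u) \<partial>lborel) = 0"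
    proof (rule integral_deriv_compact_support(1))
      fix s
      have "((\<lambda>s. \<Phi> (s, u)) has_derivative (\<lambda>h. h *\<^sub>R (e + g' s *\<^sub>R n))) (at s)"
        unfolding \<Phi>_def frame_map_def
        using g[of s] by (auto intro!: derivative_eq_intros simp: has_field_derivative_def algebra_simps)
      from has_derivative_inner_left[OF has_derivative_compose[OF this D], of e]
      show "((\<lambda>s. \<phi> (\<Phi> (s, u)) \<bullet> e) has_real_derivative A (s, u)) (at s)"
        unfolding has_field_derivative_def A_def by (simp add: linear_scale[OF lin] mult_commute_abs)
    next
      show "continuous_on UNIV (\<lambda>s. A (s, u))"
        by (rule continuous_on_compose2[OF Ac]) (auto intro: continuous_intros)
      fix s assume "R + 1 \<le> \<bar>s\<bar>"
      then have "(s, u) \<notin> K" by (auto simp: K_def)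
      from far[OF this] show "\<phi> (\<Phi> (s, u)) \<bullet> e = 0" using supp by simp
    qed
    then show "(\<integral>s. indicator ?P (s, u) * A (s, u) \<partial>lborel) = 0"
      by (cases "u > 0") (auto simp: indicator_def)
  qed
  also have "(\<integral>p. indicator ?P p * B p \<partial>(lborel \<Otimes>\<^sub>M lborel)) = (\<integral>s. \<integral>u. indicator ?P (s, u) * B (s, u) \<partial>lborel \<partial>lborel)"
    using lborel_pair.integral_fst'[OF iB] by simp
  also have "\<dots> = (\<integral>s. - (\<phi> (frame_map e n (s, g s)) \<bullet> (n - g' s *\<^sub>R e)) \<partial>lborel)"
  proof (rule Bochner_Integration.integral_cong[OF refl])
    fix s :: real
    let ?F = "\<lambda>u. \<phi> (\<Phi> (s, u)) \<bullet> (n - g' s *\<^sub>R e)"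
    have "(\<integral>u. indicator {0<..} u * B (s, u) \<partial>lborel) = - ?F 0"
    proof (rule integral_deriv_compact_support(2))
      fix u
      have "((\<lambda>u. \<Phi> (s, u)) has_derivative (\<lambda>h. h *\<^sub>R n)) (at u)"
        unfolding \<Phi>_def frame_map_def by (auto intro!: derivative_eq_intros)
      from has_derivative_inner_left[OF has_derivative_compose[OF this D], of "n - g' s *\<^sub>R e"]
      show "(?F has_real_derivative B (s, u)) (at u)"
        unfolding has_field_derivative_def B_def by (simp add: linear_scale[OF lin] mult_commute_abs)
    next
      show "continuous_on UNIV (\<lambda>u. B (s, u))"
        by (rule continuous_on_compose2[OF Bc]) (auto intro: continuous_intros)
      fix u assume "R + G + 1 \<le> \<bar>u\<bar>"
      then have "(s, u) \<notin> K" by (auto simp: K_def)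
      from far[OF this] show "?F u = 0" using supp by simp
    qed
    then show "(\<integral>u. indicator ?P (s, u) * B (s, u) \<partial>lborel) = - (\<phi> (frame_map e n (s, g s)) \<bullet> (n - g' s *\<^sub>R e))"
      by (simp add: \<Phi>_def indicator_def)
  qed
  finally show ?thesis by simp
qed

section \<open>Charts, inner normal and boundary measure\<close>

lemma smooth_realD:
  assumes "smooth_real g"
  shows "(g has_real_derivative deriv g x) (at x)"
    "(deriv g has_real_derivative deriv (deriv g) x) (at x)"
    "continuous_on UNIV g" "continuous_on UNIV (deriv g)" "continuous_on UNIV (deriv (deriv g))"
proof -
  have d: "(deriv ^^ k) g differentiable (at y)" for k y
    using assms by (simp add: smooth_real_def)
  have c: "continuous_on UNIV ((deriv ^^ k) g)" for k
    using d by (intro continuous_at_imp_continuous_on ballI differentiable_imp_continuous_within)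
  show "(g has_real_derivative deriv g x) (at x)" "(deriv g has_real_derivative deriv (deriv g) x) (at x)"
    using d[of 0 x] d[of 1 x] by (auto simp: DERIV_deriv_iff_real_differentiable)
  show "continuous_on UNIV g" "continuous_on UNIV (deriv g)" "continuous_on UNIV (deriv (deriv g))"
    using c[of 0] c[of 1] c[of 2] by (auto simp: numeral_2_eq_2)
qed

text \<open>The centre may be any point of the plane: \<open>chart_ball\<close> turns a ball inside
  \<Omega> into a chart, so that one atlas covers interior and boundary alike.\<close>

definition chart :: "(real^2) set \<Rightarrow> real^2 \<Rightarrow> real \<Rightarrow> real^2 \<Rightarrow> real^2 \<Rightarrow> (real \<Rightarrow> real) \<Rightarrow> bool" where
  "chart \<Omega> p r e n g \<longleftrightarrow> 0 < r \<and> orthonormal_pair e n \<and> smooth_real g \<and>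
     \<Omega> \<inter> ball p r = {x \<in> ball p r. x \<bullet> n > g (x \<bullet> e)}"

lemma regular_set_chart:
  assumes "regular_set \<Omega>" "p \<in> frontier \<Omega>"
  obtains r e n g where "chart \<Omega> p r e n g"
  using assms unfolding regular_set_def smooth_boundary_def chart_def orthonormal_pair_def by blast

lemma chartD:
  assumes "chart \<Omega> p r e n g"
  shows "0 < r" "orthonormal_pair e n" "smooth_real g"
  using assms by (auto simp: chart_def)

lemma chart_mem:
  assumes "chart \<Omega> p r e n g" "x \<in> ball p r"
  shows "x \<in> \<Omega> \<longleftrightarrow> g (x \<bullet> e) < x \<bullet> n"
  using assms unfolding chart_def by blast

text \<open>Points strictly above the graph are interior and points strictly below are exterior,
  both conditions being open. A point on the graph is outside \<Omega> but becomes a point of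
  \<Omega> after an arbitrarily small shift along \<open>n\<close>.\<close>

lemma chart_frontier:
  assumes ch: "chart \<Omega> p r e n g" and q: "q \<in> ball p r"
  shows "q \<in> frontier \<Omega> \<longleftrightarrow> q \<bullet> n = g (q \<bullet> e)"
proof -
  note on = chartD(2)[OF ch] and sm = smooth_realD[OF chartD(3)[OF ch]]
  have c: "continuous_on UNIV (\<lambda>x. g (x \<bullet> e))"
    by (rule continuous_on_compose2[OF sm(3)]) (auto intro: continuous_intros)
  have o1: "open (ball p r \<inter> {x. g (x \<bullet> e) < x \<bullet> n})" and o2: "open (ball p r \<inter> {x. x \<bullet> n < g (x \<bullet> e)})"
    by (intro open_Int open_ball open_Collect_less c continuous_intros)+
  consider "q \<bullet> n = g (q \<bullet> e)" | "g (q \<bullet> e) < q \<bullet> n" | "q \<bullet> n < g (q \<bullet> e)" by linarith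
  then show ?thesis
  proof cases
    case 1
    have "q \<notin> interior \<Omega>" using interior_subset chart_mem[OF ch q] 1 by auto
    moreover have "q \<in> closure \<Omega>"
      unfolding closure_approachable
    proof (intro allI impI)
      fix \<epsilon> :: real assume "0 < \<epsilon>"
      define s where "s = min (\<epsilon>/2) ((r - dist p q)/2)"
      have s: "0 < s" "s < \<epsilon>" "dist p q + s < r" using \<open>0 < \<epsilon>\<close> q by (auto simp: s_def min_def field_simps)
      have d: "dist (q + s *\<^sub>R n) q = s" using on s by (simp add: dist_norm orthonormal_pair_def)
      have "dist p (q + s *\<^sub>R n) \<le> dist p q + s"
        using dist_triangle[of p "q + s *\<^sub>R n" q] d by (simp add: dist_commute)
      then have "q + s *\<^sub>R n \<in> ball p r" using s by simp
      then have "q + s *\<^sub>R n \<in> \<Omega>"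
        using chart_mem[OF ch] 1 s orthonormal_pair_inner[OF on] by (simp add: inner_simps)
      then show "\<exists>y\<in>\<Omega>. dist y q < \<epsilon>" using d s by (intro bexI[of _ "q + s *\<^sub>R n"]) auto
    qed
    ultimately show ?thesis using 1 by (simp add: frontier_def)
  next
    case 2
    have "ball p r \<inter> {x. g (x \<bullet> e) < x \<bullet> n} \<subseteq> \<Omega>" using chart_mem[OF ch] by auto
    then have "ball p r \<inter> {x. g (x \<bullet> e) < x \<bullet> n} \<subseteq> interior \<Omega>" by (rule interior_maximal[OF _ o1])
    then have "q \<in> interior \<Omega>" using 2 q by blast
    then show ?thesis using 2 by (simp add: frontier_def)
  next
    case 3
    have "ball p r \<inter> {x. x \<bullet> n < g (x \<bullet> e)} \<inter> \<Omega> = {}" using chart_mem[OF ch] by force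
    then have "ball p r \<inter> {x. x \<bullet> n < g (x \<bullet> e)} \<inter> closure \<Omega> = {}"
      using open_Int_closure_eq_empty[OF o2] by blast
    then show ?thesis using 3 q by (auto simp: frontier_def)
  qed
qed

text \<open>The unit normal of the graph pointing to the side of \<Omega>, extended constantly in
  the direction \<open>n\<close>. The extension is a field on the whole plane and can serve in a
  test field for the perimeter.\<close>

definition chart_normal :: "real^2 \<Rightarrow> real^2 \<Rightarrow> (real \<Rightarrow> real) \<Rightarrow> real^2 \<Rightarrow> real^2" where
  "chart_normal e n g x =
     (1 / sqrt (1 + (deriv g (x \<bullet> e))\<^sup>2)) *\<^sub>R (n - deriv g (x \<bullet> e) *\<^sub>R e)"

lemma sqrt_1_plus_sq_pos: "0 < sqrt (1 + (a::real)\<^sup>2)"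
  by (simp add: add_pos_nonneg)

lemma norm_chart_normal:
  assumes "orthonormal_pair e n"
  shows "norm (chart_normal e n g x) = 1"
proof -
  have "norm (n - deriv g (x \<bullet> e) *\<^sub>R e) = sqrt (1 + (deriv g (x \<bullet> e))\<^sup>2)"
    using orthonormal_pair_inner[OF assms]
    by (simp add: norm_eq_sqrt_inner inner_simps power2_eq_square)
  then show ?thesis using sqrt_1_plus_sq_pos[of "deriv g (x \<bullet> e)"] by (simp add: chart_normal_def)
qed

lemma C1_chart_normal:
  assumes "smooth_real g"
  shows "C1 (chart_normal e n g)"
  unfolding chart_normal_def
proof (intro C1_scaleR C1_diff C1_const)
  note sm = smooth_realD[OF assms]
  have lin: "C1 (\<lambda>x. x \<bullet> e)" by (intro C1_linear bounded_linear_inner_left)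
  show "C1 (\<lambda>x. deriv g (x \<bullet> e))"
    by (rule C1_compose_real[OF lin sm(2)]) (rule continuous_on_subset[OF sm(5)], simp)
  let ?h = "\<lambda>s. - (deriv g s * deriv (deriv g) s) / sqrt (1 + (deriv g s)\<^sup>2) ^ 3"
  show "C1 (\<lambda>x. 1 / sqrt (1 + (deriv g (x \<bullet> e))\<^sup>2))"
  proof (rule C1_compose_real[OF lin, where h="\<lambda>s. 1 / sqrt (1 + (deriv g s)\<^sup>2)" and h'="?h"])
    fix x
    let ?s = "x \<bullet> e"
    have p: "0 < 1 + (deriv g ?s)\<^sup>2" by (simp add: add_pos_nonneg)
    have "((\<lambda>s. 1 / sqrt (1 + (deriv g s)\<^sup>2)) has_real_derivative
      - (inverse (sqrt (1 + (deriv g ?s)\<^sup>2)) / 2 * (2 * deriv g ?s * deriv (deriv g) ?s)) / (sqrt (1 + (deriv g ?s)\<^sup>2))\<^sup>2) (at ?s)"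
      using p sqrt_1_plus_sq_pos[of "deriv g ?s"]
      by (auto intro!: derivative_eq_intros sm(2) simp: power2_eq_square)
    also have "- (inverse (sqrt (1 + (deriv g ?s)\<^sup>2)) / 2 * (2 * deriv g ?s * deriv (deriv g) ?s)) / (sqrt (1 + (deriv g ?s)\<^sup>2))\<^sup>2 = ?h ?s"
      using sqrt_1_plus_sq_pos[of "deriv g ?s"] by (simp add: field_simps power2_eq_square power3_eq_cube)
    finally show "((\<lambda>s. 1 / sqrt (1 + (deriv g s)\<^sup>2)) has_real_derivative ?h ?s) (at ?s)" .
  next
    have "sqrt (1 + (deriv g s)\<^sup>2) ^ 3 \<noteq> 0" for s using sqrt_1_plus_sq_pos[of "deriv g s"] by simp
    then have "continuous_on UNIV ?h"
      by (intro continuous_intros sm(4,5)) auto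
    then show "continuous_on (range (\<lambda>x. x \<bullet> e)) ?h" by (rule continuous_on_subset) simp
  qed
qed

text \<open>A description free of charts, so that overlapping charts give the same vector.
  Tangential directions are left open because a tangent ray may run on either side of the
  boundary.\<close>

definition is_inner_normal :: "(real^2) set \<Rightarrow> real^2 \<Rightarrow> real^2 \<Rightarrow> bool" where
  "is_inner_normal \<Omega> q \<nu> \<longleftrightarrow> norm \<nu> = 1 \<and>
     (\<forall>v. v \<bullet> \<nu> > 0 \<longrightarrow> (\<forall>\<^sub>F s in at_right 0. q + s *\<^sub>R v \<in> \<Omega>)) \<and>
     (\<forall>v. v \<bullet> \<nu> < 0 \<longrightarrow> (\<forall>\<^sub>F s in at_right 0. q + s *\<^sub>R v \<notin> \<Omega>))"

text \<open>The value \<open>0\<close> off the boundary makes \<open>inner_normal \<Omega>\<close> Borel measurable on the whole plane.\<close>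

definition inner_normal :: "(real^2) set \<Rightarrow> real^2 \<Rightarrow> real^2" where
  "inner_normal \<Omega> q = (if q \<in> frontier \<Omega> then THE \<nu>. is_inner_normal \<Omega> q \<nu> else 0)"

text \<open>Two different unit vectors have inner product below 1, so the ray in the direction of
  their difference would have to enter \<Omega> for one of them and stay outside for the
  other.\<close>

lemma is_inner_normal_unique:
  assumes "is_inner_normal \<Omega> q \<nu>" "is_inner_normal \<Omega> q \<nu>'"
  shows "\<nu> = \<nu>'"
proof (rule ccontr)
  assume ne: "\<nu> \<noteq> \<nu>'"
  have n: "\<nu> \<bullet> \<nu> = 1" "\<nu>' \<bullet> \<nu>' = 1" using assms by (auto simp: is_inner_normal_def norm_eq_1)
  have "0 < (\<nu> - \<nu>') \<bullet> (\<nu> - \<nu>')" using ne by simp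
  then have lt: "\<nu> \<bullet> \<nu>' < 1" using n by (simp add: inner_simps inner_commute)
  have "0 < (\<nu> - \<nu>') \<bullet> \<nu>" "(\<nu> - \<nu>') \<bullet> \<nu>' < 0"
    using lt n inner_commute[of \<nu> \<nu>'] by (simp_all add: inner_diff_left)
  with assms have "\<forall>\<^sub>F s in at_right 0. q + s *\<^sub>R (\<nu> - \<nu>') \<in> \<Omega>" "\<forall>\<^sub>F s in at_right 0. q + s *\<^sub>R (\<nu> - \<nu>') \<notin> \<Omega>"
    unfolding is_inner_normal_def by blast+
  then have "\<forall>\<^sub>F s in at_right (0::real). False" by eventually_elim simp
  then show False by simp
qed

lemma chart_is_inner_normal:
  assumes ch: "chart \<Omega> p r e n g" and q: "q \<in> ball p r" "q \<in> frontier \<Omega>"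
  shows "is_inner_normal \<Omega> q (chart_normal e n g q)"
proof -
  note on = chartD(2)[OF ch] and sm = smooth_realD[OF chartD(3)[OF ch]]
  define w where "w = sqrt (1 + (deriv g (q \<bullet> e))\<^sup>2)"
  have w: "0 < w" unfolding w_def by (rule sqrt_1_plus_sq_pos)
  have qn: "q \<bullet> n = g (q \<bullet> e)" using chart_frontier[OF ch q(1)] q(2) by simp
  \<comment> \<open>Height above the graph along the ray in direction \<open>v\<close>. Its
    derivative at 0 is a positive multiple of the normal component of \<open>v\<close>, so the sign
    of that component decides on which side the ray starts.\<close>
  define h where "h v s = (q + s *\<^sub>R v) \<bullet> n - g ((q + s *\<^sub>R v) \<bullet> e)" for v s
  have h0: "h v 0 = 0" for v by (simp add: h_def qn)
  have dh: "(h v has_real_derivative w * (v \<bullet> chart_normal e n g q)) (at 0)" for v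
  proof -
    have d: "((\<lambda>s. g ((q + s *\<^sub>R v) \<bullet> e)) has_real_derivative deriv g (q \<bullet> e) * (v \<bullet> e)) (at 0)"
      by (rule DERIV_chain2[where g="\<lambda>s. (q + s *\<^sub>R v) \<bullet> e"])
        (use sm(1)[of "q \<bullet> e"] in \<open>auto intro!: derivative_eq_intros simp: inner_simps\<close>)
    have "(h v has_real_derivative v \<bullet> n - deriv g (q \<bullet> e) * (v \<bullet> e)) (at 0)"
      unfolding h_def by (intro DERIV_diff d) (auto intro!: derivative_eq_intros simp: inner_simps)
    also have "v \<bullet> n - deriv g (q \<bullet> e) * (v \<bullet> e) = w * (v \<bullet> chart_normal e n g q)"
      using w by (simp add: chart_normal_def w_def[symmetric] inner_simps)
    finally show ?thesis .
  qed
  have ball: "\<forall>\<^sub>F s in at_right 0. q + s *\<^sub>R v \<in> ball p r" for v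
  proof -
    have "((\<lambda>s. q + s *\<^sub>R v) \<longlongrightarrow> q + 0 *\<^sub>R v) (at_right 0)" by (intro tendsto_intros)
    then show ?thesis using q(1) by (intro topological_tendstoD) auto
  qed
  show ?thesis
    unfolding is_inner_normal_def
  proof (intro conjI allI impI)
    show "norm (chart_normal e n g q) = 1" by (rule norm_chart_normal[OF on])
    fix v
    { assume "0 < v \<bullet> chart_normal e n g q"
      then obtain d where d: "d > 0" "\<And>s. 0 < s \<Longrightarrow> s < d \<Longrightarrow> h v 0 < h v (0 + s)"
        using DERIV_pos_inc_right[OF dh] w by (metis mult_pos_pos)
      have "\<forall>\<^sub>F s in at_right 0. s \<in> {0<..<d}" by (rule eventually_at_right_real[OF d(1)])
      with ball[of v] show "\<forall>\<^sub>F s in at_right 0. q + s *\<^sub>R v \<in> \<Omega>"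
      proof eventually_elim
        case (elim s)
        then show ?case using chart_mem[OF ch, of "q + s *\<^sub>R v"] d(2)[of s] h0[of v] by (simp add: h_def)
      qed }
    { assume "v \<bullet> chart_normal e n g q < 0"
      then obtain d where d: "d > 0" "\<And>s. 0 < s \<Longrightarrow> s < d \<Longrightarrow> h v 0 > h v (0 + s)"
        using DERIV_neg_dec_right[OF dh] w by (metis mult_pos_neg)
      have "\<forall>\<^sub>F s in at_right 0. s \<in> {0<..<d}" by (rule eventually_at_right_real[OF d(1)])
      with ball[of v] show "\<forall>\<^sub>F s in at_right 0. q + s *\<^sub>R v \<notin> \<Omega>"
      proof eventually_elim
        case (elim s)
        then show ?case using chart_mem[OF ch, of "q + s *\<^sub>R v"] d(2)[of s] h0[of v] by (simp add: h_def)
      qed }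
  qed
qed

lemma inner_normal_eq:
  assumes "is_inner_normal \<Omega> q \<nu>" "q \<in> frontier \<Omega>"
  shows "inner_normal \<Omega> q = \<nu>"
  unfolding inner_normal_def using assms is_inner_normal_unique by (auto intro!: the_equality)

lemma inner_normal_chart:
  assumes "chart \<Omega> p r e n g" "q \<in> ball p r" "q \<in> frontier \<Omega>"
  shows "inner_normal \<Omega> q = chart_normal e n g q"
  using inner_normal_eq[OF chart_is_inner_normal[OF assms] assms(3)] .

lemma regular_set_inner_normal:
  assumes "regular_set \<Omega>" "q \<in> frontier \<Omega>"
  shows "is_inner_normal \<Omega> q (inner_normal \<Omega> q)" "norm (inner_normal \<Omega> q) = 1"
proof -
  obtain r e n g where ch: "chart \<Omega> q r e n g" by (rule regular_set_chart[OF assms])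
  have q: "q \<in> ball q r" using chartD(1)[OF ch] by simp
  show "is_inner_normal \<Omega> q (inner_normal \<Omega> q)"
    using chart_is_inner_normal[OF ch q assms(2)] inner_normal_chart[OF ch q assms(2)] by simp
  then show "norm (inner_normal \<Omega> q) = 1" by (simp add: is_inner_normal_def)
qed

lemma norm_inner_normal_le: "regular_set \<Omega> \<Longrightarrow> norm (inner_normal \<Omega> q) \<le> 1"
  using regular_set_inner_normal(2)[of \<Omega> q] by (cases "q \<in> frontier \<Omega>") (auto simp: inner_normal_def)

text \<open>In each chart the normal is the restriction of a continuous field, hence it is
  continuous on the closed set \<open>frontier \<Omega>\<close>; extension by 0 keeps it
  Borel.\<close>

lemma borel_measurable_inner_normal [measurable]:
  assumes "regular_set \<Omega>"
  shows "inner_normal \<Omega> \<in> borel_measurable borel"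
proof -
  have "continuous_on (frontier \<Omega>) (inner_normal \<Omega>)"
    unfolding continuous_on_eq_continuous_within
  proof
    fix q assume q: "q \<in> frontier \<Omega>"
    obtain r e n g where ch: "chart \<Omega> q r e n g" by (rule regular_set_chart[OF assms q])
    have "continuous (at q within frontier \<Omega>) (chart_normal e n g)"
      using C1_continuous[OF C1_chart_normal[OF chartD(3)[OF ch]]]
      by (meson continuous_at_imp_continuous_at_within continuous_on_eq_continuous_at iso_tuple_UNIV_I open_UNIV)
    then show "continuous (at q within frontier \<Omega>) (inner_normal \<Omega>)"
      by (rule continuous_transform_within[OF _ chartD(1)[OF ch] q])
        (use inner_normal_chart[OF ch] in \<open>auto simp: dist_commute\<close>)
  qed
  then have "(\<lambda>q. indicator (frontier \<Omega>) q *\<^sub>R inner_normal \<Omega> q) \<in> borel_measurable borel"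
    by (intro borel_measurable_continuous_on_indicator) auto
  also have "(\<lambda>q. indicator (frontier \<Omega>) q *\<^sub>R inner_normal \<Omega> q) = inner_normal \<Omega>"
    by (auto simp: inner_normal_def indicator_def)
  finally show ?thesis .
qed

text \<open>For regular sets this is a finite measure, as Fubini with \<open>lborel\<close> and
  majorization by constants require.\<close>

definition boundary_measure :: "(real^2) set \<Rightarrow> (real^2) measure" where
  "boundary_measure \<Omega> = density hausdorff1 (indicator (frontier \<Omega>))"

lemma sets_boundary_measure [simp, measurable_cong]: "sets (boundary_measure \<Omega>) = sets borel"
  by (simp add: boundary_measure_def)

lemma measurable_boundary_measure [simp]: "measurable (boundary_measure \<Omega>) N = measurable borel N"
  by (rule measurable_cong_sets) auto

lemma space_boundary_measure [simp]: "space (boundary_measure \<Omega>) = UNIV"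
  by (simp add: boundary_measure_def)

lemma nn_integral_boundary_measure:
  "f \<in> borel_measurable borel \<Longrightarrow>
    (\<integral>\<^sup>+x. f x \<partial>boundary_measure \<Omega>) = (\<integral>\<^sup>+x. f x * indicator (frontier \<Omega>) x \<partial>hausdorff1)"
  unfolding boundary_measure_def by (subst nn_integral_density) (auto simp: mult.commute)

lemma AE_boundary_measure: "AE x in boundary_measure \<Omega>. x \<in> frontier \<Omega>"
  unfolding boundary_measure_def by (subst AE_density) (auto simp: indicator_def)

lemma nn_integral_boundary_chart:
  assumes ch: "chart \<Omega> p r e n g" and f [measurable]: "f \<in> borel_measurable borel"
    and z: "\<And>x. x \<notin> ball p r \<Longrightarrow> f x = 0"
  shows "(\<integral>\<^sup>+x. f x \<partial>boundary_measure \<Omega>) =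
    (\<integral>\<^sup>+s. f (graph_map e n g s) * ennreal (sqrt (1 + (deriv g s)\<^sup>2)) \<partial>lborel)"
proof -
  note on = chartD(2)[OF ch] and sm = smooth_realD[OF chartD(3)[OF ch]]
  have "(\<integral>\<^sup>+x. f x \<partial>boundary_measure \<Omega>) = (\<integral>\<^sup>+x. f x * indicator {x. x \<bullet> n = g (x \<bullet> e)} x \<partial>hausdorff1)"
    unfolding nn_integral_boundary_measure[OF f]
  proof (rule nn_integral_cong)
    fix x show "f x * indicator (frontier \<Omega>) x = f x * indicator {x. x \<bullet> n = g (x \<bullet> e)} x"
      using chart_frontier[OF ch, of x] z[of x] by (cases "x \<in> ball p r") (auto simp: indicator_def)
  qed
  also have "\<dots> = (\<integral>\<^sup>+s. f (graph_map e n g s) * ennreal (sqrt (1 + (deriv g s)\<^sup>2)) \<partial>lborel)"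
    by (rule nn_integral_graph[OF on sm(1) sm(4) f])
  finally show ?thesis .
qed

lemma borel_measurable_graph_map:
  "continuous_on UNIV g \<Longrightarrow> graph_map e n g \<in> borel_measurable borel"
  unfolding graph_map_def by (intro borel_measurable_continuous_onI continuous_intros) auto

lemma integral_boundary_chart:
  fixes f :: "real^2 \<Rightarrow> real"
  assumes ch: "chart \<Omega> p r e n g" and f [measurable]: "f \<in> borel_measurable borel"
    and z: "\<And>x. x \<notin> ball p r \<Longrightarrow> f x = 0"
  shows "(\<integral>x. f x \<partial>boundary_measure \<Omega>) =
    (\<integral>s. f (graph_map e n g s) * sqrt (1 + (deriv g s)\<^sup>2) \<partial>lborel)"
proof -
  note on = chartD(2)[OF ch] and sm = smooth_realD[OF chartD(3)[OF ch]]
  let ?\<gamma> = "graph_map e n g" and ?w = "\<lambda>s. sqrt (1 + (deriv g s)\<^sup>2)"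
  let ?i = "indicator (ball p r) :: real^2 \<Rightarrow> real"
  have [measurable]: "?i \<in> borel_measurable borel" by (rule borel_measurable_indicator) simp
  have [measurable]: "?\<gamma> \<in> borel_measurable borel" by (rule borel_measurable_graph_map[OF sm(3)])
  have [measurable]: "deriv g \<in> borel_measurable borel" by (rule borel_measurable_continuous_onI[OF sm(4)])
  \<comment> \<open>Cut off to the ball, the two sides are equal as measures. Integrals of signed
    functions then agree without any discussion of integrability.\<close>
  let ?M = "density (boundary_measure \<Omega>) (\<lambda>x. ennreal (?i x))"
  let ?N = "density (distr (density lborel (\<lambda>s. ennreal (?w s))) borel ?\<gamma>) (\<lambda>x. ennreal (?i x))"
  have "?M = ?N"
  proof (rule measure_eqI)
    fix A assume "A \<in> sets ?M"
    then have [measurable]: "A \<in> sets borel" by simp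
    have "emeasure ?M A = (\<integral>\<^sup>+x. ennreal (?i x) * indicator A x \<partial>boundary_measure \<Omega>)"
      by (rule emeasure_density) auto
    also have "\<dots> = (\<integral>\<^sup>+s. (ennreal (?i (?\<gamma> s)) * indicator A (?\<gamma> s)) * ennreal (?w s) \<partial>lborel)"
      by (rule nn_integral_boundary_chart[OF ch]) auto
    also have "\<dots> = (\<integral>\<^sup>+x. ennreal (?i x) * indicator A x \<partial>distr (density lborel (\<lambda>s. ennreal (?w s))) borel ?\<gamma>)"
      by (simp add: nn_integral_distr nn_integral_density mult.commute)
    also have "\<dots> = emeasure ?N A" by (rule emeasure_density[symmetric]) auto
    finally show "emeasure ?M A = emeasure ?N A" .
  qed simp
  have fi: "?i x * f x = f x" for x using z[of x] by (auto simp: indicator_def)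
  have "(\<integral>x. f x \<partial>boundary_measure \<Omega>) = integral\<^sup>L ?M f"
    by (subst integral_density) (simp_all add: fi)
  also have "\<dots> = integral\<^sup>L ?N f" using \<open>?M = ?N\<close> by simp
  also have "\<dots> = integral\<^sup>L (distr (density lborel (\<lambda>s. ennreal (?w s))) borel ?\<gamma>) f"
    by (subst integral_density) (auto simp: fi)
  also have "\<dots> = (\<integral>s. f (?\<gamma> s) \<partial>density lborel (\<lambda>s. ennreal (?w s)))"
    by (subst integral_distr) auto
  also have "\<dots> = (\<integral>s. ?w s * f (?\<gamma> s) \<partial>lborel)"
    by (subst integral_density) (auto)
  finally show ?thesis by (simp add: mult.commute)
qed

lemma continuous_on_UNIV_Icc_bound:
  fixes f :: "real \<Rightarrow> real"
  assumes "continuous_on UNIV f"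
  obtains B where "\<And>s. s \<in> {a..b} \<Longrightarrow> \<bar>f s\<bar> \<le> B"
proof -
  have "bounded (f ` {a..b})"
    using assms by (intro compact_imp_bounded compact_continuous_image) (auto intro: continuous_on_subset)
  then obtain B where "\<forall>x\<in>f ` {a..b}. norm x \<le> B" unfolding bounded_iff by blast
  then show ?thesis by (intro that[of B]) simp
qed

text \<open>Within one chart ball the arc length density is bounded over a bounded parameter
  interval; finitely many such balls cover the compact frontier.\<close>

lemma finite_boundary_measure:
  assumes reg: "regular_set \<Omega>"
  shows "finite_measure (boundary_measure \<Omega>)"
proof (rule finite_measureI)
  have local_fin: "\<exists>r>0. emeasure (boundary_measure \<Omega>) (ball p r) < \<infinity>" if p: "p \<in> frontier \<Omega>" for p
  proof -
    obtain r e n g where ch: "chart \<Omega> p r e n g" by (rule regular_set_chart[OF reg p])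
    note on = chartD(2)[OF ch] and sm = smooth_realD[OF chartD(3)[OF ch]]
    let ?w = "\<lambda>s. sqrt (1 + (deriv g s)\<^sup>2)"
    let ?J = "{p \<bullet> e - r .. p \<bullet> e + r}"
    have "continuous_on UNIV ?w" by (intro continuous_intros sm(4))
    then obtain B where B: "\<And>s. s \<in> ?J \<Longrightarrow> \<bar>?w s\<bar> \<le> B"
      by (rule continuous_on_UNIV_Icc_bound) blast
    have "emeasure (boundary_measure \<Omega>) (ball p r) = (\<integral>\<^sup>+x. indicator (ball p r) x \<partial>boundary_measure \<Omega>)"
      by simp
    also have "\<dots> = (\<integral>\<^sup>+s. indicator (ball p r) (graph_map e n g s) * ennreal (?w s) \<partial>lborel)"
      by (rule nn_integral_boundary_chart[OF ch]) (auto simp: indicator_def)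
    also have "\<dots> \<le> (\<integral>\<^sup>+s. ennreal B * indicator ?J s \<partial>lborel)"
    proof (rule nn_integral_mono)
      fix s
      show "indicator (ball p r) (graph_map e n g s) * ennreal (?w s) \<le> ennreal B * indicator ?J s"
      proof (cases "graph_map e n g s \<in> ball p r")
        case True
        then have "\<bar>(p - graph_map e n g s) \<bullet> e\<bar> < r"
          using orthonormal_pair_abs_inner_le(1)[OF on, of "p - graph_map e n g s"] by (simp add: dist_norm)
        then have s: "s \<in> ?J" using on by (simp add: inner_diff_left abs_less_iff)
        have "?w s \<le> B" using B[OF s] by simp
        then show ?thesis using s True by (simp add: ennreal_leI)
      qed simp
    qed
    also have "\<dots> = ennreal B * emeasure lborel ?J" by (subst nn_integral_cmult_indicator) auto
    also have "\<dots> < \<infinity>" using chartD(1)[OF ch] by (simp add: ennreal_mult_less_top)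
    finally show ?thesis using chartD(1)[OF ch] by blast
  qed
  then obtain r where r: "\<And>p. p \<in> frontier \<Omega> \<Longrightarrow> 0 < r p \<and> emeasure (boundary_measure \<Omega>) (ball p (r p)) < \<infinity>"
    by metis
  have "compact (frontier \<Omega>)" using reg by (simp add: regular_set_def compact_frontier_bounded)
  then obtain I where I: "I \<subseteq> frontier \<Omega>" "finite I" "frontier \<Omega> \<subseteq> (\<Union>p\<in>I. ball p (r p))"
    by (rule compactE_image[where C="frontier \<Omega>" and f="\<lambda>p. ball p (r p)"]) (use r in force)+
  have "emeasure (boundary_measure \<Omega>) (space (boundary_measure \<Omega>)) = emeasure (boundary_measure \<Omega>) (frontier \<Omega>)"
    by (intro emeasure_eq_AE) (use AE_boundary_measure[of \<Omega>] in auto)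
  also have "\<dots> \<le> emeasure (boundary_measure \<Omega>) (\<Union>p\<in>I. ball p (r p))"
    using I by (intro emeasure_mono) auto
  also have "\<dots> \<le> (\<Sum>p\<in>I. emeasure (boundary_measure \<Omega>) (ball p (r p)))"
    using I by (intro emeasure_subadditive_finite) auto
  also have "\<dots> < \<infinity>" using I r by (auto simp: less_top[symmetric])
  finally show "emeasure (boundary_measure \<Omega>) (space (boundary_measure \<Omega>)) \<noteq> \<infinity>" by simp
qed

section \<open>The divergence theorem and the perimeter\<close>

lemma C1_max0_sq: "C1 f \<Longrightarrow> C1 (\<lambda>x. (max 0 (f x))\<^sup>2 :: real)"
  by (rule C1_compose_real[where h="\<lambda>x. (max 0 x)\<^sup>2" and h'="\<lambda>x. 2 * max 0 x"])
    (auto intro!: continuous_intros DERIV_max0_sq)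

text \<open>The bumps are squared positive parts of \<open>r^2 - |x - p|^2\<close>; the squared
  distance keeps them differentiable at the centre, and they are positive exactly on their balls.
  The bound by 1 off \<open>K\<close> is what later keeps the test field for the perimeter of norm
  at most 1.\<close>

lemma C1_partition_of_unity:
  fixes K :: "'a::real_inner set" and r :: "'a \<Rightarrow> real"
  assumes I: "finite I" and K: "compact K" "K \<subseteq> (\<Union>p\<in>I. ball p (r p))"
  obtains \<eta> :: "'a \<Rightarrow> 'a \<Rightarrow> real" where
    "\<And>p. p \<in> I \<Longrightarrow> C1 (\<eta> p)" "\<And>p x. 0 \<le> \<eta> p x"
    "\<And>p x. p \<in> I \<Longrightarrow> x \<notin> ball p (r p) \<Longrightarrow> \<eta> p x = 0"
    "\<And>x. (\<Sum>p\<in>I. \<eta> p x) \<le> 1" "\<And>x. x \<in> K \<Longrightarrow> (\<Sum>p\<in>I. \<eta> p x) = 1"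
proof -
  define b where "b p x = (if 0 < r p then (max 0 ((r p)\<^sup>2 - (x - p) \<bullet> (x - p)))\<^sup>2 else 0)" for p x :: 'a
  have lin: "C1 (\<lambda>x::'a. x)" using C1_linear[OF bounded_linear_ident] .
  have bC: "C1 (b p)" for p
    unfolding b_def by (cases "0 < r p") (auto intro!: C1_max0_sq C1_diff C1_inner lin)
  have b0: "0 \<le> b p x" for p x by (simp add: b_def)
  have bpos: "0 < b p x \<longleftrightarrow> x \<in> ball p (r p)" for p x
  proof -
    have "(x - p) \<bullet> (x - p) < (r p)\<^sup>2 \<longleftrightarrow> dist p x < r p" if "0 < r p"
    proof -
      have "(norm (x - p))\<^sup>2 < (r p)\<^sup>2 \<longleftrightarrow> norm (x - p) < r p"
        using that by (meson less_imp_le norm_ge_zero not_less power_mono power_strict_mono zero_less_numeral)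
      then show ?thesis by (simp add: power2_norm_eq_inner dist_norm[of x p] dist_commute[of p x])
    qed
    moreover have "\<not> dist p x < r p" if "\<not> 0 < r p" using that by (smt (verit) zero_le_dist)
    ultimately show ?thesis by (auto simp: b_def max_def zero_less_power2)
  qed
  define S where "S x = (\<Sum>p\<in>I. b p x)" for x
  have SC: "C1 S" unfolding S_def by (intro C1_sum I bC)
  have S0: "0 \<le> S x" for x unfolding S_def by (intro sum_nonneg b0)
  have Spos: "0 < S x" if x: "x \<in> K" for x
  proof -
    obtain p where "p \<in> I" "x \<in> ball p (r p)" using x K(2) by blast
    then show ?thesis unfolding S_def using I b0 bpos by (intro sum_pos2) auto
  qed
  obtain m where m: "0 < m" "\<And>x. x \<in> K \<Longrightarrow> m \<le> S x"
  proof (cases "K = {}")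
    case True then show ?thesis using that[of 1] by auto
  next
    case False
    obtain x where "x \<in> K" "\<forall>y\<in>K. S x \<le> S y"
      using continuous_attains_inf[OF K(1) False continuous_on_subset[OF C1_continuous[OF SC]]] by blast
    then show ?thesis using that[of "S x"] Spos by auto
  qed
  (* T agrees with S on K, where S is at least m, and is positive everywhere. *)
  define T where "T x = S x + (max 0 (m - S x))\<^sup>2" for x
  have TC: "C1 T" unfolding T_def by (intro C1_add SC C1_max0_sq C1_diff C1_const)
  have Tpos: "0 < T x" for x
  proof (cases "0 < S x")
    case True then show ?thesis by (simp add: T_def add_pos_nonneg)
  next
    case False
    then have "S x = 0" using S0[of x] by simp
    then show ?thesis using m(1) by (simp add: T_def)
  qed
  have TiC: "C1 (\<lambda>x. inverse (T x))"
  proof (rule C1_compose_real[OF TC, where h'="\<lambda>t. - (inverse t)\<^sup>2"])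
    show "DERIV inverse (T x) :> - (inverse (T x))\<^sup>2" for x
      using DERIV_inverse[of "T x" UNIV] Tpos[of x] by (simp add: power2_eq_square)
    show "continuous_on (range T) (\<lambda>t. - (inverse t)\<^sup>2)"
      using Tpos by (intro continuous_intros) (auto simp: less_le)
  qed
  have sum: "(\<Sum>p\<in>I. b p x * inverse (T x)) = S x / T x" for x
    by (simp add: S_def sum_distrib_right[symmetric] divide_inverse)
  show ?thesis
  proof (rule that[of "\<lambda>p x. b p x * inverse (T x)"])
    show "C1 (\<lambda>x. b p x * inverse (T x))" for p by (intro C1_mult bC TiC)
    show "0 \<le> b p x * inverse (T x)" for p x using b0 less_imp_le[OF Tpos[of x]] by (intro mult_nonneg_nonneg) auto
    show "b p x * inverse (T x) = 0" if "x \<notin> ball p (r p)" for p x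
    proof -
      have "b p x = 0" using that bpos[of p x] b0[of p x] by linarith
      then show ?thesis by simp
    qed
    show "(\<Sum>p\<in>I. b p x * inverse (T x)) \<le> 1" for x
      unfolding sum using Tpos[of x] by (simp add: T_def)
    show "(\<Sum>p\<in>I. b p x * inverse (T x)) = 1" if "x \<in> K" for x
      unfolding sum using Tpos[of x] m(2)[OF that] by (simp add: T_def)
  qed
qed

section \<open>A finite atlas of the closure\<close>

lemma orthonormal_pair_axis: "orthonormal_pair (axis 1 1) (axis 2 1)"
  by (simp add: orthonormal_pair_def inner_axis) (simp add: axis_def)

lemma smooth_real_const: "smooth_real (\<lambda>_. c)"
proof -
  have "\<exists>c'. (deriv ^^ k) (\<lambda>_::real. c) = (\<lambda>_. c')" for k
    by (induction k) auto
  then show ?thesis unfolding smooth_real_def by (metis differentiable_const)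
qed

text \<open>The horizontal line at height \<open>p \<bullet> axis 2 1 - r\<close> runs below the
  open ball, so the condition of lying above the graph holds throughout the ball.\<close>

lemma chart_ball:
  assumes "0 < r" "ball p r \<subseteq> \<Omega>"
  shows "chart \<Omega> p r (axis 1 1) (axis 2 1) (\<lambda>_. p \<bullet> axis 2 1 - r)"
proof -
  have "p \<bullet> axis 2 1 - r < x \<bullet> axis 2 1" if "x \<in> ball p r" for x
    using orthonormal_pair_abs_inner_le(2)[OF orthonormal_pair_axis, of "p - x"] that
    by (simp add: dist_norm inner_diff_left)
  then show ?thesis
    using assms by (auto simp: chart_def orthonormal_pair_axis smooth_real_const)
qed

lemma regular_set_atlas:
  assumes reg: "regular_set \<Omega>"
  obtains I r e n g where "finite I" "closure \<Omega> \<subseteq> (\<Union>p\<in>I. ball p (r p))"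
    "\<And>p. p \<in> I \<Longrightarrow> chart \<Omega> p (r p) (e p) (n p) (g p)"
proof -
  have "\<exists>r e n g. chart \<Omega> p r e n g" if p: "p \<in> closure \<Omega>" for p
  proof (cases "p \<in> frontier \<Omega>")
    case False
    then have "p \<in> \<Omega>" using p reg by (auto simp: frontier_def regular_set_def interior_open)
    then obtain r where "0 < r" "ball p r \<subseteq> \<Omega>"
      using reg unfolding regular_set_def open_contains_ball by blast
    then show ?thesis using chart_ball by blast
  qed (use regular_set_chart[OF reg] in blast)
  then obtain r e n g where c: "\<And>p. p \<in> closure \<Omega> \<Longrightarrow> chart \<Omega> p (r p) (e p) (n p) (g p)"
    by metis
  have "compact (closure \<Omega>)" using reg by (simp add: regular_set_def compact_closure)
  then obtain I where "I \<subseteq> closure \<Omega>" "finite I" "closure \<Omega> \<subseteq> (\<Union>p\<in>I. ball p (r p))"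
    by (rule compactE_image[where C="closure \<Omega>" and f="\<lambda>p. ball p (r p)"]) (use chartD(1)[OF c] in force)+
  then show ?thesis using c by (intro that[of I r e n g]) blast+
qed

lemma C1_divergence_continuous: "C1 \<phi> \<Longrightarrow> continuous_on UNIV (divergence \<phi>)"
  unfolding divergence_def by (intro continuous_intros) (auto simp: C1_def)

lemma C1_derivative_zero:
  assumes "C1 f" "\<And>y. y \<notin> K \<Longrightarrow> f y = 0" "closed K" "x \<notin> K"
  shows "frechet_derivative f (at x) = (\<lambda>_. 0)"
proof -
  have "((\<lambda>_. 0) has_derivative frechet_derivative f (at x)) (at x)"
    by (rule has_derivative_transform_within_open[OF C1_has_derivative[OF assms(1)], of "- K"])
      (use assms in auto)
  then show ?thesis using has_derivative_const has_derivative_unique by blast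
qed

text \<open>Outside the closed ball the field vanishes locally. Points of the sphere are limits of
  such points, and the divergence is continuous.\<close>

lemma divergence_support:
  assumes C: "C1 \<phi>" and z: "\<And>y. y \<notin> ball p r \<Longrightarrow> \<phi> y = 0" and x: "x \<notin> ball p r" and r: "0 < r"
  shows "divergence \<phi> x = 0"
proof -
  have 0: "divergence \<phi> y = 0" if "y \<notin> cball p r" for y
    using C1_derivative_zero[OF C, of "cball p r" y] z that by (simp add: divergence_def)
  have cl: "closed {y. divergence \<phi> y = 0}"
    using C1_divergence_continuous[OF C] by (intro closed_Collect_eq) auto
  have "x \<in> closure (- cball p r)"
    using x r by (simp add: closure_complement interior_cball)
  moreover have "- cball p r \<subseteq> {y. divergence \<phi> y = 0}" using 0 by auto
  ultimately have "x \<in> {y. divergence \<phi> y = 0}" using closure_minimal[OF _ cl] by blast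
  then show ?thesis by simp
qed

text \<open>The vector \<open>n - deriv g s *\<^sub>R e\<close> is the unit inner normal times
  \<open>sqrt (1 + (deriv g s)\<^sup>2)\<close>, and this factor is the arc length density. That
  converts the graph formula into an integral against the boundary measure.\<close>

lemma divergence_chart:
  assumes reg: "regular_set \<Omega>" and ch: "chart \<Omega> p r e n g"
    and C: "C1 \<phi>" and z: "\<And>y. y \<notin> ball p r \<Longrightarrow> \<phi> y = 0"
  shows "(\<integral>x. indicator \<Omega> x * divergence \<phi> x \<partial>lborel) = - (\<integral>x. \<phi> x \<bullet> inner_normal \<Omega> x \<partial>boundary_measure \<Omega>)"
proof -
  note r = chartD(1)[OF ch] and on = chartD(2)[OF ch] and sm = smooth_realD[OF chartD(3)[OF ch]]
  define R where "R = norm p + r"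
  have supp: "\<phi> x = 0" if "R \<le> norm x" for x
  proof (rule z)
    show "x \<notin> ball p r" using that norm_triangle_ineq2[of x p] by (auto simp: R_def dist_norm norm_minus_commute)
  qed
  have dz: "divergence \<phi> x = 0" if "x \<notin> ball p r" for x by (rule divergence_support[OF C z that r])
  have "(\<integral>x. indicator \<Omega> x * divergence \<phi> x \<partial>lborel) =
      (\<integral>x. indicator {x. x \<bullet> n > g (x \<bullet> e)} x * divergence \<phi> x \<partial>lborel)"
  proof (rule Bochner_Integration.integral_cong[OF refl])
    fix x show "indicator \<Omega> x * divergence \<phi> x = indicator {x. x \<bullet> n > g (x \<bullet> e)} x * divergence \<phi> x"
      using chart_mem[OF ch, of x] dz[of x] by (cases "x \<in> ball p r") (auto simp: indicator_def)
  qed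
  also have "\<dots> = - (\<integral>s. \<phi> (frame_map e n (s, g s)) \<bullet> (n - deriv g s *\<^sub>R e) \<partial>lborel)"
    by (rule divergence_graph[OF on sm(1) sm(4) C supp])
  also have "(\<integral>s. \<phi> (frame_map e n (s, g s)) \<bullet> (n - deriv g s *\<^sub>R e) \<partial>lborel) =
      (\<integral>s. (\<phi> (graph_map e n g s) \<bullet> inner_normal \<Omega> (graph_map e n g s)) * sqrt (1 + (deriv g s)\<^sup>2) \<partial>lborel)"
  proof (rule Bochner_Integration.integral_cong[OF refl])
    fix s
    let ?x = "graph_map e n g s"
    show "\<phi> (frame_map e n (s, g s)) \<bullet> (n - deriv g s *\<^sub>R e) = \<phi> ?x \<bullet> inner_normal \<Omega> ?x * sqrt (1 + (deriv g s)\<^sup>2)"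
    proof (cases "?x \<in> ball p r")
      case True
      have "?x \<in> frontier \<Omega>" using chart_frontier[OF ch True] on by simp
      from inner_normal_chart[OF ch True this]
      have "inner_normal \<Omega> ?x = (1 / sqrt (1 + (deriv g s)\<^sup>2)) *\<^sub>R (n - deriv g s *\<^sub>R e)"
        using on by (simp add: chart_normal_def)
      then show ?thesis using sqrt_1_plus_sq_pos[of "deriv g s"]
        by (simp add: graph_map_def)
    next
      case False
      then show ?thesis using z[OF False] by (simp add: graph_map_def)
    qed
  qed
  also have "\<dots> = (\<integral>x. \<phi> x \<bullet> inner_normal \<Omega> x \<partial>boundary_measure \<Omega>)"
  proof (rule integral_boundary_chart[OF ch, symmetric])
    have [measurable]: "\<phi> \<in> borel_measurable borel" "inner_normal \<Omega> \<in> borel_measurable borel"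
      using C1_continuous[OF C] reg by (auto intro: borel_measurable_continuous_onI borel_measurable_inner_normal)
    show "(\<lambda>x. \<phi> x \<bullet> inner_normal \<Omega> x) \<in> borel_measurable borel" by measurable
  qed (simp add: z)
  finally show ?thesis .
qed

text \<open>A partition of unity reduces the claim to single charts. The pieces add up to
  \<open>\<phi>\<close> on \<open>closure \<Omega>\<close>, the only set that the two integrals see.
  The minus sign comes from the inner normal.\<close>

theorem divergence_theorem:
  assumes reg: "regular_set \<Omega>" and C: "C1 \<phi>"
  shows "(\<integral>x. indicator \<Omega> x * divergence \<phi> x \<partial>lborel) = - (\<integral>x. \<phi> x \<bullet> inner_normal \<Omega> x \<partial>boundary_measure \<Omega>)"
proof -
  interpret finite_measure "boundary_measure \<Omega>" by (rule finite_boundary_measure[OF reg])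
  obtain I r e n g where I: "finite I" "closure \<Omega> \<subseteq> (\<Union>p\<in>I. ball p (r p))"
    and ch: "\<And>p. p \<in> I \<Longrightarrow> chart \<Omega> p (r p) (e p) (n p) (g p)"
    by (rule regular_set_atlas[OF reg]) blast
  have cpt: "compact (closure \<Omega>)" using reg by (simp add: regular_set_def compact_closure)
  obtain \<eta> :: "real^2 \<Rightarrow> real^2 \<Rightarrow> real" where \<eta>: "\<And>p. p \<in> I \<Longrightarrow> C1 (\<eta> p)"
    "\<And>p x. p \<in> I \<Longrightarrow> x \<notin> ball p (r p) \<Longrightarrow> \<eta> p x = 0" "\<And>x. x \<in> closure \<Omega> \<Longrightarrow> (\<Sum>p\<in>I. \<eta> p x) = 1"
    by (rule C1_partition_of_unity[OF I(1) cpt I(2)]) blast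
  define \<psi> where "\<psi> p x = \<eta> p x *\<^sub>R \<phi> x" for p x
  have \<psi>C: "C1 (\<psi> p)" if "p \<in> I" for p unfolding \<psi>_def by (intro C1_scaleR \<eta> that C)
  have \<psi>0: "\<psi> p x = 0" if "p \<in> I" "x \<notin> ball p (r p)" for p x using \<eta>(2)[OF that] by (simp add: \<psi>_def)
  have sum\<psi>: "(\<Sum>p\<in>I. \<psi> p x) = \<phi> x" if "x \<in> closure \<Omega>" for x
    using \<eta>(3)[OF that] by (simp add: \<psi>_def scaleR_sum_left[symmetric])
  have \<Omega>m [measurable]: "\<Omega> \<in> sets borel" using reg by (simp add: regular_set_def)
  \<comment> \<open>Derivatives are compared at points of the open set \<Omega>, around which the
    sum of the pieces equals \<open>\<phi>\<close>.\<close>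
  have div: "divergence \<phi> x = (\<Sum>p\<in>I. divergence (\<psi> p) x)" if "x \<in> \<Omega>" for x
  proof -
    have "((\<lambda>x. \<Sum>p\<in>I. \<psi> p x) has_derivative (\<lambda>v. \<Sum>p\<in>I. frechet_derivative (\<psi> p) (at x) v)) (at x)"
      by (intro has_derivative_sum C1_has_derivative \<psi>C)
    then have "(\<phi> has_derivative (\<lambda>v. \<Sum>p\<in>I. frechet_derivative (\<psi> p) (at x) v)) (at x)"
      by (rule has_derivative_transform_within_open[of _ _ _ _ \<Omega>])
        (use reg that sum\<psi> closure_subset in \<open>auto simp: regular_set_def\<close>)
    then have eq: "frechet_derivative \<phi> (at x) = (\<lambda>v. \<Sum>p\<in>I. frechet_derivative (\<psi> p) (at x) v)"
      by (rule frechet_derivative_at[symmetric])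
    show ?thesis unfolding divergence_def eq by (simp add: sum.swap[of _ I])
  qed
  have int1: "integrable lborel (\<lambda>x. indicator \<Omega> x * divergence (\<psi> p) x)" if "p \<in> I" for p
  proof (rule integrable_continuous_bounded_support[OF C1_divergence_continuous[OF \<psi>C[OF that]], of "cball p (r p)"])
    fix x assume "x \<notin> cball p (r p)"
    then show "divergence (\<psi> p) x = 0"
      using C1_derivative_zero[OF \<psi>C[OF that], of "cball p (r p)" x] \<psi>0[OF that] by (simp add: divergence_def)
  qed auto
  have int2: "integrable (boundary_measure \<Omega>) (\<lambda>x. \<psi> p x \<bullet> inner_normal \<Omega> x)" if "p \<in> I" for p
  proof -
    have [measurable]: "\<psi> p \<in> borel_measurable borel" "inner_normal \<Omega> \<in> borel_measurable borel"
      using C1_continuous[OF \<psi>C[OF that]] reg by (auto intro: borel_measurable_continuous_onI borel_measurable_inner_normal)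
    have "compact (frontier \<Omega>)" using reg by (simp add: regular_set_def compact_frontier_bounded)
    then have "bounded (\<psi> p ` frontier \<Omega>)"
      by (intro compact_imp_bounded compact_continuous_image continuous_on_subset[OF C1_continuous[OF \<psi>C[OF that]]]) auto
    then obtain B where B: "\<forall>x\<in>frontier \<Omega>. norm (\<psi> p x) \<le> B" unfolding bounded_iff by auto
    show ?thesis
    proof (rule integrable_const_bound[where B=B])
      show "AE x in boundary_measure \<Omega>. norm (\<psi> p x \<bullet> inner_normal \<Omega> x) \<le> B"
        using AE_boundary_measure
      proof eventually_elim
        case (elim x)
        have "norm (\<psi> p x \<bullet> inner_normal \<Omega> x) \<le> norm (\<psi> p x) * norm (inner_normal \<Omega> x)"
          using Cauchy_Schwarz_ineq2 by simp
        also have "\<dots> = norm (\<psi> p x)" using regular_set_inner_normal(2)[OF reg elim] by simp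
        also have "\<dots> \<le> B" using B elim by simp
        finally show ?case .
      qed
    qed simp
  qed
  have "(\<integral>x. indicator \<Omega> x * divergence \<phi> x \<partial>lborel) = (\<integral>x. (\<Sum>p\<in>I. indicator \<Omega> x * divergence (\<psi> p) x) \<partial>lborel)"
    by (intro Bochner_Integration.integral_cong) (auto simp: div indicator_def)
  also have "\<dots> = (\<Sum>p\<in>I. \<integral>x. indicator \<Omega> x * divergence (\<psi> p) x \<partial>lborel)"
    by (rule Bochner_Integration.integral_sum) (rule int1)
  also have "\<dots> = (\<Sum>p\<in>I. - (\<integral>x. \<psi> p x \<bullet> inner_normal \<Omega> x \<partial>boundary_measure \<Omega>))"
    by (intro sum.cong refl divergence_chart[OF reg ch \<psi>C \<psi>0]) auto
  also have "\<dots> = - (\<integral>x. (\<Sum>p\<in>I. \<psi> p x \<bullet> inner_normal \<Omega> x) \<partial>boundary_measure \<Omega>)"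
    by (subst Bochner_Integration.integral_sum) (auto simp: int2 sum_negf)
  also have "(\<integral>x. (\<Sum>p\<in>I. \<psi> p x \<bullet> inner_normal \<Omega> x) \<partial>boundary_measure \<Omega>) =
      (\<integral>x. \<phi> x \<bullet> inner_normal \<Omega> x \<partial>boundary_measure \<Omega>)"
  proof (rule Bochner_Integration.integral_cong[OF refl])
    fix x
    show "(\<Sum>p\<in>I. \<psi> p x \<bullet> inner_normal \<Omega> x) = \<phi> x \<bullet> inner_normal \<Omega> x"
      using sum\<psi>[of x] by (cases "x \<in> frontier \<Omega>") (auto simp: inner_sum_left[symmetric] frontier_def inner_normal_def)
  qed
  finally show ?thesis .
qed

section \<open>The perimeter as the total boundary measure\<close>

lemma abs_integral_inner_normal_le:
  assumes reg: "regular_set \<Omega>" and m: "\<phi> \<in> borel_measurable borel" and b: "\<And>x. norm (\<phi> x) \<le> 1"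
  shows "\<bar>\<integral>x. \<phi> x \<bullet> inner_normal \<Omega> x \<partial>boundary_measure \<Omega>\<bar> \<le> measure (boundary_measure \<Omega>) UNIV"
proof -
  interpret finite_measure "boundary_measure \<Omega>" by (rule finite_boundary_measure[OF reg])
  have le: "\<bar>\<phi> x \<bullet> inner_normal \<Omega> x\<bar> \<le> 1" for x
    using Cauchy_Schwarz_ineq2[of "\<phi> x" "inner_normal \<Omega> x"] b[of x] norm_inner_normal_le[OF reg, of x]
      mult_mono[of "norm (\<phi> x)" 1 "norm (inner_normal \<Omega> x)" 1] by simp
  have [measurable]: "inner_normal \<Omega> \<in> borel_measurable borel" by (rule borel_measurable_inner_normal[OF reg])
  note m [measurable]
  have int: "integrable (boundary_measure \<Omega>) (\<lambda>x. \<phi> x \<bullet> inner_normal \<Omega> x)"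
    by (rule integrable_const_bound[where B=1]) (auto simp: le)
  have "\<bar>\<integral>x. \<phi> x \<bullet> inner_normal \<Omega> x \<partial>boundary_measure \<Omega>\<bar> \<le> (\<integral>x. \<bar>\<phi> x \<bullet> inner_normal \<Omega> x\<bar> \<partial>boundary_measure \<Omega>)"
    by (rule integral_abs_bound)
  also have "\<dots> \<le> (\<integral>x. 1 \<partial>boundary_measure \<Omega>)"
    by (intro integral_mono integrable_abs int) (auto simp: le)
  finally show ?thesis by simp
qed

text \<open>The divergence theorem turns each competitor into a flux through the boundary, bounded
  by the total measure. The supremum is attained by a field that equals the outer unit normal on the
  frontier.\<close>

theorem perimeter_eq_boundary_measure:
  assumes reg: "regular_set \<Omega>"
  shows "perimeter \<Omega> = ennreal (measure (boundary_measure \<Omega>) UNIV)"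
proof -
  interpret finite_measure "boundary_measure \<Omega>" by (rule finite_boundary_measure[OF reg])
  let ?P = "measure (boundary_measure \<Omega>) UNIV"
  have [measurable]: "\<Omega> \<in> sets borel" using reg by (simp add: regular_set_def)
  have eq: "(LINT x:\<Omega>|lebesgue. divergence \<phi> x) = - (\<integral>x. \<phi> x \<bullet> inner_normal \<Omega> x \<partial>boundary_measure \<Omega>)"
    if "C1 \<phi>" for \<phi>
  proof -
    have [measurable]: "divergence \<phi> \<in> borel_measurable borel"
      using C1_divergence_continuous[OF that] by (rule borel_measurable_continuous_onI)
    have "(LINT x:\<Omega>|lebesgue. divergence \<phi> x) = (\<integral>x. indicator \<Omega> x * divergence \<phi> x \<partial>lborel)"
      unfolding set_lebesgue_integral_def by (subst integral_completion) auto
    then show ?thesis using divergence_theorem[OF reg that] by simp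
  qed
  show ?thesis
  proof (rule antisym)
    show "perimeter \<Omega> \<le> ennreal ?P"
      unfolding perimeter_def
    proof (safe intro!: SUP_least ennreal_leI)
      fix \<phi> assume "C1_compact_support \<phi>" and b: "\<forall>x. norm (\<phi> x) \<le> 1"
      then have C: "C1 \<phi>" by (simp add: C1_compact_support_iff)
      have "\<phi> \<in> borel_measurable borel" using C1_continuous[OF C] by (rule borel_measurable_continuous_onI)
      then show "(LINT x:\<Omega>|lebesgue. divergence \<phi> x) \<le> ?P"
        unfolding eq[OF C] using abs_integral_inner_normal_le[OF reg, of \<phi>] b by simp
    qed
    obtain I r e n g where I: "finite I" "closure \<Omega> \<subseteq> (\<Union>p\<in>I. ball p (r p))"
      and ch: "\<And>p. p \<in> I \<Longrightarrow> chart \<Omega> p (r p) (e p) (n p) (g p)"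
      by (rule regular_set_atlas[OF reg]) blast
    have cpt: "compact (closure \<Omega>)" using reg by (simp add: regular_set_def compact_closure)
    obtain \<eta> :: "real^2 \<Rightarrow> real^2 \<Rightarrow> real" where \<eta>: "\<And>p. p \<in> I \<Longrightarrow> C1 (\<eta> p)" "\<And>p x. 0 \<le> \<eta> p x"
      "\<And>p x. p \<in> I \<Longrightarrow> x \<notin> ball p (r p) \<Longrightarrow> \<eta> p x = 0" "\<And>x. (\<Sum>p\<in>I. \<eta> p x) \<le> 1"
      "\<And>x. x \<in> closure \<Omega> \<Longrightarrow> (\<Sum>p\<in>I. \<eta> p x) = 1"
      by (rule C1_partition_of_unity[OF I(1) cpt I(2)]) blast
    define \<nu> where "\<nu> p = chart_normal (e p) (n p) (g p)" for p
    have \<nu>C: "C1 (\<nu> p)" if "p \<in> I" for p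
      unfolding \<nu>_def by (rule C1_chart_normal[OF chartD(3)[OF ch[OF that]]])
    have \<nu>1: "norm (\<nu> p x) \<le> 1" if "p \<in> I" for p x
      unfolding \<nu>_def by (simp add: norm_chart_normal[OF chartD(2)[OF ch[OF that]]])
    have \<nu>n: "\<eta> p x *\<^sub>R \<nu> p x = \<eta> p x *\<^sub>R inner_normal \<Omega> x" if "p \<in> I" "x \<in> frontier \<Omega>" for p x
      using inner_normal_chart[OF ch[OF that(1)] _ that(2)] \<eta>(3)[OF that(1), of x]
      by (cases "x \<in> ball p (r p)") (auto simp: \<nu>_def)
    \<comment> \<open>On the frontier the chart normals agree with the inner normal, so the sum is
      its negative there. Elsewhere it is a combination of unit vectors with nonnegative weights of
      sum at most 1, hence of norm at most 1.\<close>
    define \<phi> where "\<phi> x = (\<Sum>p\<in>I. \<eta> p x *\<^sub>R - \<nu> p x)" for x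
    have C: "C1 \<phi>"
      unfolding \<phi>_def using C1_scaleR[OF C1_const[of "-1"] \<nu>C] by (intro C1_sum I C1_scaleR \<eta>) auto
    have n1: "norm (\<phi> x) \<le> 1" for x
    proof -
      have "norm (\<phi> x) \<le> (\<Sum>p\<in>I. \<eta> p x * norm (\<nu> p x))"
        unfolding \<phi>_def by (rule order_trans[OF norm_sum]) (simp add: \<eta>(2))
      also have "\<dots> \<le> (\<Sum>p\<in>I. \<eta> p x * 1)" by (intro sum_mono mult_left_mono \<nu>1 \<eta>(2))
      also have "\<dots> \<le> 1" using \<eta>(4) by simp
      finally show ?thesis .
    qed
    have "{x. \<phi> x \<noteq> 0} \<subseteq> (\<Union>p\<in>I. ball p (r p))"
    proof
      fix x assume "x \<in> {x. \<phi> x \<noteq> 0}"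
      then have "(\<Sum>p\<in>I. \<eta> p x *\<^sub>R - \<nu> p x) \<noteq> 0" by (simp add: \<phi>_def)
      then obtain p where "p \<in> I" "\<eta> p x *\<^sub>R - \<nu> p x \<noteq> 0"
        by (rule sum.not_neutral_contains_not_neutral)
      then show "x \<in> (\<Union>p\<in>I. ball p (r p))" using \<eta>(3)[of p x] by auto
    qed
    then have "bounded {x. \<phi> x \<noteq> 0}" using I(1) by (meson bounded_UN bounded_ball bounded_subset)
    then have adm: "C1_compact_support \<phi>" using C by (simp add: C1_compact_support_iff compact_closure)
    have "(\<integral>x. \<phi> x \<bullet> inner_normal \<Omega> x \<partial>boundary_measure \<Omega>) = (\<integral>x. -1 \<partial>boundary_measure \<Omega>)"
    proof (rule integral_cong_AE)
      have [measurable]: "\<phi> \<in> borel_measurable borel" "inner_normal \<Omega> \<in> borel_measurable borel"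
        using C1_continuous[OF C] reg by (auto intro: borel_measurable_continuous_onI borel_measurable_inner_normal)
      show "(\<lambda>x. \<phi> x \<bullet> inner_normal \<Omega> x) \<in> borel_measurable (boundary_measure \<Omega>)" by simp
      show "AE x in boundary_measure \<Omega>. \<phi> x \<bullet> inner_normal \<Omega> x = -1"
        using AE_boundary_measure
      proof eventually_elim
        case (elim x)
        have "\<phi> x = - (\<Sum>p\<in>I. \<eta> p x *\<^sub>R inner_normal \<Omega> x)"
          unfolding \<phi>_def scaleR_minus_right sum_negf using \<nu>n[OF _ elim] by (metis (no_types, lifting) sum.cong)
        also have "\<dots> = - inner_normal \<Omega> x"
          using \<eta>(5)[of x] elim by (simp add: scaleR_sum_left[symmetric] frontier_def)
        finally show ?case using regular_set_inner_normal(2)[OF reg elim] by (simp add: norm_eq_1)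
      qed
    qed simp
    also have "\<dots> = - ?P" by simp
    finally have "ennreal ?P = ennreal (LINT x:\<Omega>|lebesgue. divergence \<phi> x)" using eq[OF C] by simp
    also have "\<dots> \<le> perimeter \<Omega>" unfolding perimeter_def using adm n1 by (intro SUP_upper) auto
    finally show "ennreal ?P \<le> perimeter \<Omega>" .
  qed
qed

section \<open>The kernel as a divergence\<close>

text \<open>Product rule: the term with the identity contributes its trace 2 times
  \<open>h x\<close>, and the rank-one term contributes \<open>h'\<close> in the radial
  direction.\<close>

lemma divergence_scaleR_diff:
  fixes h :: "real^2 \<Rightarrow> real"
  assumes "(h has_derivative h') (at x)"
  shows "divergence (\<lambda>x. h x *\<^sub>R (x - y)) x = h' (x - y) + 2 * h x"
proof -
  have "((\<lambda>x. h x *\<^sub>R (x - y)) has_derivative (\<lambda>v. h x *\<^sub>R v + h' v *\<^sub>R (x - y))) (at x)"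
    by (rule derivative_eq_intros assms refl | simp)+
  then have fd: "frechet_derivative (\<lambda>x. h x *\<^sub>R (x - y)) (at x) = (\<lambda>v. h x *\<^sub>R v + h' v *\<^sub>R (x - y))"
    by (rule frechet_derivative_at[symmetric])
  have lin: "linear h'" using assms by (rule has_derivative_linear)
  have "h' (x - y) = h' (\<Sum>i\<in>UNIV. ((x - y) $ i) *\<^sub>R axis i 1)"
    using basis_expansion[of "x - y"] by (simp add: scalar_mult_eq_scaleR)
  also have "\<dots> = (\<Sum>i\<in>UNIV. h' (axis i 1) * ((x - y) $ i))"
    by (simp add: linear_sum[OF lin] linear_scale[OF lin] mult.commute)
  finally show ?thesis unfolding divergence_def fd by (simp add: sum.distrib axis_def sum_2)
qed

text \<open>The field is \<open>radial_coeff \<mu> (|z|^2)\<close> times \<open>z\<close>. A radial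
  field f(r) z / r in the plane has divergence (r f)' / r, so divergence exp (- mu r) / r requires
  (r f)' = exp (- mu r); the antiderivative that decays at infinity gives this coefficient. The
  variable \<open>t\<close> is the squared distance, which is differentiable everywhere.\<close>

definition radial_coeff :: "real \<Rightarrow> real \<Rightarrow> real" where
  "radial_coeff \<mu> t = - exp (- (\<mu> * sqrt t)) / (\<mu> * t)"

lemma DERIV_radial_coeff:
  assumes "0 < \<mu>" "0 < t"
  shows "DERIV (radial_coeff \<mu>) t :> exp (- (\<mu> * sqrt t)) * (1 / (2 * t * sqrt t) + 1 / (\<mu> * t\<^sup>2))"
proof -
  define r where "r = sqrt t"
  have r: "0 < r" "t = r\<^sup>2" using assms by (auto simp: r_def)
  have "DERIV (\<lambda>t. - exp (- (\<mu> * sqrt t)) / (\<mu> * t)) t :>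
     (exp (- (\<mu> * sqrt t)) * (\<mu> * (inverse (sqrt t) / 2)) * (\<mu> * t) + exp (- (\<mu> * sqrt t)) * \<mu>) / ((\<mu> * t) * (\<mu> * t))"
    using assms by (auto intro!: derivative_eq_intros simp: field_simps)
  also have "(exp (- (\<mu> * sqrt t)) * (\<mu> * (inverse (sqrt t) / 2)) * (\<mu> * t) + exp (- (\<mu> * sqrt t)) * \<mu>) / ((\<mu> * t) * (\<mu> * t)) =
     exp (- (\<mu> * sqrt t)) * (1 / (2 * t * sqrt t) + 1 / (\<mu> * t\<^sup>2))"
    unfolding r_def[symmetric] using r assms by (simp add: field_simps power2_eq_square)
  finally show ?thesis unfolding radial_coeff_def[abs_def] .
qed

text \<open>The divergence theorem for the field of \<open>radial_coeff\<close> centred at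
  \<open>y\<close>. The condition on \<open>y\<close> puts the singularity at a positive distance
  \<open>\<delta>\<close> from \<Omega>; the sign of the coefficient cancels the sign due to the
  inner normal.\<close>

lemma integral_kernel_eq_boundary_integral:
  assumes reg: "regular_set \<Omega>" and \<mu>: "0 < \<mu>" and y: "y \<notin> closure \<Omega>"
  shows "(\<integral>x. indicator \<Omega> x * (exp (- (\<mu> * norm (x - y))) / norm (x - y)) \<partial>lborel) =
    (\<integral>q. exp (- (\<mu> * norm (q - y))) / (\<mu> * (norm (q - y))\<^sup>2) * ((q - y) \<bullet> inner_normal \<Omega> q) \<partial>boundary_measure \<Omega>)"
proof -
  obtain \<delta> where \<delta>: "0 < \<delta>" "\<And>x. x \<in> closure \<Omega> \<Longrightarrow> \<delta> \<le> norm (x - y)"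
    using separate_point_closed[OF closed_closure y] by (metis dist_commute dist_norm)
  (* Replaces |x - y|^2 near its zero y, where the field is singular, and does not change it on \<Omega>. *)
  define \<theta> where "\<theta> s = s + (max 0 (\<delta>\<^sup>2 - s))\<^sup>2 / (2 * \<delta>\<^sup>2)" for s
  have \<theta>pos: "0 < \<theta> s" for s
  proof (cases "s < \<delta>\<^sup>2")
    case True
    have "\<theta> s * (2 * \<delta>\<^sup>2) = s * (2 * \<delta>\<^sup>2) + (\<delta>\<^sup>2 - s)\<^sup>2" using True \<delta> by (simp add: \<theta>_def distrib_right)
    also have "\<dots> = s\<^sup>2 + (\<delta>\<^sup>2)\<^sup>2" by (simp add: power2_eq_square algebra_simps)
    also have "\<dots> > 0" using \<delta> by (simp add: add_nonneg_pos)
    finally show ?thesis using \<delta> by (simp add: zero_less_mult_iff)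
  next
    case False
    have "0 < \<delta>\<^sup>2" using \<delta> by simp
    then have "0 < s" using False by linarith
    then show ?thesis by (simp add: \<theta>_def add_pos_nonneg)
  qed
  have \<theta>id: "\<theta> s = s" if "\<delta>\<^sup>2 \<le> s" for s using that by (simp add: \<theta>_def)
  let ?h' = "\<lambda>t. exp (- (\<mu> * sqrt t)) * (1 / (2 * t * sqrt t) + 1 / (\<mu> * t\<^sup>2))"
  define H where "H x = radial_coeff \<mu> (\<theta> ((x - y) \<bullet> (x - y)))" for x :: "real^2"
  define \<phi> where "\<phi> x = H x *\<^sub>R (x - y)" for x :: "real^2"
  have lin: "C1 (\<lambda>x::real^2. x - y)" by (intro C1_diff C1_const C1_linear bounded_linear_ident)
  have "C1 (\<lambda>x::real^2. \<theta> ((x - y) \<bullet> (x - y)))"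
  proof -
    have "C1 (\<lambda>x::real^2. (max 0 (\<delta>\<^sup>2 - (x - y) \<bullet> (x - y)))\<^sup>2)"
      by (intro C1_max0_sq C1_diff C1_inner C1_const lin)
    then have "C1 (\<lambda>x::real^2. (x - y) \<bullet> (x - y) + (max 0 (\<delta>\<^sup>2 - (x - y) \<bullet> (x - y)))\<^sup>2 * (1 / (2 * \<delta>\<^sup>2)))"
      by (intro C1_add C1_mult C1_inner lin C1_const)
    then show ?thesis by (simp add: \<theta>_def)
  qed
  then have HC: "C1 H"
    unfolding H_def
  proof (rule C1_compose_real[where h'="?h'"])
    show "DERIV (radial_coeff \<mu>) (\<theta> ((x - y) \<bullet> (x - y))) :> ?h' (\<theta> ((x - y) \<bullet> (x - y)))" for x :: "real^2"
      by (rule DERIV_radial_coeff[OF \<mu> \<theta>pos])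
    show "continuous_on (range (\<lambda>x::real^2. \<theta> ((x - y) \<bullet> (x - y)))) ?h'"
      using \<theta>pos \<mu> by (intro continuous_intros) (auto simp: less_le)
  qed
  have C: "C1 \<phi>" unfolding \<phi>_def by (intro C1_scaleR HC lin)
  have Hcl: "H x = - exp (- (\<mu> * norm (x - y))) / (\<mu> * (norm (x - y))\<^sup>2)" if "x \<in> closure \<Omega>" for x
  proof -
    have "\<delta>\<^sup>2 \<le> (norm (x - y))\<^sup>2" using \<delta>(2)[OF that] \<delta>(1) by (intro power_mono) auto
    then show ?thesis by (simp add: H_def \<theta>id power2_norm_eq_inner[symmetric] radial_coeff_def)
  qed
  have div: "divergence \<phi> x = exp (- (\<mu> * norm (x - y))) / norm (x - y)" if x: "x \<in> \<Omega>" for x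
  proof -
    define r where "r = norm (x - y)"
    have xc: "x \<in> closure \<Omega>" using x closure_subset by blast
    have r: "0 < r" using \<delta> xc by (force simp: r_def)
    have s: "(x - y) \<bullet> (x - y) = r\<^sup>2" by (simp add: r_def power2_norm_eq_inner)
    have d1: "((\<lambda>x. (x - y) \<bullet> (x - y)) has_derivative (\<lambda>v. 2 * ((x - y) \<bullet> v))) (at x)"
      by (auto intro!: derivative_eq_intros simp: inner_commute)
    have "DERIV (radial_coeff \<mu>) ((x - y) \<bullet> (x - y)) :> ?h' (r\<^sup>2)"
      unfolding s using r by (intro DERIV_radial_coeff \<mu>) auto
    from has_derivative_compose[OF d1 this[unfolded has_field_derivative_def]]
    have d2: "((\<lambda>x. radial_coeff \<mu> ((x - y) \<bullet> (x - y))) has_derivative (\<lambda>v. ?h' (r\<^sup>2) * (2 * ((x - y) \<bullet> v)))) (at x)"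
      by simp
    have dH: "(H has_derivative (\<lambda>v. ?h' (r\<^sup>2) * (2 * ((x - y) \<bullet> v)))) (at x)"
    proof (rule has_derivative_transform_within_open[OF d2, of \<Omega>])
      show "open \<Omega>" using reg by (simp add: regular_set_def)
      fix z assume "z \<in> \<Omega>"
      then have "z \<in> closure \<Omega>" using closure_subset by blast
      from \<delta>(2)[OF this] have "\<delta>\<^sup>2 \<le> (norm (z - y))\<^sup>2" using \<delta>(1) by (intro power_mono) auto
      then show "radial_coeff \<mu> ((z - y) \<bullet> (z - y)) = H z" by (simp add: H_def \<theta>id power2_norm_eq_inner)
    qed (rule x)
    have "divergence \<phi> x = ?h' (r\<^sup>2) * (2 * ((x - y) \<bullet> (x - y))) + 2 * H x"
      unfolding \<phi>_def by (rule divergence_scaleR_diff[OF dH])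
    also have "\<dots> = exp (- (\<mu> * r)) * (1 / (2 * r\<^sup>2 * r) + 1 / (\<mu> * (r\<^sup>2)\<^sup>2)) * (2 * r\<^sup>2) - 2 * exp (- (\<mu> * r)) / (\<mu> * r\<^sup>2)"
      using r by (simp add: s Hcl[OF xc] r_def[symmetric])
    also have "\<dots> = exp (- (\<mu> * r)) / r"
      using r \<mu> by (simp add: field_simps power2_eq_square)
    finally show ?thesis by (simp add: r_def)
  qed
  have "(\<integral>x. indicator \<Omega> x * (exp (- (\<mu> * norm (x - y))) / norm (x - y)) \<partial>lborel) = (\<integral>x. indicator \<Omega> x * divergence \<phi> x \<partial>lborel)"
    by (intro Bochner_Integration.integral_cong) (auto simp: div indicator_def)
  also have "\<dots> = - (\<integral>x. \<phi> x \<bullet> inner_normal \<Omega> x \<partial>boundary_measure \<Omega>)" by (rule divergence_theorem[OF reg C])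
  also have "\<dots> = (\<integral>q. exp (- (\<mu> * norm (q - y))) / (\<mu> * (norm (q - y))\<^sup>2) * ((q - y) \<bullet> inner_normal \<Omega> q) \<partial>boundary_measure \<Omega>)"
    unfolding Bochner_Integration.integral_minus[symmetric]
  proof (rule Bochner_Integration.integral_cong[OF refl])
    fix q
    show "- (\<phi> q \<bullet> inner_normal \<Omega> q) = exp (- (\<mu> * norm (q - y))) / (\<mu> * (norm (q - y))\<^sup>2) * ((q - y) \<bullet> inner_normal \<Omega> q)"
      using Hcl[of q] by (cases "q \<in> frontier \<Omega>") (auto simp: \<phi>_def frontier_def inner_normal_def)
  qed
  finally show ?thesis .
qed

section \<open>The potential of a half plane\<close>

lemma orthonormal_pair_exists:
  assumes "norm \<nu> = 1"
  obtains \<tau> where "orthonormal_pair \<tau> \<nu>"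
proof -
  let ?t = "vector [- (\<nu> $ 2), \<nu> $ 1] :: real^2"
  have "\<nu> \<bullet> \<nu> = 1" using assms by (simp add: norm_eq_1)
  then have "orthonormal_pair ?t \<nu>"
    using assms by (simp add: orthonormal_pair_def norm_eq_1 inner_vec_def sum_2)
  then show ?thesis using that by blast
qed

lemma nn_integral_even:
  fixes f :: "real \<Rightarrow> ennreal"
  assumes [measurable]: "f \<in> borel_measurable borel" and even: "\<And>x. f (- x) = f x"
  shows "(\<integral>\<^sup>+x. f x \<partial>lborel) = 2 * (\<integral>\<^sup>+x. f x * indicator {0..} x \<partial>lborel)"
proof -
  have "(\<integral>\<^sup>+x. f x \<partial>lborel) = (\<integral>\<^sup>+x. f x * indicator {0..} x + f x * indicator {..0} x \<partial>lborel)"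
    by (intro nn_integral_cong_AE) (use AE_lborel_singleton[of 0] in eventually_elim, auto simp: indicator_def)
  also have "\<dots> = (\<integral>\<^sup>+x. f x * indicator {0..} x \<partial>lborel) + (\<integral>\<^sup>+x. f x * indicator {..0} x \<partial>lborel)"
    by (rule nn_integral_add) auto
  also have "(\<integral>\<^sup>+x. f x * indicator {..0} x \<partial>lborel) = (\<integral>\<^sup>+x. f x * indicator {0..} x \<partial>lborel)"
    by (subst nn_integral_real_affine[of _ "-1" 0]) (auto simp: even indicator_def intro!: nn_integral_cong)
  finally show ?thesis by (simp add: mult_2)
qed

lemma nn_integral_exp_abs:
  assumes "0 < c"
  shows "(\<integral>\<^sup>+s. ennreal (exp (- (c * \<bar>s\<bar>))) \<partial>lborel) = ennreal (2 / c)"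
proof -
  have "(\<integral>\<^sup>+s. ennreal (exp (- (c * \<bar>s\<bar>))) * indicator {0..} s \<partial>lborel) = (\<integral>\<^sup>+s. ennreal (exp (- (c * s))) * indicator {0..} s \<partial>lborel)"
    by (intro nn_integral_cong) (auto simp: indicator_def)
  also have "\<dots> = ennreal (0 - (- exp (- (c * 0)) / c))"
  proof (rule nn_integral_FTC_atLeast)
    show "DERIV (\<lambda>s. - exp (- (c * s)) / c) s :> exp (- (c * s))" for s
      using assms by (auto intro!: derivative_eq_intros)
    have "LIM s at_top. - (c * s) :> at_bot"
      using assms by (simp add: filterlim_uminus_at_bot filterlim_tendsto_pos_mult_at_top[OF tendsto_const _ filterlim_ident])
    then have "((\<lambda>s. - exp (- (c * s)) / c) \<longlongrightarrow> - 0 / c) at_top"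
      using assms by (intro tendsto_intros filterlim_compose[OF exp_at_bot]) auto
    then show "((\<lambda>s. - exp (- (c * s)) / c) \<longlongrightarrow> 0) at_top" by simp
  qed auto
  finally have "(\<integral>\<^sup>+s. ennreal (exp (- (c * \<bar>s\<bar>))) * indicator {0..} s \<partial>lborel) = ennreal (1 / c)" by simp
  then show ?thesis
    using assms by (subst nn_integral_even) (auto simp: ennreal_mult[symmetric] mult_2 ennreal_plus[symmetric] simp del: ennreal_plus)
qed

lemma nn_integral_abs_over_cube:
  "(\<integral>\<^sup>+x. ennreal (\<bar>x\<bar> / (sqrt (1 + x\<^sup>2)) ^ 3) \<partial>lborel) = 2"
proof -
  have "(\<integral>\<^sup>+x. ennreal (\<bar>x\<bar> / (sqrt (1 + x\<^sup>2)) ^ 3) * indicator {0..} x \<partial>lborel) =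
      (\<integral>\<^sup>+x. ennreal (x / (sqrt (1 + x\<^sup>2)) ^ 3) * indicator {0..} x \<partial>lborel)"
    by (intro nn_integral_cong) (auto simp: indicator_def)
  also have "\<dots> = ennreal (0 - (- 1 / sqrt (1 + 0\<^sup>2)))"
  proof (rule nn_integral_FTC_atLeast)
    fix x :: real
    have p: "0 < 1 + x\<^sup>2" by (simp add: add_pos_nonneg)
    show "DERIV (\<lambda>x. - 1 / sqrt (1 + x\<^sup>2)) x :> x / (sqrt (1 + x\<^sup>2)) ^ 3"
      using p sqrt_1_plus_sq_pos[of x]
      by (auto intro!: derivative_eq_intros simp: field_simps power2_eq_square power3_eq_cube)
  next
    have "filterlim (\<lambda>x::real. sqrt (1 + x\<^sup>2)) at_top at_top"
      by (intro filterlim_compose[OF sqrt_at_top] filterlim_tendsto_add_at_top[OF tendsto_const] filterlim_pow_at_top filterlim_ident) auto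
    then show "((\<lambda>x. - 1 / sqrt (1 + x\<^sup>2)) \<longlongrightarrow> 0) at_top"
      by (rule tendsto_divide_0[OF tendsto_const filterlim_at_top_imp_at_infinity])
  qed auto
  finally have "(\<integral>\<^sup>+x. ennreal (\<bar>x\<bar> / (sqrt (1 + x\<^sup>2)) ^ 3) * indicator {0..} x \<partial>lborel) = 1" by simp
  then show ?thesis by (subst nn_integral_even) auto
qed

text \<open>This is \<mu> times the absolute value of the component along \<nu> of the field in
  \<open>radial_coeff\<close>, that is, its flux density through the tangent direction. At
  \<open>z = 0\<close> the quotient has the default value 0.\<close>

definition tangent_kernel :: "real \<Rightarrow> real^2 \<Rightarrow> real^2 \<Rightarrow> real" where
  "tangent_kernel \<mu> \<nu> z = \<bar>z \<bullet> \<nu>\<bar> / (norm z)\<^sup>2 * exp (- (\<mu> * norm z))"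

lemma borel_measurable_tangent_kernel [measurable]:
  "(\<lambda>x. tangent_kernel \<mu> (f x) (g x)) \<in> borel_measurable M"
  if [measurable]: "f \<in> borel_measurable M" "g \<in> borel_measurable M"
  unfolding tangent_kernel_def by measurable

lemma tangent_kernel_nonneg [simp]: "0 \<le> tangent_kernel \<mu> \<nu> z"
  by (simp add: tangent_kernel_def)

text \<open>The substitution \<open>t = s x\<close> separates the variables.\<close>

lemma nn_integral_half_plane_potential:
  fixes \<nu> :: "real^2"
  assumes \<nu>: "norm \<nu> = 1" and \<mu>: "0 < \<mu>"
  shows "(\<integral>\<^sup>+z. ennreal (tangent_kernel \<mu> \<nu> z) \<partial>lborel) = ennreal (4 / \<mu>)"
proof -
  obtain \<tau> where on: "orthonormal_pair \<tau> \<nu>" by (rule orthonormal_pair_exists[OF \<nu>])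
  let ?w = "\<lambda>x::real. sqrt (1 + x\<^sup>2)"
  have w: "0 < ?w x" for x by (rule sqrt_1_plus_sq_pos)
  have "(\<integral>\<^sup>+z. ennreal (tangent_kernel \<mu> \<nu> z) \<partial>lborel) =
    (\<integral>\<^sup>+s. \<integral>\<^sup>+t. ennreal (\<bar>t\<bar> / (s\<^sup>2 + t\<^sup>2) * exp (- (\<mu> * sqrt (s\<^sup>2 + t\<^sup>2)))) \<partial>lborel \<partial>lborel)"
    by (subst nn_integral_frame[OF on]) (auto simp: tangent_kernel_def norm_frame_map[OF on] on)
  also have "\<dots> = (\<integral>\<^sup>+s. \<integral>\<^sup>+x. ennreal (\<bar>x\<bar> / (1 + x\<^sup>2) * exp (- (\<mu> * ?w x * \<bar>s\<bar>))) \<partial>lborel \<partial>lborel)"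
  proof (intro nn_integral_cong_AE)
    \<comment> \<open>The substitution degenerates at \<open>s = 0\<close>, a null set.\<close>
    show "AE s in lborel. (\<integral>\<^sup>+t. ennreal (\<bar>t\<bar> / (s\<^sup>2 + t\<^sup>2) * exp (- (\<mu> * sqrt (s\<^sup>2 + t\<^sup>2)))) \<partial>lborel) =
      (\<integral>\<^sup>+x. ennreal (\<bar>x\<bar> / (1 + x\<^sup>2) * exp (- (\<mu> * ?w x * \<bar>s\<bar>))) \<partial>lborel)"
      using AE_lborel_singleton[of 0]
    proof eventually_elim
      case (elim s)
      have "(\<integral>\<^sup>+t. ennreal (\<bar>t\<bar> / (s\<^sup>2 + t\<^sup>2) * exp (- (\<mu> * sqrt (s\<^sup>2 + t\<^sup>2)))) \<partial>lborel) =
        ennreal \<bar>s\<bar> * (\<integral>\<^sup>+x. ennreal (\<bar>s * x\<bar> / (s\<^sup>2 + (s * x)\<^sup>2) * exp (- (\<mu> * sqrt (s\<^sup>2 + (s * x)\<^sup>2)))) \<partial>lborel)"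
        using elim by (subst nn_integral_real_affine[of _ s 0]) auto
      also have "\<dots> = (\<integral>\<^sup>+x. ennreal \<bar>s\<bar> * ennreal (\<bar>s * x\<bar> / (s\<^sup>2 + (s * x)\<^sup>2) * exp (- (\<mu> * sqrt (s\<^sup>2 + (s * x)\<^sup>2)))) \<partial>lborel)"
        by (subst nn_integral_cmult) auto
      also have "\<dots> = (\<integral>\<^sup>+x. ennreal (\<bar>x\<bar> / (1 + x\<^sup>2) * exp (- (\<mu> * ?w x * \<bar>s\<bar>))) \<partial>lborel)"
      proof (rule nn_integral_cong)
        fix x
        have 1: "s\<^sup>2 + (s * x)\<^sup>2 = s\<^sup>2 * (1 + x\<^sup>2)" by (simp add: power_mult_distrib algebra_simps)
        have 2: "\<bar>s\<bar> * (\<bar>s * x\<bar> / (s\<^sup>2 * (1 + x\<^sup>2))) = \<bar>x\<bar> / (1 + x\<^sup>2)"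
          using elim by (simp add: abs_mult power2_eq_square[of s])
            (metis abs_mult_self_eq abs_zero mult.assoc mult_divide_mult_cancel_left mult_eq_0_iff)
        show "ennreal \<bar>s\<bar> * ennreal (\<bar>s * x\<bar> / (s\<^sup>2 + (s * x)\<^sup>2) * exp (- (\<mu> * sqrt (s\<^sup>2 + (s * x)\<^sup>2)))) =
            ennreal (\<bar>x\<bar> / (1 + x\<^sup>2) * exp (- (\<mu> * ?w x * \<bar>s\<bar>)))"
          unfolding 1 by (subst ennreal_mult[symmetric]) (simp_all add: 2[symmetric] real_sqrt_mult mult.commute mult.left_commute)
      qed
      finally show ?case .
    qed
  qed
  also have "\<dots> = (\<integral>\<^sup>+x. \<integral>\<^sup>+s. ennreal (\<bar>x\<bar> / (1 + x\<^sup>2) * exp (- (\<mu> * ?w x * \<bar>s\<bar>))) \<partial>lborel \<partial>lborel)"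
    by (rule lborel_pair.Fubini') measurable
  also have "\<dots> = (\<integral>\<^sup>+x. ennreal (2 / \<mu>) * ennreal (\<bar>x\<bar> / (?w x) ^ 3) \<partial>lborel)"
  proof (rule nn_integral_cong)
    fix x :: real
    have "(\<integral>\<^sup>+s. ennreal (\<bar>x\<bar> / (1 + x\<^sup>2) * exp (- (\<mu> * ?w x * \<bar>s\<bar>))) \<partial>lborel) =
        ennreal (\<bar>x\<bar> / (1 + x\<^sup>2)) * (\<integral>\<^sup>+s. ennreal (exp (- (\<mu> * ?w x * \<bar>s\<bar>))) \<partial>lborel)"
      by (subst nn_integral_cmult[symmetric]) (auto simp: ennreal_mult[symmetric])
    also have "\<dots> = ennreal (\<bar>x\<bar> / (1 + x\<^sup>2)) * ennreal (2 / (\<mu> * ?w x))"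
      using \<mu> w by (subst nn_integral_exp_abs) auto
    also have "\<dots> = ennreal (2 / \<mu>) * ennreal (\<bar>x\<bar> / (?w x) ^ 3)"
    proof -
      have "(?w x)\<^sup>2 = 1 + x\<^sup>2" by (simp add: add_nonneg_nonneg)
      then have "\<bar>x\<bar> / (1 + x\<^sup>2) * (2 / (\<mu> * ?w x)) = 2 / \<mu> * (\<bar>x\<bar> / (?w x) ^ 3)"
        using \<mu> w[of x] by (simp add: power3_eq_cube power2_eq_square field_simps)
      then show ?thesis using \<mu> w[of x] by (simp add: ennreal_mult[symmetric])
    qed
    finally show "(\<integral>\<^sup>+s. ennreal (\<bar>x\<bar> / (1 + x\<^sup>2) * exp (- (\<mu> * ?w x * \<bar>s\<bar>))) \<partial>lborel) =
      ennreal (2 / \<mu>) * ennreal (\<bar>x\<bar> / (?w x) ^ 3)" .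
  qed
  also have "\<dots> = ennreal (2 / \<mu>) * 2"
    by (subst nn_integral_cmult) (auto simp: nn_integral_abs_over_cube)
  also have "\<dots> = ennreal (4 / \<mu>)"
    using \<mu> by (simp add: ennreal_numeral[symmetric] ennreal_mult[symmetric] del: ennreal_numeral)
  finally show ?thesis .
qed

text \<open>Reflecting \<nu> to \<open>- \<nu>\<close> changes nothing in frame coordinates, so the
  two half planes share the total \<open>4 / \<mu>\<close> equally.\<close>

lemma integral_half_plane_potential:
  fixes \<nu> :: "real^2"
  assumes \<nu>: "norm \<nu> = 1" and \<mu>: "0 < \<mu>"
  shows "integrable lborel (tangent_kernel \<mu> \<nu>)" (is "integrable _ ?f")
    and "(\<integral>z. max 0 (- (z \<bullet> \<nu>)) / (norm z)\<^sup>2 * exp (- (\<mu> * norm z)) \<partial>lborel) = 2 / \<mu>"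
proof -
  have "has_bochner_integral lborel ?f (4 / \<mu>)"
    using \<mu> nn_integral_half_plane_potential[OF \<nu> \<mu>] by (intro has_bochner_integral_nn_integral) auto
  then have int: "integrable lborel ?f" and val: "(\<integral>z. ?f z \<partial>lborel) = 4 / \<mu>"
    by (auto simp: has_bochner_integral_iff)
  show "integrable lborel ?f" by (rule int)
  obtain \<tau> where on: "orthonormal_pair \<tau> \<nu>" by (rule orthonormal_pair_exists[OF \<nu>])
  then have on': "orthonormal_pair \<tau> (- \<nu>)" by (simp add: orthonormal_pair_def)
  define h where "h \<nu> = (\<lambda>z::real^2. max 0 (z \<bullet> \<nu>) / (norm z)\<^sup>2 * exp (- (\<mu> * norm z)))" for \<nu>
  have hm [measurable]: "h \<nu> \<in> borel_measurable borel" for \<nu> unfolding h_def by measurable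
  have fr: "h n (frame_map e n p) = max 0 (snd p) / ((fst p)\<^sup>2 + (snd p)\<^sup>2) * exp (- (\<mu> * sqrt ((fst p)\<^sup>2 + (snd p)\<^sup>2)))"
    if "orthonormal_pair e n" for e n p
    using that norm_frame_map[OF that, of "fst p" "snd p"] by (simp add: h_def)
  have eq: "integral\<^sup>L lborel (h \<nu>) = integral\<^sup>L lborel (h (- \<nu>))"
    unfolding integral_frame[OF on hm[of \<nu>]] integral_frame[OF on' hm[of "- \<nu>"]] fr[OF on] fr[OF on'] ..
  have inth: "integrable lborel (h \<nu>)" "integrable lborel (h (- \<nu>))"
    by (rule Bochner_Integration.integrable_bound[OF int]; (simp add: h_def tangent_kernel_def)?;
        intro always_eventually allI mult_right_mono divide_right_mono; simp)+
  have "?f = (\<lambda>z. h \<nu> z + h (- \<nu>) z)"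
    by (auto simp: h_def tangent_kernel_def fun_eq_iff add_divide_distrib[symmetric] distrib_right[symmetric] max_def)
  then have "4 / \<mu> = integral\<^sup>L lborel (h \<nu>) + integral\<^sup>L lborel (h (- \<nu>))"
    using val Bochner_Integration.integral_add[OF inth] by simp
  then have "integral\<^sup>L lborel (h (- \<nu>)) = 2 / \<mu>" using eq by simp
  then show "(\<integral>z. max 0 (- (z \<bullet> \<nu>)) / (norm z)\<^sup>2 * exp (- (\<mu> * norm z)) \<partial>lborel) = 2 / \<mu>"
    by (simp add: h_def)
qed

text \<open>Since |z| is at most the sum of the absolute values of its two coordinates, the kernel
  is dominated by the sum of two tangent kernels, whose integrability is known.\<close>

lemma integrable_exp_over_norm:
  assumes "0 < \<mu>"
  shows "integrable lborel (\<lambda>z::real^2. exp (- (\<mu> * norm z)) / norm z)"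
proof -
  let ?e = "axis 1 1 :: real^2" and ?n = "axis 2 1 :: real^2"
  have on: "orthonormal_pair ?e ?n" by (rule orthonormal_pair_axis)
  then have n: "norm ?e = 1" "norm ?n = 1" by (auto simp: orthonormal_pair_def)
  show ?thesis
  proof (rule Bochner_Integration.integrable_bound[OF Bochner_Integration.integrable_add[OF
        integral_half_plane_potential(1)[OF n(1) assms] integral_half_plane_potential(1)[OF n(2) assms]]])
    show "AE z in lborel. norm (exp (- (\<mu> * norm z)) / norm z) \<le>
      norm (tangent_kernel \<mu> ?e z + tangent_kernel \<mu> ?n z)"
    proof (intro always_eventually allI)
      fix z :: "real^2"
      show "norm (exp (- (\<mu> * norm z)) / norm z) \<le>
        norm (tangent_kernel \<mu> ?e z + tangent_kernel \<mu> ?n z)"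
      proof (cases "z = 0")
        case False
        have "norm z \<le> \<bar>z \<bullet> ?e\<bar> + \<bar>z \<bullet> ?n\<bar>"
          unfolding orthonormal_pair_norm[OF on, of z] by (rule sqrt_sum_squares_le_sum_abs)
        then have "norm z / (norm z)\<^sup>2 * exp (- (\<mu> * norm z)) \<le> (\<bar>z \<bullet> ?e\<bar> + \<bar>z \<bullet> ?n\<bar>) / (norm z)\<^sup>2 * exp (- (\<mu> * norm z))"
          by (intro mult_right_mono divide_right_mono) auto
        moreover have "norm z / (norm z)\<^sup>2 = 1 / norm z" using False by (simp add: power2_eq_square)
        ultimately show ?thesis by (simp add: tangent_kernel_def add_divide_distrib distrib_right)
      qed simp
    qed
  qed simp
qed

section \<open>The nonlocal energy as a boundary integral\<close>

lemma lborel_translate: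
  fixes f :: "'a::euclidean_space \<Rightarrow> real"
  assumes [measurable]: "f \<in> borel_measurable borel"
  shows "(\<integral>y. f (c + y) \<partial>lborel) = (\<integral>y. f y \<partial>lborel)"
    and "integrable lborel (\<lambda>y. f (c + y)) \<longleftrightarrow> integrable lborel f"
proof -
  show "(\<integral>y. f (c + y) \<partial>lborel) = (\<integral>y. f y \<partial>lborel)"
    by (subst (2) lborel_distr_plus[of c, symmetric], subst integral_distr) auto
  show "integrable lborel (\<lambda>y. f (c + y)) \<longleftrightarrow> integrable lborel f"
    by (subst (2) lborel_distr_plus[of c, symmetric], subst integrable_distr_eq) auto
qed

lemma emeasure_graph_eq_0:
  assumes on: "orthonormal_pair e n" and g: "continuous_on UNIV g"
  shows "emeasure lborel {x. x \<bullet> n = g (x \<bullet> e)} = 0"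
proof -
  have [measurable]: "g \<in> borel_measurable borel" using g by (rule borel_measurable_continuous_onI)
  have [measurable]: "{x. x \<bullet> n = g (x \<bullet> e)} \<in> sets borel" by measurable
  have "emeasure lborel {x. x \<bullet> n = g (x \<bullet> e)} = (\<integral>\<^sup>+x. indicator {x. x \<bullet> n = g (x \<bullet> e)} x \<partial>lborel)"
    by simp
  also have "\<dots> = (\<integral>\<^sup>+s. \<integral>\<^sup>+t. indicator {x. x \<bullet> n = g (x \<bullet> e)} (frame_map e n (s, t)) \<partial>lborel \<partial>lborel)"
    by (rule nn_integral_frame[OF on]) simp
  also have "\<dots> = (\<integral>\<^sup>+s. \<integral>\<^sup>+t. indicator {g s} t \<partial>lborel \<partial>(lborel :: real measure))"
    by (intro nn_integral_cong) (auto simp: indicator_def on)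
  also have "\<dots> = 0" by simp
  finally show ?thesis .
qed

text \<open>The boundary formula for the kernel integral holds for \<open>y\<close> outside the
  closure, so the frontier must be negligible. Within each chart ball it lies on a graph.\<close>

lemma AE_not_frontier:
  assumes reg: "regular_set \<Omega>"
  shows "AE x in lborel. x \<notin> frontier \<Omega>"
proof -
  obtain I r e n g where I: "finite I" "closure \<Omega> \<subseteq> (\<Union>p\<in>I. ball p (r p))"
    and ch: "\<And>p. p \<in> I \<Longrightarrow> chart \<Omega> p (r p) (e p) (n p) (g p)"
    by (rule regular_set_atlas[OF reg]) blast
  have "AE x in lborel. x \<in> ball p (r p) \<longrightarrow> x \<notin> frontier \<Omega>" if "p \<in> I" for p
  proof -
    note c = ch[OF that]
    note sm = smooth_realD[OF chartD(3)[OF c]]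
    have [measurable]: "g p \<in> borel_measurable borel" using sm(3) by (rule borel_measurable_continuous_onI)
    have "{x. x \<bullet> n p = g p (x \<bullet> e p)} \<in> null_sets lborel"
      using emeasure_graph_eq_0[OF chartD(2)[OF c] sm(3)] by (intro null_setsI) simp_all
    from AE_not_in[OF this] show ?thesis
      by eventually_elim (use chart_frontier[OF c] in auto)
  qed
  then have "AE x in lborel. \<forall>p\<in>I. x \<in> ball p (r p) \<longrightarrow> x \<notin> frontier \<Omega>"
    unfolding AE_finite_all[OF I(1)] by blast
  then show ?thesis
    by eventually_elim (use I(2) in \<open>auto simp: frontier_def\<close>)
qed

text \<open>The symmetric difference of \<Omega> and its inner tangent half plane at
  \<open>q\<close>, in coordinates centred at \<open>q\<close>.\<close>

definition mismatch :: "(real^2) set \<Rightarrow> real^2 \<Rightarrow> (real^2) set" where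
  "mismatch \<Omega> q = {z. (q + z \<in> \<Omega>) \<noteq> (0 < z \<bullet> inner_normal \<Omega> q)}"

lemma borel_mismatch: "regular_set \<Omega> \<Longrightarrow> mismatch \<Omega> q \<in> sets borel"
proof -
  assume "regular_set \<Omega>"
  then have [measurable]: "\<Omega> \<in> sets borel" by (simp add: regular_set_def)
  show ?thesis unfolding mismatch_def by measurable
qed

text \<open>The amount by which the flux integral at \<open>q\<close> falls short of its value for
  the tangent half plane, with the common factor \<open>1 / \<mu>\<close> taken out. Off the
  frontier it is 0, because \<open>inner_normal\<close> is 0 there.\<close>

definition half_plane_defect :: "(real^2) set \<Rightarrow> real \<Rightarrow> real^2 \<Rightarrow> real" where
  "half_plane_defect \<Omega> \<mu> q =
     (\<integral>z. indicator (mismatch \<Omega> q) z * tangent_kernel \<mu> (inner_normal \<Omega> q) z \<partial>lborel)"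

lemma borel_measurable_half_plane_defect:
  assumes reg: "regular_set \<Omega>"
  shows "half_plane_defect \<Omega> \<mu> \<in> borel_measurable borel"
proof -
  have [measurable]: "inner_normal \<Omega> \<in> borel_measurable borel" by (rule borel_measurable_inner_normal[OF reg])
  have [measurable]: "\<Omega> \<in> sets borel" using reg by (simp add: regular_set_def)
  have "(\<lambda>q. (\<integral>z. (if (q + z \<in> \<Omega>) \<noteq> (0 < z \<bullet> inner_normal \<Omega> q) then 1 else 0) *
        tangent_kernel \<mu> (inner_normal \<Omega> q) z \<partial>lborel)) \<in> borel_measurable borel"
    by measurable
  then show ?thesis by (simp add: half_plane_defect_def[abs_def] mismatch_def indicator_def of_bool_def)
qed

lemma half_plane_defect_integrable:
  assumes reg: "regular_set \<Omega>" and \<mu>: "0 < \<mu>" and q: "q \<in> frontier \<Omega>"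
  shows "integrable lborel (\<lambda>z. indicator (mismatch \<Omega> q) z * tangent_kernel \<mu> (inner_normal \<Omega> q) z)"
  using integrable_mult_indicator[OF _ integral_half_plane_potential(1)[OF regular_set_inner_normal(2)[OF reg q] \<mu>], of
      "mismatch \<Omega> q"] borel_mismatch[OF reg] by simp

lemma half_plane_defect_bounds:
  assumes reg: "regular_set \<Omega>" and \<mu>: "0 < \<mu>"
  shows "0 \<le> half_plane_defect \<Omega> \<mu> q" "half_plane_defect \<Omega> \<mu> q \<le> 4 / \<mu>"
proof -
  show "0 \<le> half_plane_defect \<Omega> \<mu> q" unfolding half_plane_defect_def by (intro integral_nonneg_AE) simp
  show "half_plane_defect \<Omega> \<mu> q \<le> 4 / \<mu>"
  proof (cases "q \<in> frontier \<Omega>")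
    case True
    note \<nu> = regular_set_inner_normal(2)[OF reg True]
    have "half_plane_defect \<Omega> \<mu> q \<le> (\<integral>z. tangent_kernel \<mu> (inner_normal \<Omega> q) z \<partial>lborel)"
      unfolding half_plane_defect_def
      by (intro integral_mono half_plane_defect_integrable integral_half_plane_potential assms True \<nu>)
        (auto simp: indicator_def)
    also have "\<dots> = 4 / \<mu>"
      using nn_integral_half_plane_potential[OF \<nu> \<mu>] \<mu> by (intro integral_eq_nn_integral[THEN trans]) auto
    finally show ?thesis .
  qed (use \<mu> in \<open>simp add: half_plane_defect_def tangent_kernel_def inner_normal_def\<close>)
qed

text \<open>Fubini is used twice: over \<open>lborel\<close> in both variables, to fix
  \<open>y\<close> and apply the boundary formula, and over the boundary measure and
  \<open>lborel\<close>, to fix the boundary point. Both times translates of the integrable kernel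
  \<open>k\<close> are the majorant.\<close>

lemma nonlocal_energy_eq:
  assumes reg: "regular_set \<Omega>" and \<mu>: "0 < \<mu>"
  shows "(LINT x:\<Omega>|lebesgue. (LINT y:- \<Omega>|lebesgue. exp (- (\<mu> * norm (x - y))) / norm (x - y))) =
    2 / \<mu>\<^sup>2 * measure (boundary_measure \<Omega>) UNIV - (1 / \<mu>) * (\<integral>q. half_plane_defect \<Omega> \<mu> q \<partial>boundary_measure \<Omega>)"
proof -
  interpret B: finite_measure "boundary_measure \<Omega>" by (rule finite_boundary_measure[OF reg])
  interpret BL: pair_sigma_finite "boundary_measure \<Omega>" "lborel :: (real^2) measure" ..
  have \<Omega>m [measurable]: "\<Omega> \<in> sets borel" using reg by (simp add: regular_set_def)
  have [measurable]: "inner_normal \<Omega> \<in> borel_measurable borel" by (rule borel_measurable_inner_normal[OF reg])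
  define k where "k z = exp (- (\<mu> * norm z)) / norm z" for z :: "real^2"
  have [measurable]: "k \<in> borel_measurable borel" unfolding k_def by measurable
  have k0: "0 \<le> k z" for z by (simp add: k_def)
  have kint: "integrable lborel k" unfolding k_def using \<mu> by (rule integrable_exp_over_norm)
  define K where "K = (\<integral>z. k z \<partial>lborel)"
  have kshift: "integrable lborel (\<lambda>y. k (x - y))" "(\<integral>y. k (x - y) \<partial>lborel) = K" for x
  proof -
    have "k (x - y) = k (- x + y)" for y by (simp add: k_def norm_minus_commute)
    then show "integrable lborel (\<lambda>y. k (x - y))" "(\<integral>y. k (x - y) \<partial>lborel) = K"
      using lborel_translate[of k "- x"] kint by (simp_all add: K_def)
  qed
  define f where "f = (\<lambda>(x, y). indicator \<Omega> x * (indicator (- \<Omega>) y * k (x - y)) :: real)"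
  have [measurable]: "f \<in> borel_measurable (lborel \<Otimes>\<^sub>M lborel)" unfolding f_def by measurable
  have fi: "integrable lborel (\<lambda>y. f (x, y))" for x
  proof -
    have "integrable lborel (\<lambda>y. indicator (- \<Omega>) y * k (x - y))"
      using integrable_mult_indicator[OF _ kshift(1), of "- \<Omega>"] by simp
    then show ?thesis unfolding f_def by simp
  qed
  have \<Omega>fin: "integrable lborel (indicator \<Omega> :: _ \<Rightarrow> real)"
    using reg emeasure_bounded_finite[of \<Omega>] by (simp add: regular_set_def)
  have f_int: "integrable (lborel \<Otimes>\<^sub>M lborel) f"
  proof (rule lborel_pair.Fubini_integrable)
    show "integrable lborel (\<lambda>x. \<integral>y. norm (f (x, y)) \<partial>lborel)"
    proof (rule Bochner_Integration.integrable_bound)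
      show "integrable lborel (\<lambda>x. indicator \<Omega> x * K :: real)" using \<Omega>fin by simp
      show "AE x in lborel. norm (\<integral>y. norm (f (x, y)) \<partial>lborel) \<le> norm (indicator \<Omega> x * K)"
      proof (intro always_eventually allI)
        fix x
        have "(\<integral>y. norm (f (x, y)) \<partial>lborel) \<le> (\<integral>y. indicator \<Omega> x * k (x - y) \<partial>lborel)"
          by (intro integral_mono integrable_norm fi) (auto simp: kshift f_def indicator_def k0)
        also have "\<dots> = indicator \<Omega> x * K" by (simp add: kshift)
        finally show "norm (\<integral>y. norm (f (x, y)) \<partial>lborel) \<le> norm (indicator \<Omega> x * K)" by simp
      qed
    qed measurable
  qed (use fi in auto)
  define G where "G = (\<lambda>(q, y). exp (- (\<mu> * norm (q - y))) / (\<mu> * (norm (q - y))\<^sup>2) * ((q - y) \<bullet> inner_normal \<Omega> q))"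
  define h where "h = (\<lambda>(q, y). indicator (- \<Omega>) y * G (q, y))"
  have [measurable]: "G \<in> borel_measurable (borel \<Otimes>\<^sub>M borel)" unfolding G_def by measurable
  have hm': "h \<in> borel_measurable (borel \<Otimes>\<^sub>M borel)" unfolding h_def by measurable
  have hm [measurable]: "h \<in> borel_measurable (boundary_measure \<Omega> \<Otimes>\<^sub>M lborel)"
    using hm' by (subst measurable_cong_sets[OF sets_pair_measure_cong refl]) auto
  \<comment> \<open>For \<open>q = y\<close> both sides are 0 by the default value of
    division.\<close>
  have Gle: "\<bar>G (q, y)\<bar> \<le> k (q - y) / \<mu>" for q y
  proof (cases "q = y")
    case False
    have "\<bar>(q - y) \<bullet> inner_normal \<Omega> q\<bar> \<le> norm (q - y) * norm (inner_normal \<Omega> q)" by (rule Cauchy_Schwarz_ineq2)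
    also have "\<dots> \<le> norm (q - y) * 1" by (intro mult_left_mono norm_inner_normal_le[OF reg]) auto
    finally have "\<bar>G (q, y)\<bar> \<le> exp (- (\<mu> * norm (q - y))) / (\<mu> * (norm (q - y))\<^sup>2) * norm (q - y)"
      unfolding G_def using \<mu> by (simp add: abs_mult divide_right_mono mult_left_mono)
    also have "\<dots> = k (q - y) / \<mu>" using False \<mu> by (simp add: k_def power2_eq_square)
    finally show ?thesis .
  qed (simp add: G_def k_def)
  have hle: "\<bar>h (q, y)\<bar> \<le> k (q - y) / \<mu>" for q y
    using Gle[of q y] by (auto simp: h_def indicator_def intro: divide_nonneg_nonneg k0 less_imp_le[OF \<mu>])
  have hi: "integrable lborel (\<lambda>y. h (q, y))" for q
  proof (rule Bochner_Integration.integrable_bound)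
    show "integrable lborel (\<lambda>y. k (q - y) / \<mu>)" using kshift(1) by simp
    show "AE y in lborel. norm (h (q, y)) \<le> norm (k (q - y) / \<mu>)"
      using hle[of q] \<mu> k0 by (intro always_eventually allI) auto
    show "(\<lambda>y. h (q, y)) \<in> borel_measurable lborel" using hm' by measurable
  qed
  have h_int: "integrable (boundary_measure \<Omega> \<Otimes>\<^sub>M lborel) h"
  proof (rule BL.Fubini_integrable)
    show "integrable (boundary_measure \<Omega>) (\<lambda>q. \<integral>y. norm (h (q, y)) \<partial>lborel)"
    proof (rule B.integrable_const_bound[where B="K / \<mu>"])
      show "AE q in boundary_measure \<Omega>. norm (\<integral>y. norm (h (q, y)) \<partial>lborel) \<le> K / \<mu>"
      proof (intro always_eventually allI)
        fix q
        have "(\<integral>y. norm (h (q, y)) \<partial>lborel) \<le> (\<integral>y. k (q - y) / \<mu> \<partial>lborel)"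
          by (intro integral_mono integrable_norm hi) (auto simp: kshift hle)
        also have "\<dots> = K / \<mu>" by (simp add: kshift)
        finally show "norm (\<integral>y. norm (h (q, y)) \<partial>lborel) \<le> K / \<mu>" by simp
      qed
      show "(\<lambda>q. \<integral>y. norm (h (q, y)) \<partial>lborel) \<in> borel_measurable (boundary_measure \<Omega>)" by measurable
    qed
  qed (use hi in auto)
  have inner: "(LINT y:- \<Omega>|lebesgue. exp (- (\<mu> * norm (x - y))) / norm (x - y)) = (\<integral>y. indicator (- \<Omega>) y * k (x - y) \<partial>lborel)" for x
    unfolding set_lebesgue_integral_def k_def by (subst integral_completion) auto
  have "(LINT x:\<Omega>|lebesgue. (LINT y:- \<Omega>|lebesgue. exp (- (\<mu> * norm (x - y))) / norm (x - y))) =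
      (\<integral>x. indicator \<Omega> x * (\<integral>y. indicator (- \<Omega>) y * k (x - y) \<partial>lborel) \<partial>lborel)"
    unfolding inner unfolding set_lebesgue_integral_def by (subst integral_completion) auto
  also have "\<dots> = (\<integral>x. \<integral>y. f (x, y) \<partial>lborel \<partial>lborel)" by (simp add: f_def)
  also have "\<dots> = (\<integral>y. \<integral>x. f (x, y) \<partial>lborel \<partial>lborel)"
    using lborel_pair.Fubini_integral[of "\<lambda>x y. f (x, y)"] f_int by (simp add: split_beta')
  also have "\<dots> = (\<integral>y. \<integral>q. h (q, y) \<partial>boundary_measure \<Omega> \<partial>lborel)"
  proof (rule integral_cong_AE)
    show "AE y in lborel. (\<integral>x. f (x, y) \<partial>lborel) = (\<integral>q. h (q, y) \<partial>boundary_measure \<Omega>)"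
      using AE_not_frontier[OF reg]
    proof eventually_elim
      case (elim y)
      show ?case
      proof (cases "y \<in> \<Omega>")
        case True
        then show ?thesis by (simp add: f_def h_def)
      next
        case False
        then have y: "y \<notin> closure \<Omega>" using elim reg by (auto simp: frontier_def regular_set_def interior_open)
        have "(\<integral>x. f (x, y) \<partial>lborel) = (\<integral>x. indicator \<Omega> x * (exp (- (\<mu> * norm (x - y))) / norm (x - y)) \<partial>lborel)"
          using False by (simp add: f_def k_def)
        also have "\<dots> = (\<integral>q. G (q, y) \<partial>boundary_measure \<Omega>)"
          unfolding integral_kernel_eq_boundary_integral[OF reg \<mu> y] by (simp add: G_def)
        finally show ?thesis using False by (simp add: h_def)
      qed
    qed
  qed (use BL.Fubini_integral[of "\<lambda>q y. h (q, y)"] in measurable)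
  also have "\<dots> = (\<integral>q. \<integral>y. h (q, y) \<partial>lborel \<partial>boundary_measure \<Omega>)"
    using BL.Fubini_integral[of "\<lambda>q y. h (q, y)"] h_int by (simp add: split_beta')
  also have "\<dots> = (\<integral>q. (1 / \<mu>) * (2 / \<mu> - half_plane_defect \<Omega> \<mu> q) \<partial>boundary_measure \<Omega>)"
  proof (rule integral_cong_AE)
    show "AE q in boundary_measure \<Omega>. (\<integral>y. h (q, y) \<partial>lborel) = (1 / \<mu>) * (2 / \<mu> - half_plane_defect \<Omega> \<mu> q)"
      using AE_boundary_measure
    proof eventually_elim
      case (elim q)
      let ?\<nu> = "inner_normal \<Omega> q"
      note \<nu> = regular_set_inner_normal(2)[OF reg elim]
      let ?T = "\<lambda>z. max 0 (- (z \<bullet> ?\<nu>)) / (norm z)\<^sup>2 * exp (- (\<mu> * norm z))"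
      have mx: "integrable lborel ?T"
        by (rule Bochner_Integration.integrable_bound[OF integral_half_plane_potential(1)[OF \<nu> \<mu>]])
          (auto intro!: always_eventually mult_right_mono divide_right_mono simp: tangent_kernel_def)
      have "(\<integral>y. h (q, y) \<partial>lborel) = (\<integral>z. h (q, q + z) \<partial>lborel)"
        using hm' by (intro lborel_translate(1)[symmetric]) measurable
      also have "\<dots> = (\<integral>z. (1 / \<mu>) * (?T z - indicator (mismatch \<Omega> q) z * tangent_kernel \<mu> ?\<nu> z) \<partial>lborel)"
      proof (rule Bochner_Integration.integral_cong[OF refl])
        fix z
        have diff: "q - (q + z) = - z" by simp
        \<comment> \<open>There are two kinds of mismatch: a point of the half plane outside
          \<Omega> adds the negative amount \<open>- (z \<bullet> \<nu>)\<close>, and a point of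
          \<Omega> outside the half plane removes the positive amount
          \<open>- (z \<bullet> \<nu>)\<close>. Both lower the value by
          \<open>\<bar>z \<bullet> \<nu>\<bar>\<close>, so the defect has a sign and nothing
          cancels.\<close>
        have split: "indicator (- \<Omega>) (q + z) * (- (z \<bullet> ?\<nu>)) =
          max 0 (- (z \<bullet> ?\<nu>)) - indicator (mismatch \<Omega> q) z * \<bar>z \<bullet> ?\<nu>\<bar>"
          by (cases "z \<bullet> ?\<nu>" "0::real" rule: linorder_cases) (auto simp: mismatch_def indicator_def)
        have "h (q, q + z) = indicator (- \<Omega>) (q + z) * (- (z \<bullet> ?\<nu>)) * (exp (- (\<mu> * norm z)) / (\<mu> * (norm z)\<^sup>2))"
          unfolding h_def G_def prod.case diff inner_minus_left norm_minus_cancel by (simp only: ac_simps)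
        then show "h (q, q + z) = (1 / \<mu>) * (?T z - indicator (mismatch \<Omega> q) z * tangent_kernel \<mu> ?\<nu> z)"
          unfolding split tangent_kernel_def by (simp add: left_diff_distrib right_diff_distrib diff_divide_distrib)
      qed
      also have "\<dots> = (1 / \<mu>) * (2 / \<mu> - half_plane_defect \<Omega> \<mu> q)"
        using half_plane_defect_integrable[OF reg \<mu> elim] mx integral_half_plane_potential(2)[OF \<nu> \<mu>]
        by (simp add: half_plane_defect_def)
      finally show ?case .
    qed
    have [measurable]: "half_plane_defect \<Omega> \<mu> \<in> borel_measurable borel" by (rule borel_measurable_half_plane_defect[OF reg])
    show "(\<lambda>q. (1 / \<mu>) * (2 / \<mu> - half_plane_defect \<Omega> \<mu> q)) \<in> borel_measurable (boundary_measure \<Omega>)" by simp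
    show "(\<lambda>q. \<integral>y. h (q, y) \<partial>lborel) \<in> borel_measurable (boundary_measure \<Omega>)" by measurable
  qed
  also have "\<dots> = 2 / \<mu>\<^sup>2 * measure (boundary_measure \<Omega>) UNIV - (1 / \<mu>) * (\<integral>q. half_plane_defect \<Omega> \<mu> q \<partial>boundary_measure \<Omega>)"
  proof -
    have "integrable (boundary_measure \<Omega>) (half_plane_defect \<Omega> \<mu>)"
    proof (rule B.integrable_const_bound[where B="4 / \<mu>"])
      show "AE q in boundary_measure \<Omega>. norm (half_plane_defect \<Omega> \<mu> q) \<le> 4 / \<mu>"
        using half_plane_defect_bounds[OF reg \<mu>] by simp
      show "half_plane_defect \<Omega> \<mu> \<in> borel_measurable (boundary_measure \<Omega>)"
        using borel_measurable_half_plane_defect[OF reg] by simp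
    qed
    then show ?thesis by (simp add: right_diff_distrib power2_eq_square mult.commute)
  qed
  finally show ?thesis .
qed

section \<open>Curvature in a chart\<close>

text \<open>The classical curvature of a graph. As \<Omega> lies above the graph, a positive second
  derivative means that \<Omega> is locally convex, in accordance with the sign in
  \<open>has_curvature\<close>.\<close>

definition chart_curvature :: "real^2 \<Rightarrow> (real \<Rightarrow> real) \<Rightarrow> real^2 \<Rightarrow> real" where
  "chart_curvature e g q = deriv (deriv g) (q \<bullet> e) / sqrt (1 + (deriv g (q \<bullet> e))\<^sup>2) ^ 3"

text \<open>For \<open>w\<close> the speed of a curve, \<open>L\<close> is the signed arc length
  from \<open>s0\<close> and its inverse \<open>S\<close> gives the reparametrization by arc
  length.\<close>

lemma inverse_antiderivative_exists:
  fixes w :: "real \<Rightarrow> real"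
  assumes w: "continuous_on UNIV w" and pos: "\<And>s. 0 < w s"
  obtains \<epsilon> S where "0 < \<epsilon>" "S 0 = s0"
    "\<And>t. \<bar>t\<bar> < \<epsilon> \<Longrightarrow> (S has_real_derivative 1 / w (S t)) (at t)"
proof -
  define a b where "a = s0 - 1" and "b = s0 + 1"
  let ?T = "{a<..<b}"
  define L where "L x = integral {a..x} w - integral {a..s0} w" for x
  have dL: "(L has_real_derivative w x) (at x)" if "x \<in> ?T" for x
  proof -
    have "((\<lambda>x. integral {a..x} w) has_real_derivative w x) (at x within {a..b})"
      using that by (intro integral_has_real_derivative continuous_on_subset[OF w]) auto
    then have "((\<lambda>x. integral {a..x} w) has_real_derivative w x) (at x)"
      using that by (simp add: at_within_Icc_at)
    then show ?thesis unfolding L_def by (auto intro!: derivative_eq_intros)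
  qed
  have mono: "L x < L y" if "x \<in> ?T" "y \<in> ?T" "x < y" for x y
  proof (rule DERIV_pos_imp_increasing[OF that(3)])
    fix z assume "x \<le> z" "z \<le> y"
    then have "z \<in> ?T" using that by auto
    then show "\<exists>d. DERIV L z :> d \<and> 0 < d" using dL pos by blast
  qed
  have inj: "inj_on L ?T" by (rule linorder_inj_onI) (use mono in force)+
  have cont: "continuous_on ?T L" using dL by (meson DERIV_isCont continuous_at_imp_continuous_on)
  \<comment> \<open>With this choice every \<open>t\<close> with
    \<open>\<bar>t\<bar> < \<epsilon>\<close> is a value of \<open>L\<close> at distance at most 1/2
    from \<open>s0\<close>, well inside the window where \<open>L\<close> is inverted.\<close>
  define \<epsilon> where "\<epsilon> = min (L (s0 + 1/2)) (- L (s0 - 1/2))"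
  have L0: "L s0 = 0" by (simp add: L_def)
  have "0 < L (s0 + 1/2)" "L (s0 - 1/2) < 0"
    using mono[of s0 "s0 + 1/2"] mono[of "s0 - 1/2" s0] L0 by (auto simp: a_def b_def)
  then have \<epsilon>: "0 < \<epsilon>" by (simp add: \<epsilon>_def)
  define S where "S = inv_into ?T L"
  have SL: "S (L x) = x" if "x \<in> ?T" for x using inv_into_f_f[OF inj that] by (simp add: S_def)
  have dS: "(S has_real_derivative 1 / w (S t)) (at t)" if "\<bar>t\<bar> < \<epsilon>" for t
  proof -
    have "\<exists>x\<ge>s0 - 1/2. x \<le> s0 + 1/2 \<and> L x = t"
    proof (rule IVT')
      show "continuous_on {s0 - 1/2..s0 + 1/2} L"
        by (rule continuous_on_subset[OF cont]) (auto simp: a_def b_def)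
    qed (use that in \<open>auto simp: \<epsilon>_def\<close>)
    then obtain x where "s0 - 1/2 \<le> x" "x \<le> s0 + 1/2" "L x = t" by blast
    then have x: "x \<in> ?T" "L x = t" by (simp_all add: a_def b_def)
    have "(S has_derivative (\<lambda>h. h / w x)) (at (L x))"
    proof (rule has_derivative_inverse_strong[OF _ x(1) cont])
      show "(L has_derivative times (w x)) (at x)" using dL[OF x(1)] by (simp add: has_field_derivative_def)
      show "times (w x) \<circ> (\<lambda>h. h / w x) = id" using pos[of x] by (auto simp: fun_eq_iff)
    qed (auto simp: SL)
    moreover have "(\<lambda>h. h / w x) = times (1 / w x)" by auto
    ultimately show ?thesis using SL[OF x(1)] x(2) by (simp add: has_field_derivative_def)
  qed
  show ?thesis
  proof (rule that[OF \<epsilon> _ dS])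
    show "S 0 = s0" using SL[of s0] L0 by (simp add: a_def b_def)
  qed
qed

text \<open>The witness is the graph parametrized by arc length. Its unit tangent is
  \<open>P (S t)\<close>, and differentiating once more brings in the factor \<open>1 / w\<close>
  from \<open>S\<close>.\<close>

lemma chart_has_curvature:
  assumes ch: "chart \<Omega> p r e n g" and q: "q \<in> ball p r" "q \<in> frontier \<Omega>"
  shows "has_curvature \<Omega> q (chart_curvature e g q)"
proof -
  note on = chartD(2)[OF ch] and sm = smooth_realD[OF chartD(3)[OF ch]]
  define s0 where "s0 = q \<bullet> e"
  define w where "w s = sqrt (1 + (deriv g s)\<^sup>2)" for s
  have wpos: "0 < w s" for s unfolding w_def by (rule sqrt_1_plus_sq_pos)
  have w2: "(w s)\<^sup>2 = 1 + (deriv g s)\<^sup>2" for s by (simp add: w_def add_nonneg_nonneg)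
  have wc: "continuous_on UNIV w" unfolding w_def by (intro continuous_intros sm)
  obtain \<epsilon> S where \<epsilon>: "0 < \<epsilon>" and S0: "S 0 = s0"
    and dS: "\<And>t. \<bar>t\<bar> < \<epsilon> \<Longrightarrow> (S has_real_derivative 1 / w (S t)) (at t)"
    by (rule inverse_antiderivative_exists[OF wc wpos, of s0]) blast
  let ?\<gamma> = "graph_map e n g"
  have \<gamma>0: "?\<gamma> s0 = q" unfolding s0_def using chart_frontier[OF ch q(1)] q(2) by (intro graph_map_eqI[OF on]) simp
  define P where "P s = (1 / w s) *\<^sub>R (e + deriv g s *\<^sub>R n)" for s
  define P' where "P' s = (1 / w s) *\<^sub>R (deriv (deriv g) s *\<^sub>R n) +
    (- (deriv g s * deriv (deriv g) s / w s) / (w s)\<^sup>2) *\<^sub>R (e + deriv g s *\<^sub>R n)" for s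
  have dw: "(w has_real_derivative deriv g s * deriv (deriv g) s / w s) (at s)" for s
  proof -
    have "0 < 1 + (deriv g s)\<^sup>2" by (simp add: add_pos_nonneg)
    then show ?thesis unfolding w_def
      by (auto intro!: derivative_eq_intros sm(2) simp: field_simps)
  qed
  have dP: "(P has_vector_derivative P' s) (at s)" for s
  proof -
    have 1: "((\<lambda>s. 1 / w s) has_real_derivative - (deriv g s * deriv (deriv g) s / w s) / (w s)\<^sup>2) (at s)"
      using wpos[of s] dw[of s] by (auto intro!: derivative_eq_intros simp: power2_eq_square)
    have 2: "((\<lambda>s. e + deriv g s *\<^sub>R n) has_vector_derivative deriv (deriv g) s *\<^sub>R n) (at s)"
      using sm(2)[of s] by (auto intro!: derivative_eq_intros simp: has_real_derivative_iff_has_vector_derivative[symmetric])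
    show ?thesis unfolding P_def P'_def
      by (rule has_vector_derivative_scaleR[OF 1 2])
  qed
  have d\<gamma>: "(?\<gamma> has_vector_derivative (e + deriv g s *\<^sub>R n)) (at s)" for s
    unfolding graph_map_def frame_map_def
    using sm(1)[of s] by (auto intro!: derivative_eq_intros)
  define c where "c t = ?\<gamma> (S t)" for t
  define c' where "c' t = P (S t)" for t
  define c'' where "c'' t = (1 / w (S t)) *\<^sub>R P' (S t)" for t
  have dSv: "(S has_vector_derivative 1 / w (S t)) (at t)" if "\<bar>t\<bar> < \<epsilon>" for t
    using dS[OF that] by (simp add: has_real_derivative_iff_has_vector_derivative)
  have dc: "(c has_vector_derivative c' t) (at t)" if "\<bar>t\<bar> < \<epsilon>" for t
    using vector_diff_chain_at[OF dSv[OF that] d\<gamma>] by (simp add: c_def[abs_def] c'_def P_def o_def)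
  have dc': "(c' has_vector_derivative c'' t) (at t)" if "\<bar>t\<bar> < \<epsilon>" for t
    using vector_diff_chain_at[OF dSv[OF that] dP] by (simp add: c'_def[abs_def] c''_def o_def)
  have nc': "norm (c' t) = 1" for t
  proof -
    have "norm (e + deriv g s *\<^sub>R n) = w s" for s
      using orthonormal_pair_inner[OF on] by (simp add: w_def norm_eq_sqrt_inner inner_simps power2_eq_square)
    then show ?thesis using wpos[of "S t"] by (simp add: c'_def P_def)
  qed
  have "continuous (at 0) c" using dc[of 0] \<epsilon> has_vector_derivative_continuous by fastforce
  then have "c \<midarrow>0\<rightarrow> q" by (simp add: continuous_at c_def S0 \<gamma>0)
  then have "\<forall>\<^sub>F t in at 0. c t \<in> ball p r" using q(1) by (intro topological_tendstoD) auto
  then obtain d where d: "0 < d" "\<And>t. t \<noteq> 0 \<Longrightarrow> \<bar>t\<bar> < d \<Longrightarrow> c t \<in> ball p r"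
    by (auto simp: eventually_at dist_real_def)
  have cball: "c t \<in> ball p r" if "\<bar>t\<bar> < d" for t
    using d(2)[of t] that q(1) by (cases "t = 0") (auto simp: c_def S0 \<gamma>0)
  have cf: "c t \<in> frontier \<Omega>" if "\<bar>t\<bar> < d" for t
    using chart_frontier[OF ch cball[OF that]] on by (simp add: c_def)
  let ?\<nu> = "chart_normal e n g q"
  have \<nu>: "is_inner_normal \<Omega> q ?\<nu>" by (rule chart_is_inner_normal[OF ch q])
  have \<nu>1: "norm ?\<nu> = 1" by (rule norm_chart_normal[OF on])
  have c''0: "c'' 0 = chart_curvature e g q *\<^sub>R ?\<nu>"
  proof -
    let ?w = "w s0" and ?g1 = "deriv g s0" and ?g2 = "deriv (deriv g) s0"
    have wp: "0 < ?w" by (rule wpos)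
    \<comment> \<open>Collapses the numerator of the component of \<open>c'' 0\<close> along
      \<open>n\<close> to the second derivative of \<open>g\<close>, after which
      \<open>c'' 0\<close> is visibly a multiple of the normal.\<close>
    have "?w\<^sup>2 - ?g1 * ?g1 = 1" using w2[of s0] by (simp add: power2_eq_square)
    then have n: "?g2 * ?w\<^sup>2 - ?g1 * ?g2 * ?g1 = ?g2" by (metis (no_types, opaque_lifting) mult.assoc mult.commute mult.right_neutral right_diff_distrib)
    have "c'' 0 = (?g2 / ?w\<^sup>2 - ?g1 * ?g2 * ?g1 / ?w ^ 4) *\<^sub>R n - (?g1 * ?g2 / ?w ^ 4) *\<^sub>R e"
      unfolding c''_def P'_def S0 using wp
      by (simp add: scaleR_add_right scaleR_diff_left power2_eq_square power4_eq_xxxx algebra_simps)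
    also have "?g2 / ?w\<^sup>2 - ?g1 * ?g2 * ?g1 / ?w ^ 4 = (?g2 * ?w\<^sup>2 - ?g1 * ?g2 * ?g1) / ?w ^ 4"
      using wp by (simp add: diff_divide_distrib power2_eq_square power4_eq_xxxx)
    also have "\<dots> = ?g2 / ?w ^ 4" unfolding n ..
    also have "(?g2 / ?w ^ 4) *\<^sub>R n - (?g1 * ?g2 / ?w ^ 4) *\<^sub>R e = (?g2 / ?w ^ 3) *\<^sub>R ((1 / ?w) *\<^sub>R (n - ?g1 *\<^sub>R e))"
      by (simp add: scaleR_diff_right power3_eq_cube power4_eq_xxxx mult.commute mult.left_commute)
    finally show ?thesis by (simp add: chart_curvature_def chart_normal_def w_def s0_def)
  qed
  show ?thesis
    unfolding has_curvature_def
  proof (intro exI conjI ballI)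
    show "0 < min \<epsilon> d" using \<epsilon> d by simp
    show "c 0 = q" by (simp add: c_def S0 \<gamma>0)
    fix t assume "t \<in> {- min \<epsilon> d<..<min \<epsilon> d}"
    then have t: "\<bar>t\<bar> < \<epsilon>" "\<bar>t\<bar> < d" by auto
    show "c t \<in> frontier \<Omega>" "norm (c' t) = 1" "(c has_vector_derivative c' t) (at t)" "(c' has_vector_derivative c'' t) (at t)"
      using t cf nc' dc dc' by auto
  next
    show "norm ?\<nu> = 1" by (rule \<nu>1)
    show "?\<nu> \<bullet> c' 0 = 0" using orthonormal_pair_inner[OF on]
      by (simp add: c'_def P_def S0 chart_normal_def inner_simps s0_def)
    have "?\<nu> \<bullet> ?\<nu> > 0" using \<nu>1 by (simp add: norm_eq_1)
    then show "\<forall>\<^sub>F s in at_right 0. q + s *\<^sub>R ?\<nu> \<in> \<Omega>" using \<nu> unfolding is_inner_normal_def by blast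
    show "c'' 0 = chart_curvature e g q *\<^sub>R ?\<nu>" by (rule c''0)
  qed
qed

text \<open>A unit vector of slope \<open>g'\<close> has component 1 / sqrt (1 + g'^2) along
  \<open>e\<close> up to sign; squaring removes the orientation.\<close>

lemma tangent_inner_sq:
  assumes on: "orthonormal_pair e n" and \<tau>: "norm \<tau> = 1" "\<tau> \<bullet> n = deriv g (q \<bullet> e) * (\<tau> \<bullet> e)"
  shows "(\<tau> \<bullet> e)\<^sup>2 = 1 / (sqrt (1 + (deriv g (q \<bullet> e))\<^sup>2))\<^sup>2"
proof -
  have p: "0 < 1 + (deriv g (q \<bullet> e))\<^sup>2" by (simp add: add_pos_nonneg)
  have "1 = (\<tau> \<bullet> e)\<^sup>2 + (\<tau> \<bullet> n)\<^sup>2"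
    using orthonormal_pair_inner_expand[OF on, of \<tau> \<tau>] \<tau>(1) by (simp add: norm_eq_1 power2_eq_square)
  also have "\<dots> = (\<tau> \<bullet> e)\<^sup>2 * (1 + (deriv g (q \<bullet> e))\<^sup>2)"
    unfolding \<tau>(2) by (simp add: power_mult_distrib algebra_simps)
  finally show ?thesis using p by (simp add: field_simps)
qed

text \<open>Any admissible curve satisfies \<open>c t \<bullet> n = g (c t \<bullet> e)\<close> near
  0. Differentiating twice at 0 determines the normal part of the acceleration from \<open>g\<close>
  and the unit tangent.\<close>

lemma has_curvature_chart_unique:
  assumes ch: "chart \<Omega> p r e n g" and q: "q \<in> ball p r" "q \<in> frontier \<Omega>"
    and k: "has_curvature \<Omega> q k"
  shows "k = chart_curvature e g q"
proof -
  note on = chartD(2)[OF ch] and sm = smooth_realD[OF chartD(3)[OF ch]]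
  obtain \<epsilon> c c' c'' m where \<epsilon>: "0 < \<epsilon>" and c0: "c 0 = q"
    and c: "\<And>t. t \<in> {-\<epsilon><..<\<epsilon>} \<Longrightarrow> c t \<in> frontier \<Omega> \<and> norm (c' t) = 1 \<and>
       (c has_vector_derivative c' t) (at t) \<and> (c' has_vector_derivative c'' t) (at t)"
    and m: "norm m = 1" "m \<bullet> c' 0 = 0" "\<forall>\<^sub>F s in at_right 0. q + s *\<^sub>R m \<in> \<Omega>" "c'' 0 = k *\<^sub>R m"
    using k unfolding has_curvature_def by blast
  have c_0: "(c has_vector_derivative c' 0) (at 0)" "(c' has_vector_derivative c'' 0) (at 0)" "norm (c' 0) = 1"
    using c[of 0] \<epsilon> by auto
  have "c \<midarrow>0\<rightarrow> q" using has_vector_derivative_continuous[OF c_0(1)] c0 by (simp add: continuous_at)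
  then have "\<forall>\<^sub>F t in at 0. c t \<in> ball p r" using q(1) by (intro topological_tendstoD) auto
  then obtain d where d: "0 < d" "\<And>t. t \<noteq> 0 \<Longrightarrow> \<bar>t\<bar> < d \<Longrightarrow> c t \<in> ball p r"
    by (auto simp: eventually_at dist_real_def)
  define \<delta> where "\<delta> = min \<epsilon> d"
  have \<delta>: "0 < \<delta>" using \<epsilon> d by (simp add: \<delta>_def)
  have cgraph: "c t \<bullet> n - g (c t \<bullet> e) = 0" if "t \<in> {-\<delta><..<\<delta>}" for t
  proof -
    have "c t \<in> ball p r" using that d(2)[of t] q(1) c0 by (cases "t = 0") (auto simp: \<delta>_def)
    moreover have "c t \<in> frontier \<Omega>" using c[of t] that by (auto simp: \<delta>_def)
    ultimately show ?thesis using chart_frontier[OF ch] by simp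
  qed
  have dci: "((\<lambda>t. c t \<bullet> a) has_real_derivative c' t \<bullet> a) (at t)" "((\<lambda>t. c' t \<bullet> a) has_real_derivative c'' t \<bullet> a) (at t)"
    if "t \<in> {-\<delta><..<\<delta>}" for t a
  proof -
    have "t \<in> {-\<epsilon><..<\<epsilon>}" using that by (auto simp: \<delta>_def)
    from c[OF this] show "((\<lambda>t. c t \<bullet> a) has_real_derivative c' t \<bullet> a) (at t)" "((\<lambda>t. c' t \<bullet> a) has_real_derivative c'' t \<bullet> a) (at t)"
      unfolding has_real_derivative_iff_has_vector_derivative
      by (auto intro: bounded_linear.has_vector_derivative[OF bounded_linear_inner_left])
  qed
  have zero_deriv: "D = 0" if "(h has_real_derivative D) (at t)" "t \<in> {-\<delta><..<\<delta>}" "\<And>t. t \<in> {-\<delta><..<\<delta>} \<Longrightarrow> h t = 0" for h D t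
  proof -
    have "((\<lambda>_. 0) has_real_derivative D) (at t)"
      by (rule has_field_derivative_transform_within_open[OF that(1), of "{-\<delta><..<\<delta>}"]) (use that in auto)
    then show ?thesis using DERIV_const DERIV_unique by blast
  qed
  have first: "c' t \<bullet> n - deriv g (c t \<bullet> e) * (c' t \<bullet> e) = 0" if t: "t \<in> {-\<delta><..<\<delta>}" for t
  proof (rule zero_deriv[OF _ t cgraph])
    show "((\<lambda>t. c t \<bullet> n - g (c t \<bullet> e)) has_real_derivative c' t \<bullet> n - deriv g (c t \<bullet> e) * (c' t \<bullet> e)) (at t)"
      by (intro DERIV_diff dci t DERIV_chain2[OF sm(1)])
  qed
  have z: "(0::real) \<in> {-\<delta><..<\<delta>}" using \<delta> by simp
  let ?g1 = "deriv g (q \<bullet> e)" and ?g2 = "deriv (deriv g) (q \<bullet> e)"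
  have second: "c'' 0 \<bullet> n - (?g1 * (c'' 0 \<bullet> e) + ?g2 * (c' 0 \<bullet> e) * (c' 0 \<bullet> e)) = 0"
  proof (rule zero_deriv[OF _ z first])
    have "((\<lambda>t. deriv g (c t \<bullet> e)) has_real_derivative ?g2 * (c' 0 \<bullet> e)) (at 0)"
      using DERIV_chain2[OF sm(2) dci(1)[OF z, of e]] by (simp add: c0)
    from DERIV_diff[OF dci(2)[OF z, of n] DERIV_mult'[OF this dci(2)[OF z, of e]]]
    show "((\<lambda>t. c' t \<bullet> n - deriv g (c t \<bullet> e) * (c' t \<bullet> e)) has_real_derivative
       c'' 0 \<bullet> n - (?g1 * (c'' 0 \<bullet> e) + ?g2 * (c' 0 \<bullet> e) * (c' 0 \<bullet> e))) (at 0)"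
      by (simp add: c0)
  qed
  define w where "w = sqrt (1 + ?g1\<^sup>2)"
  have w: "0 < w" unfolding w_def by (rule sqrt_1_plus_sq_pos)
  let ?\<nu> = "chart_normal e n g q"
  have w\<nu>: "n - ?g1 *\<^sub>R e = w *\<^sub>R ?\<nu>" using w by (simp add: chart_normal_def w_def)
  have \<nu>: "is_inner_normal \<Omega> q ?\<nu>" by (rule chart_is_inner_normal[OF ch q])
  have f0: "c' 0 \<bullet> n = ?g1 * (c' 0 \<bullet> e)" using first[OF z] c0 by simp
  have "w * (c' 0 \<bullet> ?\<nu>) = c' 0 \<bullet> (n - ?g1 *\<^sub>R e)" unfolding w\<nu> by simp
  also have "\<dots> = 0" using f0 by (simp add: inner_diff_right)
  finally have "c' 0 \<bullet> ?\<nu> = 0" using w by simp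
  then have on': "orthonormal_pair (c' 0) ?\<nu>" using c_0(3) norm_chart_normal[OF on] by (simp add: orthonormal_pair_def)
  \<comment> \<open>Orthogonality to the tangent leaves the normal and its negative; the negative is
    excluded because the ray along \<open>m\<close> enters \<Omega>.\<close>
  have m\<nu>: "m = (m \<bullet> ?\<nu>) *\<^sub>R ?\<nu>" using orthonormal_pair_expand[OF on', of m] m(2) by simp
  have "m \<bullet> ?\<nu> = 1"
  proof -
    have "\<bar>m \<bullet> ?\<nu>\<bar> = 1" using arg_cong[OF m\<nu>, of norm] m(1) norm_chart_normal[OF on] by simp
    then have "m \<bullet> ?\<nu> = 1 \<or> m \<bullet> ?\<nu> = - 1" by linarith
    moreover have False if "m \<bullet> ?\<nu> = - 1"
    proof -
      have "\<forall>\<^sub>F s in at_right 0. q + s *\<^sub>R m \<notin> \<Omega>" using \<nu> that unfolding is_inner_normal_def by auto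
      with m(3) have "\<forall>\<^sub>F s in at_right (0::real). False" by eventually_elim simp
      then show False by simp
    qed
    ultimately show ?thesis by blast
  qed
  then have m\<nu>: "m = ?\<nu>" using m\<nu> by simp
  have "c'' 0 \<bullet> n - ?g1 * (c'' 0 \<bullet> e) = c'' 0 \<bullet> (n - ?g1 *\<^sub>R e)" by (simp add: inner_diff_right)
  also have "\<dots> = k * w"
    unfolding w\<nu> m(4) m\<nu> using norm_chart_normal[OF on, of g q] by (simp add: norm_eq_1)
  finally have kw: "k * w = ?g2 * (c' 0 \<bullet> e)\<^sup>2" using second by (simp add: power2_eq_square algebra_simps)
  have "(c' 0 \<bullet> e)\<^sup>2 = 1 / w\<^sup>2" unfolding w_def by (rule tangent_inner_sq[OF on c_0(3) f0])
  with kw have "k * w = ?g2 / w\<^sup>2" by simp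
  then have "k = ?g2 / w ^ 3" using w by (simp add: field_simps power2_eq_square power3_eq_cube)
  then show ?thesis by (simp add: chart_curvature_def w_def)
qed

lemma curvature_chart:
  assumes "chart \<Omega> p r e n g" "q \<in> ball p r" "q \<in> frontier \<Omega>"
  shows "curvature \<Omega> q = chart_curvature e g q"
  unfolding curvature_def
  using chart_has_curvature[OF assms] has_curvature_chart_unique[OF assms] by (rule the_equality)

section \<open>Asymptotics of the half-plane defect\<close>

lemma smooth_real_taylor:
  assumes "smooth_real g"
  obtains \<xi> where "\<bar>\<xi> - s\<bar> \<le> \<bar>x\<bar>" "g (s + x) = g s + deriv g s * x + deriv (deriv g) \<xi> / 2 * x\<^sup>2"
proof (cases "x = 0")
  case True
  then show ?thesis using that[of s] by simp
next
  case False
  note sm = smooth_realD[OF assms]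
  let ?diff = "\<lambda>m::nat. if m = 0 then g else if m = 1 then deriv g else deriv (deriv g)"
  have "\<exists>t. (if s + x < s then s + x < t \<and> t < s else s < t \<and> t < s + x) \<and>
      g (s + x) = (\<Sum>m<2. ?diff m s / fact m * (s + x - s) ^ m) + ?diff 2 t / fact 2 * (s + x - s)\<^sup>2"
    by (rule Taylor[where a="min s (s + x)" and b="max s (s + x)"]) (use False sm(1,2) in \<open>auto simp: less_2_cases_iff\<close>)
  then obtain t where "if s + x < s then s + x < t \<and> t < s else s < t \<and> t < s + x"
      "g (s + x) = (\<Sum>m<2. ?diff m s / fact m * (s + x - s) ^ m) + ?diff 2 t / fact 2 * (s + x - s)\<^sup>2" by blast
  then show ?thesis by (intro that[of t]) (auto simp: numeral_2_eq_2 split: if_splits)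
qed

lemma chart_normal_inner:
  "sqrt (1 + (deriv g (q \<bullet> e))\<^sup>2) * (z \<bullet> chart_normal e n g q) = z \<bullet> n - deriv g (q \<bullet> e) * (z \<bullet> e)"
  using sqrt_1_plus_sq_pos[of "deriv g (q \<bullet> e)"] by (simp add: chart_normal_def inner_simps)

text \<open>The normal coordinate times \<open>sqrt (1 + g'^2)\<close> is the vertical height above
  the tangent line. Membership therefore compares this height with the remainder of \<open>g\<close>
  after its linear part.\<close>

lemma chart_mem_iff_normal:
  assumes ch: "chart \<Omega> p r e n g" and q: "q \<in> ball p r" "q \<in> frontier \<Omega>" and z: "q + z \<in> ball p r"
  shows "q + z \<in> \<Omega> \<longleftrightarrow>
    g (q \<bullet> e + z \<bullet> e) - g (q \<bullet> e) - deriv g (q \<bullet> e) * (z \<bullet> e) <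
      sqrt (1 + (deriv g (q \<bullet> e))\<^sup>2) * (z \<bullet> inner_normal \<Omega> q)"
  using chart_mem[OF ch z] chart_frontier[OF ch q(1)] q(2)
  unfolding inner_normal_chart[OF ch q] chart_normal_inner by (auto simp: inner_add_left)

text \<open>Close to \<open>q\<close>, the normal coordinate of a mismatched point is controlled by
  the quadratic Taylor remainder. Far from \<open>q\<close>, the trivial bound by |z| is itself at
  most a multiple of |z|^2. Compactness of the frontier makes the constant uniform.\<close>

lemma defect_region_bound:
  assumes reg: "regular_set \<Omega>"
  obtains C where "0 < C" "\<And>q z. q \<in> frontier \<Omega> \<Longrightarrow> z \<in> mismatch \<Omega> q \<Longrightarrow>
    \<bar>z \<bullet> inner_normal \<Omega> q\<bar> \<le> C * (norm z)\<^sup>2"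
proof -
  have "\<exists>\<rho>>0. \<exists>C\<ge>0. \<forall>q\<in>frontier \<Omega> \<inter> ball p \<rho>. \<forall>z. z \<in> mismatch \<Omega> q \<longrightarrow>
      \<bar>z \<bullet> inner_normal \<Omega> q\<bar> \<le> C * (norm z)\<^sup>2" if p: "p \<in> frontier \<Omega>" for p
  proof -
    obtain r e n g where ch: "chart \<Omega> p r e n g" by (rule regular_set_chart[OF reg p])
    note r = chartD(1)[OF ch] and on = chartD(2)[OF ch] and sm = smooth_realD[OF chartD(3)[OF ch]]
    obtain B where B: "\<And>s. s \<in> {p \<bullet> e - r..p \<bullet> e + r} \<Longrightarrow> \<bar>deriv (deriv g) s\<bar> \<le> B"
      by (rule continuous_on_UNIV_Icc_bound[OF sm(5)]) blast
    have B0: "0 \<le> B" using B[of "p \<bullet> e"] r by force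
    \<comment> \<open>\<open>B\<close> serves the points with |z| < r/2, for which
      \<open>q + z\<close> stays in the chart ball because \<open>q\<close> is in the half ball;
      \<open>2 / r\<close> serves the others.\<close>
    define C where "C = B + 2 / r"
    have C: "B \<le> C" "2 / r \<le> C" "0 \<le> C" using B0 r by (auto simp: C_def)
    have "\<bar>z \<bullet> inner_normal \<Omega> q\<bar> \<le> C * (norm z)\<^sup>2"
      if q: "q \<in> frontier \<Omega>" "q \<in> ball p (r/2)" and xor: "z \<in> mismatch \<Omega> q" for q z
    proof (cases "norm z < r/2")
      case True
      have qb: "q \<in> ball p r" using q r by auto
      have "dist p (q + z) \<le> dist p q + norm z" using dist_triangle[of p "q + z" q] by (simp add: dist_norm)
      then have qz: "q + z \<in> ball p r" using q True by simp
      let ?s = "q \<bullet> e" and ?x = "z \<bullet> e" and ?t = "z \<bullet> inner_normal \<Omega> q"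
      let ?w = "sqrt (1 + (deriv g ?s)\<^sup>2)"
      have w: "1 \<le> ?w" by simp
      obtain \<xi> where \<xi>: "\<bar>\<xi> - ?s\<bar> \<le> \<bar>?x\<bar>" "g (?s + ?x) = g ?s + deriv g ?s * ?x + deriv (deriv g) \<xi> / 2 * ?x\<^sup>2"
        by (rule smooth_real_taylor[OF chartD(3)[OF ch]])
      have x: "\<bar>?x\<bar> \<le> norm z" by (rule orthonormal_pair_abs_inner_le[OF on])
      have "\<bar>(q - p) \<bullet> e\<bar> \<le> norm (q - p)" by (rule orthonormal_pair_abs_inner_le[OF on])
      then have "\<bar>?s - p \<bullet> e\<bar> < r/2" using q by (simp add: dist_norm norm_minus_commute inner_diff_left)
      then have "\<bar>\<xi> - p \<bullet> e\<bar> \<le> r" using \<xi>(1) x True by arith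
      then have "\<bar>deriv (deriv g) \<xi>\<bar> \<le> B" by (intro B) (simp add: abs_le_iff)
      then have "\<bar>deriv (deriv g) \<xi> / 2 * ?x\<^sup>2\<bar> \<le> B / 2 * (norm z)\<^sup>2"
        using x by (simp add: abs_mult) (intro mult_mono, auto simp: abs_le_square_iff[symmetric])
      \<comment> \<open>Thus the height \<open>?w * ?t\<close> lies between 0 and the Taylor
        remainder, endpoints included.\<close>
      moreover have "(deriv (deriv g) \<xi> / 2 * ?x\<^sup>2 < ?w * ?t) \<noteq> (0 < ?t)"
        using xor chart_mem_iff_normal[OF ch qb q(1) qz] \<xi>(2) by (simp add: mismatch_def)
      moreover have "?w * ?t > 0 \<longleftrightarrow> ?t > 0"
        using sqrt_1_plus_sq_pos[of "deriv g ?s"] by (metis mult_pos_pos zero_less_mult_pos)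
      ultimately have "\<bar>?w * ?t\<bar> \<le> B / 2 * (norm z)\<^sup>2" by (auto simp: abs_le_iff)
      moreover have "\<bar>?t\<bar> \<le> \<bar>?w * ?t\<bar>" using w by (simp add: abs_mult mult_le_cancel_right1)
      moreover have "B / 2 * (norm z)\<^sup>2 \<le> C * (norm z)\<^sup>2" using C B0 by (intro mult_right_mono) auto
      ultimately show ?thesis by linarith
    next
      case False
      have "\<bar>z \<bullet> inner_normal \<Omega> q\<bar> \<le> norm z * norm (inner_normal \<Omega> q)" by (rule Cauchy_Schwarz_ineq2)
      also have "\<dots> = norm z" using regular_set_inner_normal(2)[OF reg q(1)] by simp
      also have "\<dots> \<le> norm z * (2 / r * norm z)" 
      proof -
        have "1 \<le> 2 / r * norm z" using False r by (simp add: field_simps)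
        from mult_left_mono[OF this norm_ge_zero[of z]] show ?thesis by simp
      qed
      also have "\<dots> = 2 / r * (norm z)\<^sup>2" by (simp add: power2_eq_square)
      also have "\<dots> \<le> C * (norm z)\<^sup>2" using C by (intro mult_right_mono) auto
      finally show ?thesis .
    qed
    then have "\<forall>q\<in>frontier \<Omega> \<inter> ball p (r/2). \<forall>z. z \<in> mismatch \<Omega> q \<longrightarrow>
      \<bar>z \<bullet> inner_normal \<Omega> q\<bar> \<le> C * (norm z)\<^sup>2" by blast
    moreover have "0 < r/2" using r by simp
    ultimately show ?thesis using C(3) by blast
  qed
  then obtain \<rho> C where \<rho>: "\<And>p. p \<in> frontier \<Omega> \<Longrightarrow> 0 < \<rho> p" and C0: "\<And>p. p \<in> frontier \<Omega> \<Longrightarrow> 0 \<le> C p"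
    and C: "\<And>p q z. p \<in> frontier \<Omega> \<Longrightarrow> q \<in> frontier \<Omega> \<inter> ball p (\<rho> p) \<Longrightarrow> z \<in> mismatch \<Omega> q \<Longrightarrow>
      \<bar>z \<bullet> inner_normal \<Omega> q\<bar> \<le> C p * (norm z)\<^sup>2" by metis
  have "compact (frontier \<Omega>)" using reg by (simp add: regular_set_def compact_frontier_bounded)
  then obtain I where I: "I \<subseteq> frontier \<Omega>" "finite I" "frontier \<Omega> \<subseteq> (\<Union>p\<in>I. ball p (\<rho> p))"
    by (rule compactE_image[where C="frontier \<Omega>" and f="\<lambda>p. ball p (\<rho> p)"]) (use \<rho> in force)+
  show ?thesis
  \<comment> \<open>The sum of nonnegative local constants dominates each of them, and the added 1
    makes the result strictly positive.\<close>
  proof (rule that[of "1 + sum C I"])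
    have "0 \<le> sum C I" using I C0 by (intro sum_nonneg) auto
    then show "0 < 1 + sum C I" by simp
    fix q z assume q: "q \<in> frontier \<Omega>" and xor: "z \<in> mismatch \<Omega> q"
    obtain p where p: "p \<in> I" "q \<in> ball p (\<rho> p)" using I(3) q by blast
    have "\<bar>z \<bullet> inner_normal \<Omega> q\<bar> \<le> C p * (norm z)\<^sup>2" using C[of p q z] p q xor I(1) by auto
    also have "\<dots> \<le> (1 + sum C I) * (norm z)\<^sup>2"
      using I C0 member_le_sum[of p I C] p by (intro mult_right_mono) force+
    finally show "\<bar>z \<bullet> inner_normal \<Omega> q\<bar> \<le> (1 + sum C I) * (norm z)\<^sup>2" .
  qed
qed

text \<open>The defect integrand at the point with frame coordinates \<open>u / \<mu>\<close> and
  \<open>v / \<mu>\<^sup>2\<close>. No power of \<mu> stands in front because |z . nu| and |z|^2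
  both scale like \<open>1 / \<mu>\<^sup>2\<close>; the square root is \<mu> |z|.\<close>

definition scaled_defect_integrand :: "(real^2) set \<Rightarrow> real^2 \<Rightarrow> real^2 \<Rightarrow> real \<Rightarrow> real \<times> real \<Rightarrow> real" where
  "scaled_defect_integrand \<Omega> q \<tau> \<mu> = (\<lambda>(u, v).
     (if (q + frame_map \<tau> (inner_normal \<Omega> q) (u / \<mu>, v / \<mu>\<^sup>2) \<in> \<Omega>) \<noteq> (0 < v)
      then \<bar>v\<bar> / (u\<^sup>2 + (v / \<mu>)\<^sup>2) * exp (- sqrt (u\<^sup>2 + (v / \<mu>)\<^sup>2)) else 0))"

lemma borel_measurable_scaled_defect_integrand:
  assumes "regular_set \<Omega>"
  shows "scaled_defect_integrand \<Omega> q \<tau> \<mu> \<in> borel_measurable (lborel \<Otimes>\<^sub>M lborel)"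
proof -
  have [measurable]: "\<Omega> \<in> sets borel" using assms by (simp add: regular_set_def)
  have "scaled_defect_integrand \<Omega> q \<tau> \<mu> \<in> borel_measurable (borel \<Otimes>\<^sub>M borel)"
    unfolding scaled_defect_integrand_def by measurable
  then show ?thesis by simp
qed

text \<open>The factor \<open>\<mu> ^ 3\<close> cancels the Jacobian 1/mu times 1/mu^2 of the
  parabolic scaling. Nonnegative integrals carry the substitution, so it is valid before
  integrability is established.\<close>

lemma half_plane_defect_scaled:
  assumes reg: "regular_set \<Omega>" and \<mu>: "0 < \<mu>" and q: "q \<in> frontier \<Omega>"
    and on: "orthonormal_pair \<tau> (inner_normal \<Omega> q)"
  shows "\<mu> ^ 3 * half_plane_defect \<Omega> \<mu> q = (\<integral>p. scaled_defect_integrand \<Omega> q \<tau> \<mu> p \<partial>(lborel \<Otimes>\<^sub>M lborel))"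
proof -
  let ?\<nu> = "inner_normal \<Omega> q"
  have [measurable]: "\<Omega> \<in> sets borel" using reg by (simp add: regular_set_def)
  define F where "F z = indicator (mismatch \<Omega> q) z * tangent_kernel \<mu> ?\<nu> z" for z
  have [measurable]: "F \<in> borel_measurable borel" unfolding F_def using borel_mismatch[OF reg] by measurable
  note [measurable] = borel_measurable_scaled_defect_integrand[OF reg]
  have F0: "0 \<le> F z" for z by (simp add: F_def)
  have eqF: "F (frame_map \<tau> ?\<nu> (u / \<mu>, v / \<mu>\<^sup>2)) = scaled_defect_integrand \<Omega> q \<tau> \<mu> (u, v)" for u v
  proof -
    have 1: "(u / \<mu>)\<^sup>2 + (v / \<mu>\<^sup>2)\<^sup>2 = (u\<^sup>2 + (v / \<mu>)\<^sup>2) / \<mu>\<^sup>2"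
      using \<mu> by (simp add: power_divide add_divide_distrib power2_eq_square)
    have 2: "norm (frame_map \<tau> ?\<nu> (u / \<mu>, v / \<mu>\<^sup>2)) = sqrt (u\<^sup>2 + (v / \<mu>)\<^sup>2) / \<mu>"
      unfolding norm_frame_map[OF on] 1 using \<mu> by (simp add: real_sqrt_divide)
    have 3: "(sqrt (u\<^sup>2 + (v / \<mu>)\<^sup>2) / \<mu>)\<^sup>2 = (u\<^sup>2 + (v / \<mu>)\<^sup>2) / \<mu>\<^sup>2" by (simp add: power_divide)
    have 4: "0 < v / \<mu>\<^sup>2 \<longleftrightarrow> 0 < v" using \<mu> by (simp add: zero_less_divide_iff)
    have 5: "\<bar>v / \<mu>\<^sup>2\<bar> / ((u\<^sup>2 + (v / \<mu>)\<^sup>2) / \<mu>\<^sup>2) = \<bar>v\<bar> / (u\<^sup>2 + (v / \<mu>)\<^sup>2)" using \<mu> by simp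
    show ?thesis
      unfolding F_def tangent_kernel_def scaled_defect_integrand_def prod.case 2 3 frame_map_inner[OF on] snd_conv 5
      using \<mu> 4 by (simp add: mismatch_def indicator_def frame_map_inner[OF on])
  qed
  have nn: "ennreal (\<mu> ^ 3) * (\<integral>\<^sup>+z. ennreal (F z) \<partial>lborel) =
      (\<integral>\<^sup>+p. ennreal (scaled_defect_integrand \<Omega> q \<tau> \<mu> p) \<partial>(lborel \<Otimes>\<^sub>M lborel))"
  proof -
    have "(\<integral>\<^sup>+z. ennreal (F z) \<partial>lborel) = (\<integral>\<^sup>+s. \<integral>\<^sup>+t. ennreal (F (frame_map \<tau> ?\<nu> (s, t))) \<partial>lborel \<partial>lborel)"
      by (rule nn_integral_frame[OF on]) simp
    also have "\<dots> = ennreal (1 / \<mu>) * (\<integral>\<^sup>+u. \<integral>\<^sup>+t. ennreal (F (frame_map \<tau> ?\<nu> (u / \<mu>, t))) \<partial>lborel \<partial>lborel)"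
      using \<mu> by (subst nn_integral_real_affine[of _ "1 / \<mu>" 0]) auto
    also have "\<dots> = ennreal (1 / \<mu>) * (\<integral>\<^sup>+u. ennreal (1 / \<mu>\<^sup>2) * (\<integral>\<^sup>+v. ennreal (F (frame_map \<tau> ?\<nu> (u / \<mu>, v / \<mu>\<^sup>2))) \<partial>lborel) \<partial>lborel)"
    proof -
      have "(\<integral>\<^sup>+t. ennreal (F (frame_map \<tau> ?\<nu> (u / \<mu>, t))) \<partial>lborel) =
        ennreal (1 / \<mu>\<^sup>2) * (\<integral>\<^sup>+v. ennreal (F (frame_map \<tau> ?\<nu> (u / \<mu>, v / \<mu>\<^sup>2))) \<partial>lborel)" for u
        using \<mu> by (subst nn_integral_real_affine[of _ "1 / \<mu>\<^sup>2" 0]) auto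
      then show ?thesis by simp
    qed
    also have "\<dots> = ennreal (1 / \<mu>) * (ennreal (1 / \<mu>\<^sup>2) * (\<integral>\<^sup>+u. \<integral>\<^sup>+v. ennreal (F (frame_map \<tau> ?\<nu> (u / \<mu>, v / \<mu>\<^sup>2))) \<partial>lborel \<partial>lborel))"
      by (subst nn_integral_cmult) auto
    also have "\<dots> = ennreal (1 / \<mu>) * (ennreal (1 / \<mu>\<^sup>2) * (\<integral>\<^sup>+p. ennreal (scaled_defect_integrand \<Omega> q \<tau> \<mu> p) \<partial>(lborel \<Otimes>\<^sub>M lborel)))"
      unfolding eqF by (subst lborel.nn_integral_fst[symmetric]) auto
    finally show ?thesis
      using \<mu> by (simp add: mult.assoc[symmetric] ennreal_mult[symmetric] power2_eq_square power3_eq_cube)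
  qed
  have "half_plane_defect \<Omega> \<mu> q = enn2real (\<integral>\<^sup>+z. ennreal (F z) \<partial>lborel)"
    unfolding half_plane_defect_def F_def[symmetric] by (rule integral_eq_nn_integral) (auto simp: F0)
  then have "\<mu> ^ 3 * half_plane_defect \<Omega> \<mu> q = enn2real (ennreal (\<mu> ^ 3) * (\<integral>\<^sup>+z. ennreal (F z) \<partial>lborel))"
    using \<mu> by (simp add: enn2real_mult)
  also have "\<dots> = (\<integral>p. scaled_defect_integrand \<Omega> q \<tau> \<mu> p \<partial>(lborel \<Otimes>\<^sub>M lborel))"
    unfolding nn by (rule integral_eq_nn_integral[symmetric]) (auto simp: scaled_defect_integrand_def split_beta')
  finally show ?thesis .
qed

section \<open>An integrable majorant independent of \<mu> and of the boundary point\<close>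

lemma integrable_inverse_1_plus_sq:
  fixes a :: real
  assumes "0 < a"
  shows "integrable lborel (\<lambda>v. 1 / (1 + (a * v)\<^sup>2))"
proof (rule integrableI_nonneg)
  have p: "0 < 1 + (a * v)\<^sup>2" for v by (simp add: add_pos_nonneg)
  have "(\<integral>\<^sup>+v. ennreal (1 / (1 + (a * v)\<^sup>2)) * indicator {0..} v \<partial>lborel) = ennreal (pi / 2 / a - arctan (a * 0) / a)"
  proof (rule nn_integral_FTC_atLeast)
    show "DERIV (\<lambda>v. arctan (a * v) / a) v :> 1 / (1 + (a * v)\<^sup>2)" for v
    proof -
      have "DERIV (\<lambda>v. arctan (a * v) / a) v :> inverse (1 + (a * v)\<^sup>2) * a / a"
        by (auto intro!: derivative_eq_intros)
      then show ?thesis using assms by (simp add: inverse_eq_divide)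
    qed
    have "LIM v at_top. a * v :> at_top"
      using assms by (intro filterlim_tendsto_pos_mult_at_top[OF tendsto_const _ filterlim_ident])
    then show "((\<lambda>v. arctan (a * v) / a) \<longlongrightarrow> pi / 2 / a) at_top"
      using assms by (intro tendsto_divide tendsto_const filterlim_compose[OF tendsto_arctan_at_top]) auto
  qed (use p in \<open>auto intro: less_imp_le\<close>)
  then show "(\<integral>\<^sup>+v. ennreal (1 / (1 + (a * v)\<^sup>2)) \<partial>lborel) < \<infinity>"
    by (subst nn_integral_even) (auto simp: ennreal_mult_less_top)
qed (auto intro: add_nonneg_nonneg)

lemma integrable_exp_abs: "0 < c \<Longrightarrow> integrable lborel (\<lambda>s::real. exp (- (c * \<bar>s\<bar>)))"
  by (rule integrableI_nonneg) (auto simp: nn_integral_exp_abs)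

lemma integrable_lborel_product:
  fixes f g :: "real \<Rightarrow> real"
  assumes f: "integrable lborel f" and g: "integrable lborel g"
  shows "integrable (lborel \<Otimes>\<^sub>M lborel) (\<lambda>(u, v). f u * g v)"
proof (rule lborel_pair.Fubini_integrable)
  have [measurable]: "f \<in> borel_measurable borel" "g \<in> borel_measurable borel" using f g by auto
  show "(\<lambda>(u, v). f u * g v) \<in> borel_measurable (lborel \<Otimes>\<^sub>M lborel)" by measurable
  show "integrable lborel (\<lambda>u. \<integral>v. norm (case (u, v) of (u, v) \<Rightarrow> f u * g v) \<partial>lborel)"
    using f by (simp add: abs_mult)
qed (use g in simp)

text \<open>A product of integrable functions of \<open>u\<close> and \<open>v\<close>. The factor
  \<open>C\<close> bounds the quotient |z . nu| / |z|^2, half of the exponential gives the decay in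
  \<open>u\<close>, and the other half gives the decay in \<open>v\<close> through
  \<open>exp_neg_half_le\<close>.\<close>

definition defect_majorant :: "real \<Rightarrow> real \<times> real \<Rightarrow> real" where
  "defect_majorant C = (\<lambda>(u, v). C * exp (- (1 / 2 * \<bar>u\<bar>)) * (1 / (1 + (1 / (64 * C) * v)\<^sup>2)))"

lemma integrable_defect_majorant:
  assumes "0 < C"
  shows "integrable (lborel \<Otimes>\<^sub>M lborel) (defect_majorant C)"
  unfolding defect_majorant_def
  by (intro integrable_lborel_product integrable_inverse_1_plus_sq integrable_mult_right integrable_exp_abs)
    (use assms in auto)

text \<open>With \<open>y = P / 8\<close>, exp (P / 2) is the fourth power of exp y, hence at least
  1 + y^4. The hypothesis says that v / (64 C) is at most y^2 in absolute value, which is the origin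
  of 64.\<close>

lemma exp_neg_half_le:
  fixes P v C :: real
  assumes C: "0 < C" and P: "0 \<le> P" and v: "\<bar>v\<bar> \<le> C * P\<^sup>2"
  shows "exp (- (P / 2)) \<le> 1 / (1 + (1 / (64 * C) * v)\<^sup>2)"
proof -
  define y where "y = P / 8"
  have y: "0 \<le> y" using P by (simp add: y_def)
  have "1 + y ^ 4 \<le> (1 + y) ^ 4"
  proof -
    have "(1 + y) ^ 4 = 1 + y ^ 4 + (4 * y + 6 * y\<^sup>2 + 4 * y ^ 3)"
      by (simp add: power4_eq_xxxx power2_eq_square power3_eq_cube algebra_simps)
    then show ?thesis using y by simp
  qed
  also have "\<dots> \<le> exp y ^ 4" using y by (intro power_mono) auto
  also have "\<dots> = exp (P / 2)" by (simp add: y_def exp_of_nat_mult[symmetric])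
  finally have 1: "1 + y ^ 4 \<le> exp (P / 2)" .
  have "\<bar>1 / (64 * C) * v\<bar> \<le> y\<^sup>2" using v C by (simp add: y_def abs_mult field_simps power2_eq_square)
  then have "(1 / (64 * C) * v)\<^sup>2 \<le> (y\<^sup>2)\<^sup>2" by (rule power2_le_iff_abs_le[THEN iffD2, rotated]) simp
  also have "(y\<^sup>2)\<^sup>2 = y ^ 4" by simp
  finally have 2: "1 + (1 / (64 * C) * v)\<^sup>2 \<le> exp (P / 2)" using 1 by linarith
  have "0 < 1 + (1 / (64 * C) * v)\<^sup>2" by (simp add: add_pos_nonneg)
  then have "inverse (exp (P / 2)) \<le> inverse (1 + (1 / (64 * C) * v)\<^sup>2)" using 2 by (intro le_imp_inverse_le)
  then show ?thesis by (simp add: exp_minus inverse_eq_divide)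
qed

text \<open>Here \<open>P\<close> is \<mu> |z|. On the mismatch set, quadratic contact becomes
  \<open>\<bar>v\<bar> \<le> C * P\<^sup>2\<close>: this bounds the quotient and lets decay in
  \<open>P\<close> act as decay in \<open>v\<close>, although \<open>P\<close> controls
  \<open>v\<close> itself only through \<open>v / \<mu>\<close>.\<close>

lemma scaled_defect_integrand_le:
  assumes C: "0 < C" and bound: "\<And>z. z \<in> mismatch \<Omega> q \<Longrightarrow> \<bar>z \<bullet> inner_normal \<Omega> q\<bar> \<le> C * (norm z)\<^sup>2"
    and on: "orthonormal_pair \<tau> (inner_normal \<Omega> q)" and \<mu>: "0 < \<mu>"
  shows "norm (scaled_defect_integrand \<Omega> q \<tau> \<mu> p) \<le> defect_majorant C p"
proof -
  obtain u v where p: "p = (u, v)" by (cases p)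
  let ?z = "frame_map \<tau> (inner_normal \<Omega> q) (u / \<mu>, v / \<mu>\<^sup>2)"
  define P where "P = sqrt (u\<^sup>2 + (v / \<mu>)\<^sup>2)"
  have P: "0 \<le> P" "P\<^sup>2 = u\<^sup>2 + (v / \<mu>)\<^sup>2" by (auto simp: P_def)
  have D0: "0 \<le> defect_majorant C (u, v)" using C by (simp add: defect_majorant_def add_nonneg_nonneg)
  show ?thesis
  proof (cases "(q + ?z \<in> \<Omega>) \<noteq> (0 < v)")
    case True
    have zn: "?z \<bullet> inner_normal \<Omega> q = v / \<mu>\<^sup>2" using on by simp
    have "(norm ?z)\<^sup>2 = P\<^sup>2 / \<mu>\<^sup>2"
      unfolding norm_frame_map[OF on] P(2) using \<mu> by (simp add: power_divide add_divide_distrib power2_eq_square)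
    moreover have "?z \<in> mismatch \<Omega> q"
      unfolding mismatch_def mem_Collect_eq zn using True \<mu> by (simp add: zero_less_divide_iff)
    ultimately have "\<bar>v / \<mu>\<^sup>2\<bar> \<le> C * (P\<^sup>2 / \<mu>\<^sup>2)" using bound[of ?z] unfolding zn by simp
    then have v: "\<bar>v\<bar> \<le> C * P\<^sup>2" using \<mu> by (simp add: divide_le_cancel)
    have s: "norm (scaled_defect_integrand \<Omega> q \<tau> \<mu> p) = \<bar>v\<bar> / P\<^sup>2 * exp (- P)"
      using True unfolding p scaled_defect_integrand_def P(2) by (simp add: P_def)
    have "\<bar>v\<bar> / P\<^sup>2 \<le> C" using v C by (cases "P = 0") (auto simp: divide_le_eq)
    then have "\<bar>v\<bar> / P\<^sup>2 * exp (- P) \<le> C * exp (- P)" by (intro mult_right_mono) auto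
    also have "\<dots> = C * (exp (- (1 / 2 * P)) * exp (- (P / 2)))" by (simp add: exp_add[symmetric])
    also have "\<dots> \<le> C * (exp (- (1 / 2 * \<bar>u\<bar>)) * (1 / (1 + (1 / (64 * C) * v)\<^sup>2)))"
    proof (intro mult_left_mono mult_mono exp_neg_half_le C P v)
      have "\<bar>u\<bar> \<le> P" unfolding P_def by (rule real_le_rsqrt) simp
      then show "exp (- (1 / 2 * P)) \<le> exp (- (1 / 2 * \<bar>u\<bar>))" by simp
    qed (use C in auto)
    also have "\<dots> = defect_majorant C p" by (simp add: p defect_majorant_def)
    finally show ?thesis unfolding s .
  next
    case False
    then show ?thesis using D0 by (simp add: p scaled_defect_integrand_def)
  qed
qed

text \<open>Multiplied by \<open>\<mu>\<^sup>2\<close>, the membership condition compares the Taylor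
  remainder, which converges to \<open>w\<close> times the height of the osculating parabola, with
  \<open>w * v\<close>. Off the parabola the limiting inequality is strict and therefore holds for
  all large \<mu>.\<close>

lemma chart_mem_scaled_eventually:
  assumes ch: "chart \<Omega> q r e n g" and q: "q \<in> frontier \<Omega>"
    and on': "orthonormal_pair \<tau> (inner_normal \<Omega> q)" and v: "v \<noteq> chart_curvature e g q * u\<^sup>2 / 2"
  shows "\<forall>\<^sub>F \<mu> in at_top. q + frame_map \<tau> (inner_normal \<Omega> q) (u / \<mu>, v / \<mu>\<^sup>2) \<in> \<Omega> \<longleftrightarrow>
    chart_curvature e g q * u\<^sup>2 / 2 < v"
proof -
  note on = chartD(2)[OF ch] and sm = smooth_realD[OF chartD(3)[OF ch]]
  have qb: "q \<in> ball q r" using chartD(1)[OF ch] by simp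
  let ?\<nu> = "inner_normal \<Omega> q" and ?s = "q \<bullet> e"
  let ?g1 = "deriv g ?s" and ?g2 = "deriv (deriv g) ?s"
  define w where "w = sqrt (1 + ?g1\<^sup>2)"
  have w: "0 < w" unfolding w_def by (rule sqrt_1_plus_sq_pos)
  define z where "z \<mu> = frame_map \<tau> ?\<nu> (u / \<mu>, v / \<mu>\<^sup>2)" for \<mu>
  define x where "x \<mu> = z \<mu> \<bullet> e" for \<mu>
  have iv: "((\<lambda>\<mu>::real. c / \<mu>) \<longlongrightarrow> 0) at_top" for c :: real
    by (rule tendsto_divide_0[OF tendsto_const filterlim_at_top_imp_at_infinity[OF filterlim_ident]])
  have iv2: "((\<lambda>\<mu>::real. c / \<mu>\<^sup>2) \<longlongrightarrow> 0) at_top" for c :: real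
    by (rule tendsto_divide_0[OF tendsto_const filterlim_at_top_imp_at_infinity[OF filterlim_pow_at_top[OF _ filterlim_ident]]]) simp
  have z0: "(z \<longlongrightarrow> 0) at_top"
    unfolding z_def frame_map_def prod.case by (rule tendsto_eq_intros iv iv2 refl)+ simp
  have x0: "(x \<longlongrightarrow> 0) at_top"
    unfolding x_def using tendsto_inner[OF z0 tendsto_const[of e]] by simp
  \<comment> \<open>The normal displacement has order \<open>1 / \<mu>\<^sup>2\<close>, so it does
    not affect the limit of \<mu> times the chart abscissa.\<close>
  have "((\<lambda>\<mu>. u * (\<tau> \<bullet> e) + v / \<mu> * (?\<nu> \<bullet> e)) \<longlongrightarrow> u * (\<tau> \<bullet> e) + 0 * (?\<nu> \<bullet> e)) at_top"
    by (intro tendsto_intros iv)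
  moreover have "\<forall>\<^sub>F \<mu> in at_top. u * (\<tau> \<bullet> e) + v / \<mu> * (?\<nu> \<bullet> e) = \<mu> * x \<mu>"
    using eventually_gt_at_top[of 0]
    by eventually_elim (simp add: x_def z_def frame_map_def inner_simps field_simps power2_eq_square)
  ultimately have \<mu>x: "((\<lambda>\<mu>. \<mu> * x \<mu>) \<longlongrightarrow> u * (\<tau> \<bullet> e)) at_top"
    by (auto intro: Lim_transform_eventually)
  have \<tau>e: "(\<tau> \<bullet> e)\<^sup>2 = 1 / w\<^sup>2"
  proof -
    have "\<tau> \<bullet> ?\<nu> = 0" using orthonormal_pair_inner[OF on'] by simp
    then have f0: "\<tau> \<bullet> n = ?g1 * (\<tau> \<bullet> e)"
      using chart_normal_inner[of g q e \<tau> n] inner_normal_chart[OF ch qb q] by simp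
    show ?thesis unfolding w_def using on' by (intro tangent_inner_sq[OF on _ f0]) (simp add: orthonormal_pair_def)
  qed
  have "\<exists>\<xi>. \<bar>\<xi> - ?s\<bar> \<le> \<bar>y\<bar> \<and> g (?s + y) = g ?s + ?g1 * y + deriv (deriv g) \<xi> / 2 * y\<^sup>2" for y
    by (rule smooth_real_taylor[OF chartD(3)[OF ch]]) blast
  then obtain \<xi> where \<xi>: "\<And>y. \<bar>\<xi> y - ?s\<bar> \<le> \<bar>y\<bar>"
    "\<And>y. g (?s + y) = g ?s + ?g1 * y + deriv (deriv g) (\<xi> y) / 2 * y\<^sup>2" by metis
  have "((\<lambda>\<mu>. \<xi> (x \<mu>) - ?s) \<longlongrightarrow> 0) at_top"
    by (rule Lim_null_comparison[OF _ tendsto_rabs_zero[OF x0]]) (use \<xi>(1) in auto)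
  then have "((\<lambda>\<mu>. \<xi> (x \<mu>)) \<longlongrightarrow> ?s) at_top" by (simp add: Lim_null[symmetric])
  moreover have "isCont (deriv (deriv g)) ?s" using sm(5) by (simp add: continuous_on_eq_continuous_at)
  ultimately have "((\<lambda>\<mu>. deriv (deriv g) (\<xi> (x \<mu>))) \<longlongrightarrow> ?g2) at_top" by (rule isCont_tendsto_compose[rotated])
  then have "((\<lambda>\<mu>. deriv (deriv g) (\<xi> (x \<mu>)) / 2 * (\<mu> * x \<mu>)\<^sup>2) \<longlongrightarrow> ?g2 / 2 * (u * (\<tau> \<bullet> e))\<^sup>2) at_top"
    by (intro tendsto_intros \<mu>x) auto
  also have "?g2 / 2 * (u * (\<tau> \<bullet> e))\<^sup>2 = w * (chart_curvature e g q * u\<^sup>2 / 2)"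
  proof -
    have "chart_curvature e g q = ?g2 / w ^ 3" by (simp add: chart_curvature_def w_def)
    then show ?thesis
      unfolding power_mult_distrib \<tau>e using w by (simp add: field_simps power2_eq_square power3_eq_cube)
  qed
  finally have lim: "((\<lambda>\<mu>. deriv (deriv g) (\<xi> (x \<mu>)) / 2 * (\<mu> * x \<mu>)\<^sup>2) \<longlongrightarrow> w * (chart_curvature e g q * u\<^sup>2 / 2)) at_top" .
  have "((\<lambda>\<mu>. q + z \<mu>) \<longlongrightarrow> q + 0) at_top" by (intro tendsto_intros z0)
  then have ball: "\<forall>\<^sub>F \<mu> in at_top. q + z \<mu> \<in> ball q r" using qb by (intro topological_tendstoD) auto
  have iff: "\<forall>\<^sub>F \<mu> in at_top. q + z \<mu> \<in> \<Omega> \<longleftrightarrow> deriv (deriv g) (\<xi> (x \<mu>)) / 2 * (\<mu> * x \<mu>)\<^sup>2 < w * v"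
    using ball eventually_gt_at_top[of 0]
  proof eventually_elim
    case (elim \<mu>)
    have "q + z \<mu> \<in> \<Omega> \<longleftrightarrow> deriv (deriv g) (\<xi> (x \<mu>)) / 2 * (x \<mu>)\<^sup>2 < w * (v / \<mu>\<^sup>2)"
      using chart_mem_iff_normal[OF ch qb q elim(1)] \<xi>(2)[of "x \<mu>"] on'
      by (simp add: w_def x_def[symmetric]) (simp add: z_def)
    also have "\<dots> \<longleftrightarrow> \<mu>\<^sup>2 * (deriv (deriv g) (\<xi> (x \<mu>)) / 2 * (x \<mu>)\<^sup>2) < \<mu>\<^sup>2 * (w * (v / \<mu>\<^sup>2))"
      using elim(2) by (subst mult_less_cancel_left_pos) auto
    finally show ?case using elim(2) by (simp add: power_mult_distrib mult_ac)
  qed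
  consider "chart_curvature e g q * u\<^sup>2 / 2 < v" | "v < chart_curvature e g q * u\<^sup>2 / 2" using v by linarith
  then show ?thesis
  proof cases
    case 1
    then have "w * (chart_curvature e g q * u\<^sup>2 / 2) < w * v" using w by (intro mult_strict_left_mono)
    from order_tendstoD(2)[OF lim this] iff show ?thesis
      by eventually_elim (use 1 in \<open>simp add: z_def\<close>)
  next
    case 2
    then have "w * v < w * (chart_curvature e g q * u\<^sup>2 / 2)" using w by (intro mult_strict_left_mono)
    from order_tendstoD(1)[OF lim this] iff show ?thesis
      by eventually_elim (use 2 in \<open>simp add: z_def\<close>)
  qed
qed

text \<open>The pointwise limit of \<open>scaled_defect_integrand\<close> as \<mu> tends to
  infinity, away from the line \<open>u = 0\<close> and the parabola. The condition selects the
  region between tangent and parabola for either sign of \<open>k\<close>.\<close>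

definition parabola_integrand :: "real \<Rightarrow> real \<times> real \<Rightarrow> real" where
  "parabola_integrand k = (\<lambda>(u, v). if (k * u\<^sup>2 / 2 < v) \<noteq> (0 < v) then \<bar>v\<bar> / u\<^sup>2 * exp (- \<bar>u\<bar>) else 0)"

lemma nn_integral_abs_between:
  fixes a :: real
  shows "(\<integral>\<^sup>+v. ennreal (if (a < v) \<noteq> (0 < v) then \<bar>v\<bar> else 0) \<partial>lborel) = ennreal (a\<^sup>2 / 2)"
proof -
  have "(\<integral>\<^sup>+v. ennreal (if (a < v) \<noteq> (0 < v) then \<bar>v\<bar> else 0) \<partial>lborel) =
      (\<integral>\<^sup>+v. ennreal \<bar>v\<bar> * indicator {min a 0..max a 0} v \<partial>lborel)"
    by (intro nn_integral_cong_AE) (use AE_lborel_singleton[of a] in eventually_elim, auto simp: indicator_def min_def max_def)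
  also have "\<dots> = ennreal ((\<lambda>v. v * \<bar>v\<bar> / 2) (max a 0) - (\<lambda>v. v * \<bar>v\<bar> / 2) (min a 0))"
  proof (rule nn_integral_FTC_Icc)
    have d: "((\<lambda>v::real. v * \<bar>v\<bar> / 2) has_real_derivative \<bar>v\<bar>) (at v)" for v
    proof -
      \<comment> \<open>Written with squares of positive parts, the antiderivative is differentiable
        at 0 as well.\<close>
      have "v * \<bar>v\<bar> / 2 = ((max 0 v)\<^sup>2 - (max 0 (- v))\<^sup>2) / 2" for v :: real
        by (auto simp: max_def power2_eq_square)
      moreover have "((\<lambda>v. (max 0 (- v))\<^sup>2) has_real_derivative 2 * max 0 (- v) * (- 1)) (at v)"
        by (rule DERIV_chain2[OF DERIV_max0_sq]) (auto intro!: derivative_eq_intros)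
      from DERIV_cdivide[OF DERIV_diff[OF DERIV_max0_sq this], of 2]
      have "((\<lambda>v. ((max 0 v)\<^sup>2 - (max 0 (- v))\<^sup>2) / 2) has_real_derivative \<bar>v\<bar>) (at v)"
        by (rule DERIV_cong) (auto simp: max_def)
      ultimately show ?thesis by simp
    qed
    show "DERIV (\<lambda>v::real. v * \<bar>v\<bar> / 2) v :> \<bar>v\<bar>" for v by (rule d)
  qed auto
  also have "\<dots> = ennreal (a\<^sup>2 / 2)"
    by (auto simp: max_def min_def power2_eq_square)
  finally show ?thesis .
qed

lemma nn_integral_sq_exp_abs: "(\<integral>\<^sup>+u. ennreal (u\<^sup>2 * exp (- \<bar>u\<bar>)) \<partial>lborel) = 4"
proof -
  have "(\<integral>\<^sup>+u. ennreal (u\<^sup>2 * exp (- \<bar>u\<bar>)) * indicator {0..} u \<partial>lborel) = (\<integral>\<^sup>+u. ennreal (u\<^sup>2 * exp (- u)) * indicator {0..} u \<partial>lborel)"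
    by (intro nn_integral_cong) (auto simp: indicator_def)
  also have "\<dots> = ennreal (0 - (- ((0\<^sup>2 + 2 * 0 + 2) * exp (- 0))))"
  proof (rule nn_integral_FTC_atLeast)
    show "DERIV (\<lambda>u. - ((u\<^sup>2 + 2 * u + 2) * exp (- u))) u :> u\<^sup>2 * exp (- u)" for u :: real
      by (auto intro!: derivative_eq_intros simp: algebra_simps)
    have "((\<lambda>u::real. - (u ^ 2 / exp u + 2 * (u ^ 1 / exp u) + 2 * (u ^ 0 / exp u))) \<longlongrightarrow> - (0 + 2 * 0 + 2 * 0)) at_top"
      by (intro tendsto_intros tendsto_power_div_exp_0)
    then show "((\<lambda>u::real. - ((u\<^sup>2 + 2 * u + 2) * exp (- u))) \<longlongrightarrow> 0) at_top"
      by (simp add: exp_minus divide_inverse distrib_right mult.assoc)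
  qed auto
  finally have "(\<integral>\<^sup>+u. ennreal (u\<^sup>2 * exp (- \<bar>u\<bar>)) * indicator {0..} u \<partial>lborel) = 2" by simp
  then show ?thesis by (subst nn_integral_even) auto
qed

lemma borel_measurable_parabola_integrand [measurable]:
  "parabola_integrand k \<in> borel_measurable (lborel \<Otimes>\<^sub>M lborel)"
proof -
  have "parabola_integrand k \<in> borel_measurable (borel \<Otimes>\<^sub>M borel)"
    unfolding parabola_integrand_def by measurable
  then show ?thesis by simp
qed

text \<open>Between 0 and a = k u^2 / 2 the integral of |v| is a^2 / 2 = k^2 u^4 / 8. Division by
  u^2 leaves k^2 / 8 times u^2 exp (- |u|), whose integral over the line is 4.\<close>

lemma integral_parabola_integrand:
  "(\<integral>p. parabola_integrand k p \<partial>(lborel \<Otimes>\<^sub>M lborel)) = k\<^sup>2 / 2"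
proof -
  have "(\<integral>\<^sup>+p. ennreal (parabola_integrand k p) \<partial>(lborel \<Otimes>\<^sub>M lborel)) =
      (\<integral>\<^sup>+u. \<integral>\<^sup>+v. ennreal (parabola_integrand k (u, v)) \<partial>lborel \<partial>lborel)"
    by (rule lborel.nn_integral_fst[symmetric]) measurable
  also have "\<dots> = (\<integral>\<^sup>+u. ennreal (k\<^sup>2 / 8) * ennreal (u\<^sup>2 * exp (- \<bar>u\<bar>)) \<partial>lborel)"
  proof (rule nn_integral_cong)
    fix u :: real
    have "(\<integral>\<^sup>+v. ennreal (parabola_integrand k (u, v)) \<partial>lborel) =
      (\<integral>\<^sup>+v. ennreal (exp (- \<bar>u\<bar>) / u\<^sup>2) * ennreal (if (k * u\<^sup>2 / 2 < v) \<noteq> (0 < v) then \<bar>v\<bar> else 0) \<partial>lborel)"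
      by (intro nn_integral_cong) (auto simp: parabola_integrand_def ennreal_mult[symmetric] mult.commute)
    also have "\<dots> = ennreal (exp (- \<bar>u\<bar>) / u\<^sup>2) * ennreal ((k * u\<^sup>2 / 2)\<^sup>2 / 2)"
      unfolding nn_integral_abs_between[symmetric] by (rule nn_integral_cmult) measurable
    also have "\<dots> = ennreal (k\<^sup>2 / 8) * ennreal (u\<^sup>2 * exp (- \<bar>u\<bar>))"
      by (simp add: ennreal_mult[symmetric]) (simp add: power2_eq_square field_simps)
    finally show "(\<integral>\<^sup>+v. ennreal (parabola_integrand k (u, v)) \<partial>lborel) = ennreal (k\<^sup>2 / 8) * ennreal (u\<^sup>2 * exp (- \<bar>u\<bar>))" .
  qed
  also have "\<dots> = ennreal (k\<^sup>2 / 8) * 4"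
    by (subst nn_integral_cmult) (auto simp: nn_integral_sq_exp_abs)
  also have "\<dots> = ennreal (k\<^sup>2 / 2)"
    by (simp add: ennreal_numeral[symmetric] ennreal_mult[symmetric] del: ennreal_numeral)
  finally show ?thesis
    by (subst integral_eq_nn_integral) (auto simp: parabola_integrand_def split_beta')
qed

lemma half_plane_defect_tendsto:
  assumes reg: "regular_set \<Omega>" and q: "q \<in> frontier \<Omega>"
  shows "((\<lambda>\<mu>. \<mu> ^ 3 * half_plane_defect \<Omega> \<mu> q) \<longlongrightarrow> (curvature \<Omega> q)\<^sup>2 / 2) at_top"
proof -
  obtain r e n g where ch: "chart \<Omega> q r e n g" by (rule regular_set_chart[OF reg q])
  have qb: "q \<in> ball q r" using chartD(1)[OF ch] by simp
  let ?k = "chart_curvature e g q"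
  have k: "curvature \<Omega> q = ?k" by (rule curvature_chart[OF ch qb q])
  obtain \<tau> where on: "orthonormal_pair \<tau> (inner_normal \<Omega> q)"
    by (rule orthonormal_pair_exists[OF regular_set_inner_normal(2)[OF reg q]])
  obtain C where C: "0 < C" "\<And>q z. q \<in> frontier \<Omega> \<Longrightarrow> z \<in> mismatch \<Omega> q \<Longrightarrow>
    \<bar>z \<bullet> inner_normal \<Omega> q\<bar> \<le> C * (norm z)\<^sup>2" by (rule defect_region_bound[OF reg]) blast
  have "((\<lambda>\<mu>. \<integral>p. scaled_defect_integrand \<Omega> q \<tau> \<mu> p \<partial>(lborel \<Otimes>\<^sub>M lborel)) \<longlongrightarrow>
      (\<integral>p. parabola_integrand ?k p \<partial>(lborel \<Otimes>\<^sub>M lborel))) at_top"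
  proof (rule integral_dominated_convergence_at_top[where w="defect_majorant C"])
    show "\<forall>\<^sub>F \<mu> in at_top. AE p in lborel \<Otimes>\<^sub>M lborel. norm (scaled_defect_integrand \<Omega> q \<tau> \<mu> p) \<le> defect_majorant C p"
      using eventually_gt_at_top[of 0]
      by eventually_elim (intro always_eventually allI scaled_defect_integrand_le C q on)
    have lim: "((\<lambda>\<mu>. scaled_defect_integrand \<Omega> q \<tau> \<mu> (u, v)) \<longlongrightarrow> parabola_integrand ?k (u, v)) at_top"
      \<comment> \<open>At \<open>u = 0\<close> the limit of the quotient is singular, and on the
        parabola membership is undecided; both sets are null.\<close>
      if u: "u \<noteq> 0" and v: "v \<noteq> ?k * u\<^sup>2 / 2" for u v
    proof -
      have ev: "\<forall>\<^sub>F \<mu> in at_top. (if (?k * u\<^sup>2 / 2 < v) \<noteq> (0 < v) then \<bar>v\<bar> / (u\<^sup>2 + (v / \<mu>)\<^sup>2) * exp (- sqrt (u\<^sup>2 + (v / \<mu>)\<^sup>2)) else 0) =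
          scaled_defect_integrand \<Omega> q \<tau> \<mu> (u, v)"
        using chart_mem_scaled_eventually[OF ch q on v]
        by eventually_elim (simp add: scaled_defect_integrand_def)
      have iv: "((\<lambda>\<mu>::real. v / \<mu>) \<longlongrightarrow> 0) at_top"
        by (rule tendsto_divide_0[OF tendsto_const filterlim_at_top_imp_at_infinity[OF filterlim_ident]])
      have "((\<lambda>\<mu>. \<bar>v\<bar> / (u\<^sup>2 + (v / \<mu>)\<^sup>2) * exp (- sqrt (u\<^sup>2 + (v / \<mu>)\<^sup>2))) \<longlongrightarrow> \<bar>v\<bar> / (u\<^sup>2 + 0\<^sup>2) * exp (- sqrt (u\<^sup>2 + 0\<^sup>2))) at_top"
        using u by (intro tendsto_intros iv) auto
      then have "((\<lambda>\<mu>. if (?k * u\<^sup>2 / 2 < v) \<noteq> (0 < v) then \<bar>v\<bar> / (u\<^sup>2 + (v / \<mu>)\<^sup>2) * exp (- sqrt (u\<^sup>2 + (v / \<mu>)\<^sup>2)) else 0) \<longlongrightarrow>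
          parabola_integrand ?k (u, v)) at_top"
        by (simp add: parabola_integrand_def)
      then show ?thesis by (rule Lim_transform_eventually[OF _ ev])
    qed
    have m: "{p \<in> space (lborel \<Otimes>\<^sub>M lborel). fst p \<noteq> 0 \<and> snd p \<noteq> ?k * (fst p)\<^sup>2 / 2} \<in> sets (lborel \<Otimes>\<^sub>M (lborel :: real measure))"
      by measurable
    have "AE p in lborel \<Otimes>\<^sub>M lborel. fst p \<noteq> 0 \<and> snd p \<noteq> ?k * (fst p)\<^sup>2 / 2"
    proof (rule lborel_pair.AE_pair_measure[OF m])
      show "AE u in lborel. AE v in lborel. fst (u, v) \<noteq> 0 \<and> snd (u, v) \<noteq> ?k * (fst (u, v))\<^sup>2 / 2"
        using AE_lborel_singleton[of "0::real"]
      proof eventually_elim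
        case (elim u)
        show ?case using AE_lborel_singleton[of "?k * u\<^sup>2 / 2"] by eventually_elim (use elim in auto)
      qed
    qed
    then show "AE p in lborel \<Otimes>\<^sub>M lborel. ((\<lambda>\<mu>. scaled_defect_integrand \<Omega> q \<tau> \<mu> p) \<longlongrightarrow> parabola_integrand ?k p) at_top"
      by eventually_elim (use lim in \<open>auto simp: split_paired_all\<close>)
    show "integrable (lborel \<Otimes>\<^sub>M lborel) (defect_majorant C)" by (rule integrable_defect_majorant[OF C(1)])
    show "scaled_defect_integrand \<Omega> q \<tau> \<mu> \<in> borel_measurable (lborel \<Otimes>\<^sub>M lborel)" for \<mu>
      by (rule borel_measurable_scaled_defect_integrand[OF reg])
  qed measurable
  moreover have "\<forall>\<^sub>F \<mu> in at_top. (\<integral>p. scaled_defect_integrand \<Omega> q \<tau> \<mu> p \<partial>(lborel \<Otimes>\<^sub>M lborel)) = \<mu> ^ 3 * half_plane_defect \<Omega> \<mu> q"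
    using eventually_gt_at_top[of 0] by eventually_elim (simp add: half_plane_defect_scaled[OF reg _ q on])
  ultimately show ?thesis
    unfolding integral_parabola_integrand k by (rule Lim_transform_eventually)
qed

text \<open>The constant in the majorant is the same for all boundary points, so its integral is a
  constant majorant for the second passage to the limit, along the boundary.\<close>

lemma half_plane_defect_scaled_bounded:
  assumes reg: "regular_set \<Omega>"
  obtains B where "\<And>\<mu> q. 0 < \<mu> \<Longrightarrow> q \<in> frontier \<Omega> \<Longrightarrow> \<mu> ^ 3 * half_plane_defect \<Omega> \<mu> q \<le> B"
proof -
  obtain C where C: "0 < C" "\<And>q z. q \<in> frontier \<Omega> \<Longrightarrow> z \<in> mismatch \<Omega> q \<Longrightarrow>
    \<bar>z \<bullet> inner_normal \<Omega> q\<bar> \<le> C * (norm z)\<^sup>2" by (rule defect_region_bound[OF reg]) blast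
  have "\<mu> ^ 3 * half_plane_defect \<Omega> \<mu> q \<le> (\<integral>p. defect_majorant C p \<partial>(lborel \<Otimes>\<^sub>M lborel))"
    if \<mu>: "0 < \<mu>" and q: "q \<in> frontier \<Omega>" for \<mu> q
  proof -
    obtain \<tau> where on: "orthonormal_pair \<tau> (inner_normal \<Omega> q)"
      by (rule orthonormal_pair_exists[OF regular_set_inner_normal(2)[OF reg q]])
    have le: "norm (scaled_defect_integrand \<Omega> q \<tau> \<mu> p) \<le> defect_majorant C p" for p
      by (intro scaled_defect_integrand_le C q on \<mu>)
    have "integrable (lborel \<Otimes>\<^sub>M lborel) (scaled_defect_integrand \<Omega> q \<tau> \<mu>)"
      by (rule Bochner_Integration.integrable_bound[OF integrable_defect_majorant[OF C(1)]
          borel_measurable_scaled_defect_integrand[OF reg]]) (intro always_eventually allI order_trans[OF le], simp)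
    then show ?thesis
      unfolding half_plane_defect_scaled[OF reg \<mu> q on]
      using le by (intro integral_mono integrable_defect_majorant C) (auto intro: order_trans[OF abs_ge_self])
  qed
  then show ?thesis by (rule that)
qed

lemma integral_half_plane_defect_tendsto:
  assumes reg: "regular_set \<Omega>"
  shows "((\<lambda>\<mu>. \<integral>q. \<mu> ^ 3 * half_plane_defect \<Omega> \<mu> q \<partial>boundary_measure \<Omega>) \<longlongrightarrow>
    (LINT q:frontier \<Omega>|hausdorff1. (curvature \<Omega> q)\<^sup>2) / 2) at_top"
proof -
  interpret finite_measure "boundary_measure \<Omega>" by (rule finite_boundary_measure[OF reg])
  define k where "k q = indicator (frontier \<Omega>) q * (curvature \<Omega> q)\<^sup>2" for q
  let ?f = "\<lambda>\<mu> q. indicator (frontier \<Omega>) q * (\<mu> ^ 3 * half_plane_defect \<Omega> \<mu> q)"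
  have [measurable]: "half_plane_defect \<Omega> \<mu> \<in> borel_measurable borel" for \<mu>
    by (rule borel_measurable_half_plane_defect[OF reg])
  have lim: "((\<lambda>\<mu>. ?f \<mu> q) \<longlongrightarrow> k q / 2) at_top" for q
  proof (cases "q \<in> frontier \<Omega>")
    case True
    then show ?thesis using half_plane_defect_tendsto[OF reg True] by (simp add: k_def)
  qed (simp add: k_def)
  \<comment> \<open>\<open>curvature\<close> is defined by \<open>THE\<close>, so the measurability
    of its square on the frontier is obtained from a pointwise limit of measurable functions along
    the integers.\<close>
  have k2 [measurable]: "(\<lambda>q. k q / 2) \<in> borel_measurable borel"
  proof (rule borel_measurable_LIMSEQ_real)
    show "(\<lambda>i. ?f (real i) q) \<longlonglongrightarrow> k q / 2" for q
      using filterlim_compose[OF lim filterlim_real_sequentially] .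
  qed measurable
  then have km [measurable]: "k \<in> borel_measurable borel"
    using borel_measurable_times[OF borel_measurable_const[of 2] k2] by simp
  obtain B where B: "\<And>\<mu> q. 0 < \<mu> \<Longrightarrow> q \<in> frontier \<Omega> \<Longrightarrow> \<mu> ^ 3 * half_plane_defect \<Omega> \<mu> q \<le> B"
    by (rule half_plane_defect_scaled_bounded[OF reg]) blast
  have "((\<lambda>\<mu>. \<integral>q. \<mu> ^ 3 * half_plane_defect \<Omega> \<mu> q \<partial>boundary_measure \<Omega>) \<longlongrightarrow> (\<integral>q. k q / 2 \<partial>boundary_measure \<Omega>)) at_top"
  proof (rule integral_dominated_convergence_at_top[where w="\<lambda>_. B"])
    show "AE q in boundary_measure \<Omega>. ((\<lambda>\<mu>. \<mu> ^ 3 * half_plane_defect \<Omega> \<mu> q) \<longlongrightarrow> k q / 2) at_top"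
      using AE_boundary_measure
      by eventually_elim (use half_plane_defect_tendsto[OF reg] in \<open>simp add: k_def\<close>)
    show "\<forall>\<^sub>F \<mu> in at_top. AE q in boundary_measure \<Omega>. norm (\<mu> ^ 3 * half_plane_defect \<Omega> \<mu> q) \<le> B"
      using eventually_gt_at_top[of 0]
    proof eventually_elim
      case (elim \<mu>)
      show ?case using AE_boundary_measure
        by eventually_elim (use B elim half_plane_defect_bounds(1)[OF reg elim] in \<open>simp add: abs_mult\<close>)
    qed
  qed simp_all
  moreover have "(\<integral>q. k q / 2 \<partial>boundary_measure \<Omega>) = (LINT q:frontier \<Omega>|hausdorff1. (curvature \<Omega> q)\<^sup>2) / 2"
  proof -
    have "boundary_measure \<Omega> = density hausdorff1 (\<lambda>q. ennreal (indicator (frontier \<Omega>) q))"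
      by (simp add: boundary_measure_def ennreal_indicator)
    then have "(\<integral>q. k q \<partial>boundary_measure \<Omega>) = (\<integral>q. indicator (frontier \<Omega>) q *\<^sub>R k q \<partial>hausdorff1)"
      by (simp only:, subst integral_density) auto
    also have "\<dots> = (LINT q:frontier \<Omega>|hausdorff1. (curvature \<Omega> q)\<^sup>2)"
      unfolding set_lebesgue_integral_def
      by (intro Bochner_Integration.integral_cong) (auto simp: k_def indicator_def)
    finally show ?thesis by simp
  qed
  ultimately show ?thesis by simp
qed

text \<open>The perimeter terms cancel identically for every \<open>l > 0\<close>. What remains,
  multiplied by \<open>l\<^sup>2\<close>, is a constant multiple of the scaled defect integral at
  \<open>\<mu> = l * \<alpha>\<close> minus its limit.\<close>

theorem proposition2p3:
  fixes \<alpha> :: real and \<Omega> :: "(real^2) set"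
  assumes "\<alpha> > 0" and "regular_set \<Omega>"
  shows "(\<lambda>l. energy l \<alpha> \<Omega> -
            ((1 - 1 / (2 * pi * \<alpha>\<^sup>2)) * enn2real (perimeter \<Omega>) +
             1 / (8 * pi * \<alpha> ^ 4 * l\<^sup>2) * (LINT p:frontier \<Omega>|hausdorff1. (curvature \<Omega> p)\<^sup>2)))
         \<in> o[at_top](\<lambda>l::real. 1 / l\<^sup>2)"
    (is "?f \<in> _")
proof (rule smalloI_tendsto)
  let ?K = "LINT p:frontier \<Omega>|hausdorff1. (curvature \<Omega> p)\<^sup>2"
  let ?I = "\<lambda>\<mu>. \<integral>q. \<mu> ^ 3 * half_plane_defect \<Omega> \<mu> q \<partial>boundary_measure \<Omega>"
  let ?P = "measure (boundary_measure \<Omega>) UNIV"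
  note \<alpha> = assms(1) and reg = assms(2)
  have P: "enn2real (perimeter \<Omega>) = ?P" by (simp add: perimeter_eq_boundary_measure[OF reg])
  show "\<forall>\<^sub>F l::real in at_top. 1 / l\<^sup>2 \<noteq> 0" using eventually_gt_at_top[of 0] by eventually_elim simp
  have "LIM l at_top. l * \<alpha> :> at_top"
    using \<alpha> by (intro filterlim_at_top_mult_tendsto_pos[OF tendsto_const _ filterlim_ident])
  from filterlim_compose[OF integral_half_plane_defect_tendsto[OF reg] this]
  \<comment> \<open>The defect enters the energy with the factor l^2 / (4 pi) times 1 / (l alpha).
    Multiplication by l^2 gives l^3 / (4 pi alpha), which is (l alpha)^3 / (4 pi alpha^4).\<close>
  have "((\<lambda>l. 1 / (4 * pi * \<alpha> ^ 4) * ?I (l * \<alpha>) - 1 / (8 * pi * \<alpha> ^ 4) * ?K) \<longlongrightarrow>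
      1 / (4 * pi * \<alpha> ^ 4) * (?K / 2) - 1 / (8 * pi * \<alpha> ^ 4) * ?K) at_top"
    by (intro tendsto_intros)
  then have lim: "((\<lambda>l. 1 / (4 * pi * \<alpha> ^ 4) * ?I (l * \<alpha>) - 1 / (8 * pi * \<alpha> ^ 4) * ?K) \<longlongrightarrow> 0) at_top" by simp
  have "\<forall>\<^sub>F l in at_top. 1 / (4 * pi * \<alpha> ^ 4) * ?I (l * \<alpha>) - 1 / (8 * pi * \<alpha> ^ 4) * ?K = ?f l / (1 / l\<^sup>2)"
    using eventually_gt_at_top[of 0]
  proof eventually_elim
    case (elim l)
    let ?W = "\<integral>q. half_plane_defect \<Omega> (l * \<alpha>) q \<partial>boundary_measure \<Omega>"
    have I: "?I (l * \<alpha>) = (l * \<alpha>) ^ 3 * ?W" by simp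
    have e: "energy l \<alpha> \<Omega> = ?P - l\<^sup>2 / (4 * pi) * (2 / (l * \<alpha>)\<^sup>2 * ?P - 1 / (l * \<alpha>) * ?W)"
      unfolding energy_def P using nonlocal_energy_eq[OF reg, of "l * \<alpha>"] elim \<alpha> by simp
    have "l\<^sup>2 / (4 * pi) * (2 / (l * \<alpha>)\<^sup>2 * ?P - 1 / (l * \<alpha>) * ?W) = 1 / (2 * pi * \<alpha>\<^sup>2) * ?P - l / (4 * pi * \<alpha>) * ?W"
      using elim \<alpha> by (simp add: field_simps power2_eq_square)
    then have f: "?f l = l / (4 * pi * \<alpha>) * ?W - 1 / (8 * pi * \<alpha> ^ 4 * l\<^sup>2) * ?K"
      unfolding e P by (simp add: left_diff_distrib)
    have "?f l * l\<^sup>2 = (l / (4 * pi * \<alpha>) * l\<^sup>2) * ?W - (1 / (8 * pi * \<alpha> ^ 4 * l\<^sup>2) * l\<^sup>2) * ?K"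
      unfolding f by (simp add: left_diff_distrib)
    also have "l / (4 * pi * \<alpha>) * l\<^sup>2 = 1 / (4 * pi * \<alpha> ^ 4) * (l * \<alpha>) ^ 3"
      using elim \<alpha> by (simp add: field_simps power2_eq_square power3_eq_cube power4_eq_xxxx)
    also have "1 / (8 * pi * \<alpha> ^ 4 * l\<^sup>2) * l\<^sup>2 = 1 / (8 * pi * \<alpha> ^ 4)" using elim by simp
    finally show ?case unfolding I by (simp add: mult.assoc)
  qed
  from Lim_transform_eventually[OF lim this]
  show "((\<lambda>l. ?f l / (1 / l\<^sup>2)) \<longlongrightarrow> 0) at_top" .
qed

end
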